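(* The ordered monomials $X_{11}^{a_{11}}X_{12}^{a_{12}}\cdots X_{1,2n}^{a_{1,2n}}X_{21}^{a_{21}}\cdots X_{2,2n}^{a_{2,2n}}$ ($a_{ij}\in\mathbb Z_{\ge0}$) form a $k$-basis of $\mathbb X_{n,q}$, and $\mathbb X_{n,q}$ is an iterated Ore extension $$\mathbb X_{n,q}=k[X_{11}][X_{12};\tau_{12},\delta_{12}]\cdots[X_{1,2n};\tau_{1,2n},\delta_{1,2n}][X_{21};\tau_{21},\delta_{21}]\cdots[X_{2,2n};\tau_{2,2n},\delta_{2,2n}]$$ for suitable automorphisms $\tau_{ij}$ and $\tau_{ij}$-derivations $\delta_{ij}$.
   Context: $k$ algebraically closed of characteristic $0$, $q\in k^\times$ transcendental over $\mathbb Q$, $\hat q=q-q^{-1}$, $n\ge3$, and $s'=2n+1-s$. $\mathbb X_{n,q}$ is the $k$-algebra generated by $X_{ij}$ ($i\in\{1,2\}$, $1\le j\le 2n$) with defining relations (indices in $\{1,\dots,2n\}$): $X_{rt}X_{rs}=q^{-1}X_{rs}X_{rt}$ ($r\in\{1,2\}$, $s<t$, $t\ne s'$); $X_{rs'}X_{rs}=X_{rs}X_{rs'}+\hat q\sum_{l=s+1}^nq^{l-s-1}X_{rl}X_{rl'}$ ($r\in\{1,2\}$, $s<s'$); $X_{2s}X_{1s}=q^{-1}X_{1s}X_{2s}$; $X_{2s}X_{1t}=X_{1t}X_{2s}$ ($s<t$, $t\ne s'$); $X_{2t}X_{1s}=X_{1s}X_{2t}-\hat qX_{1t}X_{2s}$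 ($s<t$, $t\ne s'$); $X_{2s}X_{1s'}=qX_{1s'}X_{2s}+\hat q\sum_{l=1}^{s-1}q^{s-l}X_{1l'}X_{2l}$ ($s<s'$); $X_{2s'}X_{1s}=qX_{1s}X_{2s'}+\hat q\sum_{l=s+1}^nq^{l-s}X_{1l}X_{2l'}+\hat qq^{-1}\sum_{l=1}^nq^{l'-s}X_{1l'}X_{2l}-\hat qX_{1s'}X_{2s}$ ($s<s'$). *)

theory Defs
  imports "HOL-Algebra.QuotRing" "HOL-Computational_Algebra.Polynomial"
begin

text \<open>A generator X_ij is encoded by the pair (i,j). Elements of the free associative
  k-algebra are functions from words (lists of generators) to k; the carrier consists
  of the finitely supported ones whose words only use the generators
  X_ij with i in {1,2}, 1 <= j <= 2n.\<close>

type_synonym gen = "nat \<times> nat"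
type_synonym 'k fa = "gen list \<Rightarrow> 'k"

definition gens :: "nat \<Rightarrow> gen set" where
  "gens n = {1,2} \<times> {1..2*n}"

definition FA :: "nat \<Rightarrow> ('k::field) fa set" where
  "FA n = {f. finite {w. f w \<noteq> 0} \<and> (\<forall>w. f w \<noteq> 0 \<longrightarrow> set w \<subseteq> gens n)}"

definition fa_mult :: "('k::field) fa \<Rightarrow> 'k fa \<Rightarrow> 'k fa" where
  "fa_mult f g = (\<lambda>w. \<Sum>i\<le>length w. f (take i w) * g (drop i w))"

definition fa_add :: "('k::field) fa \<Rightarrow> 'k fa \<Rightarrow> 'k fa" where
  "fa_add f g = (\<lambda>w. f w + g w)"

definition fa_sub :: "('k::field) fa \<Rightarrow> 'k fa \<Rightarrow> 'k fa" where
  "fa_sub f g = (\<lambda>w. f w - g w)"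

definition fa_smult :: "'k::field \<Rightarrow> 'k fa \<Rightarrow> 'k fa" where
  "fa_smult c f = (\<lambda>w. c * f w)"

definition fa_sum :: "('i \<Rightarrow> ('k::field) fa) \<Rightarrow> 'i set \<Rightarrow> 'k fa" where
  "fa_sum F S = (\<lambda>w. \<Sum>i\<in>S. F i w)"

definition fa_word :: "gen list \<Rightarrow> ('k::field) fa" where
  "fa_word w = (\<lambda>u. if u = w then 1 else 0)"

definition fa_scal :: "'k::field \<Rightarrow> 'k fa" where
  "fa_scal c = fa_smult c (fa_word [])"

definition free_alg :: "nat \<Rightarrow> ('k::field) fa ring" where
  "free_alg n = \<lparr>carrier = FA n, monoid.mult = fa_mult, one = fa_word [],
                 zero = (\<lambda>_. 0), add = fa_add\<rparr>"

definition X2 :: "gen \<Rightarrow> gen \<Rightarrow> ('k::field) fa" where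
  "X2 a b = fa_word [a, b]"

text \<open>Each relation LHS = RHS is encoded as the element LHS - RHS. Here s' = 2n+1-s,
  qh = q - q^{-1}; the condition s < s' is equivalent to s <= n.\<close>
definition relations :: "nat \<Rightarrow> 'k::field \<Rightarrow> 'k fa set" where
  "relations n q = (let qh = q - inverse q; p = (\<lambda>s. 2*n + 1 - s) in
     {fa_sub (X2 (r,t) (r,s)) (fa_smult (inverse q) (X2 (r,s) (r,t))) | r s t.
        r \<in> {1,2} \<and> 1 \<le> s \<and> s < t \<and> t \<le> 2*n \<and> t \<noteq> p s}
   \<union> {fa_sub (X2 (r, p s) (r,s))
        (fa_add (X2 (r,s) (r, p s))
          (fa_smult qh (fa_sum (\<lambda>l. fa_smult (q ^ (l - s - 1)) (X2 (r,l) (r, p l))) {s+1..n})))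
      | r s. r \<in> {1,2} \<and> 1 \<le> s \<and> s \<le> n}
   \<union> {fa_sub (X2 (2,s) (1,s)) (fa_smult (inverse q) (X2 (1,s) (2,s))) | s. 1 \<le> s \<and> s \<le> 2*n}
   \<union> {fa_sub (X2 (2,s) (1,t)) (X2 (1,t) (2,s)) | s t.
        1 \<le> s \<and> s < t \<and> t \<le> 2*n \<and> t \<noteq> p s}
   \<union> {fa_sub (X2 (2,t) (1,s)) (fa_sub (X2 (1,s) (2,t)) (fa_smult qh (X2 (1,t) (2,s)))) | s t.
        1 \<le> s \<and> s < t \<and> t \<le> 2*n \<and> t \<noteq> p s}
   \<union> {fa_sub (X2 (2,s) (1, p s))
        (fa_add (fa_smult q (X2 (1, p s) (2,s)))
          (fa_smult qh (fa_sum (\<lambda>l. fa_smult (q ^ (s - l)) (X2 (1, p l) (2,l))) {1..s-1})))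
      | s. 1 \<le> s \<and> s \<le> n}
   \<union> {fa_sub (X2 (2, p s) (1,s))
        (fa_sub
          (fa_add (fa_smult q (X2 (1,s) (2, p s)))
            (fa_add
              (fa_smult qh (fa_sum (\<lambda>l. fa_smult (q ^ (l - s)) (X2 (1,l) (2, p l))) {s+1..n}))
              (fa_smult (qh * inverse q)
                 (fa_sum (\<lambda>l. fa_smult (q ^ (p l - s)) (X2 (1, p l) (2,l))) {1..n}))))
          (fa_smult qh (X2 (1, p s) (2,s))))
      | s. 1 \<le> s \<and> s \<le> n})"

definition rel_ideal :: "nat \<Rightarrow> 'k::field \<Rightarrow> 'k fa set" where
  "rel_ideal n q = genideal (free_alg n) (relations n q)"

definition Xalg :: "nat \<Rightarrow> 'k::field \<Rightarrow> 'k fa set ring" where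
  "Xalg n q = free_alg n Quot rel_ideal n q"

definition cls :: "nat \<Rightarrow> 'k::field \<Rightarrow> 'k fa \<Rightarrow> 'k fa set" where
  "cls n q f = rel_ideal n q +>\<^bsub>free_alg n\<^esub> f"

definition gen_list :: "nat \<Rightarrow> gen list" where
  "gen_list n = map (\<lambda>j. (1,j)) [1..<2*n+1] @ map (\<lambda>j. (2,j)) [1..<2*n+1]"

text \<open>Exponent vectors (a_11,...,a_1,2n,a_21,...,a_2,2n), listed in the above order.\<close>
definition exps :: "nat \<Rightarrow> nat list set" where
  "exps n = {a. length a = 4*n}"

definition ord_word :: "nat \<Rightarrow> nat list \<Rightarrow> gen list" where
  "ord_word n a = concat (map2 replicate a (gen_list n))"

definition ordered_monomials_basis :: "nat \<Rightarrow> 'k::field \<Rightarrow> bool" where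
  "ordered_monomials_basis n q \<longleftrightarrow>
     (\<forall>f \<in> FA n. \<exists>S c. finite S \<and> S \<subseteq> exps n \<and>
        cls n q f = cls n q (fa_sum (\<lambda>a. fa_smult (c a) (fa_word (ord_word n a))) S)) \<and>
     (\<forall>S c. finite S \<and> S \<subseteq> exps n \<and>
        fa_sum (\<lambda>a. fa_smult (c a) (fa_word (ord_word n a))) S \<in> rel_ideal n q
        \<longrightarrow> (\<forall>a\<in>S. c a = 0))"

definition subalg :: "nat \<Rightarrow> 'k::field \<Rightarrow> nat \<Rightarrow> 'k fa set set" where
  "subalg n q m = {cls n q f | f. f \<in> FA n \<and>
      (\<forall>w. f w \<noteq> 0 \<longrightarrow> set w \<subseteq> set (take m (gen_list n)))}"

text \<open>B is the Ore extension A[x; tau, delta] inside the k-algebra Q (with k embedded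
  via sc): tau is a k-algebra automorphism of A, delta is a k-linear tau-derivation of A,
  x a = tau(a) x + delta(a) for a in A, and B is a free left A-module with basis the
  powers of x.\<close>
definition ore_extension :: "('a, 'b) ring_scheme \<Rightarrow> ('k \<Rightarrow> 'a) \<Rightarrow> 'a set \<Rightarrow> 'a set \<Rightarrow> 'a
    \<Rightarrow> ('a \<Rightarrow> 'a) \<Rightarrow> ('a \<Rightarrow> 'a) \<Rightarrow> bool" where
  "ore_extension Q sc A B x \<tau> \<delta> \<longleftrightarrow>
     \<tau> \<in> ring_hom (Q\<lparr>carrier := A\<rparr>) (Q\<lparr>carrier := A\<rparr>) \<and> bij_betw \<tau> A A \<and>
     (\<forall>c. \<tau> (sc c) = sc c) \<and>
     \<delta> \<in> A \<rightarrow> A \<and>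
     (\<forall>a\<in>A. \<forall>b\<in>A. \<delta> (a \<oplus>\<^bsub>Q\<^esub> b) = \<delta> a \<oplus>\<^bsub>Q\<^esub> \<delta> b) \<and>
     (\<forall>a\<in>A. \<forall>b\<in>A. \<delta> (a \<otimes>\<^bsub>Q\<^esub> b) = (\<tau> a \<otimes>\<^bsub>Q\<^esub> \<delta> b) \<oplus>\<^bsub>Q\<^esub> (\<delta> a \<otimes>\<^bsub>Q\<^esub> b)) \<and>
     (\<forall>c. \<forall>a\<in>A. \<delta> (sc c \<otimes>\<^bsub>Q\<^esub> a) = sc c \<otimes>\<^bsub>Q\<^esub> \<delta> a) \<and>
     (\<forall>a\<in>A. x \<otimes>\<^bsub>Q\<^esub> a = (\<tau> a \<otimes>\<^bsub>Q\<^esub> x) \<oplus>\<^bsub>Q\<^esub> \<delta> a) \<and>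
     B = {finsum Q (\<lambda>j. f j \<otimes>\<^bsub>Q\<^esub> x [^]\<^bsub>Q\<^esub> (j::nat)) {..<N} | N f. f \<in> {..<N} \<rightarrow> A} \<and>
     (\<forall>N f. f \<in> {..<N} \<rightarrow> A \<longrightarrow>
        finsum Q (\<lambda>j. f j \<otimes>\<^bsub>Q\<^esub> x [^]\<^bsub>Q\<^esub> (j::nat)) {..<N} = \<zero>\<^bsub>Q\<^esub> \<longrightarrow>
        (\<forall>j<N. f j = \<zero>\<^bsub>Q\<^esub>))"

definition iterated_ore :: "nat \<Rightarrow> 'k::field \<Rightarrow> bool" where
  "iterated_ore n q \<longleftrightarrow>
     subalg n q 0 = range (\<lambda>c. cls n q (fa_scal c)) \<and>
     subalg n q (4*n) = carrier (Xalg n q) \<and>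
     (\<forall>m < 4*n. \<exists>\<tau> \<delta>. ore_extension (Xalg n q) (\<lambda>c. cls n q (fa_scal c))
        (subalg n q m) (subalg n q (Suc m)) (cls n q (fa_word [gen_list n ! m])) \<tau> \<delta>)"

definition alg_closed :: "'k::field itself \<Rightarrow> bool" where
  "alg_closed _ \<longleftrightarrow> (\<forall>p :: 'k poly. degree p > 0 \<longrightarrow> (\<exists>x. poly p x = 0))"

definition transcendental_over_Q :: "'k::field_char_0 \<Rightarrow> bool" where
  "transcendental_over_Q q \<longleftrightarrow>
     (\<forall>p :: rat poly. p \<noteq> 0 \<longrightarrow> poly (map_poly of_rat p) q \<noteq> 0)"

end

theory Submission
  imports Defs "HOL-Algebra.Subrings"
begin

text \<open>
  Every product of a later generator \<open>x\<close> by an earlier generator \<open>y\<close> is, by a defining relation, a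
  nonzero multiple of \<open>y x\<close> plus quadratic terms in generators before \<open>x\<close>. Hence the ordered monomials
  span, and once they are independent each subalgebra extended by \<open>x\<close> is a free left module on the
  powers of \<open>x\<close>, which gives \<open>\<tau>\<close> and \<open>\<delta>\<close> by uniqueness of coefficients.

  Independence is proved by exhibiting enough linear functionals on words that vanish on the relation
  ideal. The mixed relations express \<open>X\<^sub>2\<^sub>a X\<^sub>1\<^sub>b\<close> through products \<open>X\<^sub>1\<^sub>c X\<^sub>2\<^sub>d\<close> by one uniform rule, so a
  functional is determined by its values on products of a first-row word by a second-row word. A product
  of functionals killing the relations of each row stays compatible with the exchange rule because the
  overlaps of degree three resolve. The functionals on one row come from operators on Laurent monomials:
  with \<open>\<Omega>\<^sub>s\<close> the sum of \<open>q\<^bsup>l-s-1\<^esup> X\<^sub>l X\<^sub>l\<^sub>'\<close> over \<open>s < l \<le> n\<close>, one has \<open>X\<^sub>s X\<^sub>s\<^sub>' = \<Omega>\<^sub>s\<^sub>-\<^sub>1 - q \<Omega>\<^sub>s\<close> and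
  \<open>X\<^sub>s\<^sub>' X\<^sub>s = \<Omega>\<^sub>s\<^sub>-\<^sub>1 - q\<^sup>-\<^sup>1 \<Omega>\<^sub>s\<close>, where the \<open>X\<^sub>s\<close> and \<open>\<Omega>\<^sub>s\<close> commute up to powers of \<open>q\<close>.
\<close>

section \<open>Ore extensions inside a ring\<close>

text \<open>Building the tower stage by stage would mean defining every \<open>\<tau>\<close> and
  \<open>\<delta>\<close> on generators and checking them against all relations of the previous
  stage. The order is reversed here: freeness is settled for all stages at once, so all hard
  computation sits in the independence of the ordered words, and there in the overlaps of degree
  three.

  The exchange rule between the rows has the shape of the standard R-matrix of the even orthogonal
  series: a diagonal part, a swap with factor \<open>- qh\<close>, and a correction supported on
  dual pairs. This is the origin of \<open>v\<close>: its exponents, lowered by \<open>n\<close>,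
  are 1-n, ..., -1, 0, 0, 1, ..., n-1, with the value 0 twice in the middle. The correction is the
  obstacle: it produces sums over dual pairs, which meet row relations that are themselves sums over
  dual pairs.

  Inside one row the dual pairs do not commute up to a scalar, so a sorted word acts on the Laurent
  model by several terms. These share the exponent \<open>\<alpha>\<close> and differ only in
  \<open>\<beta>\<close>. The functionals therefore separate words only triangularly, which is why a
  grading by level is introduced.\<close>

definition left_polys :: "('a, 'b) ring_scheme \<Rightarrow> 'a set \<Rightarrow> 'a \<Rightarrow> 'a set" where
  "left_polys Q A x = {finsum Q (\<lambda>j. f j \<otimes>\<^bsub>Q\<^esub> x [^]\<^bsub>Q\<^esub> (j::nat)) {..<N} | N f. f \<in> {..<N} \<rightarrow> A}"

locale ore_data = ring Q for Q :: "('a, 'b) ring_scheme" (structure) +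
  fixes A :: "'a set" and x :: 'a
  assumes sub: "subring A Q" and x: "x \<in> carrier Q"
    and comm: "\<And>a. a \<in> A \<Longrightarrow> \<exists>b\<in>A. \<exists>d\<in>A. x \<otimes> a = (b \<otimes> x) \<oplus> d"
begin

abbreviation "P \<equiv> left_polys Q A x"

lemma Acarr: "a \<in> A \<Longrightarrow> a \<in> carrier Q"
  using subringE(1)[OF sub] by blast

lemmas Asub = subringE[OF sub]

lemma xpow: "x [^] (j::nat) \<in> carrier Q" using x by simp

text \<open>Padding with zero coefficients brings two sums to a common length before they are
  added.\<close>

lemma left_polys_extend:
  assumes "f \<in> {..<N} \<rightarrow> A" "N \<le> N'"
  shows "(\<Oplus>j\<in>{..<N}. f j \<otimes> x [^] (j::nat)) = (\<Oplus>j\<in>{..<N'}. (if j < N then f j else \<zero>) \<otimes> x [^] j)"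
  using assms(2)
proof (induction N')
  case 0 thus ?case by simp
next
  case (Suc M)
  show ?case
  proof (cases "N = Suc M")
    case True
    show ?thesis unfolding True
      by (rule finsum_cong') (use assms True in \<open>auto simp: Acarr Pi_iff xpow\<close>)
  next
    case False
    have "(\<lambda>j. (if j < N then f j else \<zero>) \<otimes> x [^] j) \<in> {..<M} \<rightarrow> carrier Q"
      using assms by (auto simp: Acarr Pi_iff xpow)
    hence "(\<Oplus>j\<in>{..<Suc M}. (if j < N then f j else \<zero>) \<otimes> x [^] j) = \<zero> \<otimes> x [^] M \<oplus> (\<Oplus>j\<in>{..<M}. (if j < N then f j else \<zero>) \<otimes> x [^] j)"
      unfolding lessThan_Suc using False Suc.prems xpow by (subst finsum_insert) auto
    also have "\<dots> = (\<Oplus>j\<in>{..<N}. f j \<otimes> x [^] (j::nat))"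
      using Suc.IH False Suc.prems xpow assms by (simp add: Pi_def Acarr xpow finsum_closed)
    finally show ?thesis by simp
  qed
qed

lemma left_polys_add: assumes "s \<in> P" "t \<in> P" shows "s \<oplus> t \<in> P"
proof -
  obtain N f where s: "f \<in> {..<N} \<rightarrow> A" "s = (\<Oplus>j\<in>{..<N}. f j \<otimes> x [^] (j::nat))"
    using assms unfolding left_polys_def by blast
  obtain M g where t: "g \<in> {..<M} \<rightarrow> A" "t = (\<Oplus>j\<in>{..<M}. g j \<otimes> x [^] (j::nat))"
    using assms unfolding left_polys_def by blast
  define K where "K = max M N"
  define f' where "f' j = (if j < N then f j else \<zero>)" for j
  define g' where "g' j = (if j < M then g j else \<zero>)" for j
  have A: "f' j \<in> A" "g' j \<in> A" for j using s t Asub by (auto simp: f'_def g'_def)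
  have "s \<oplus> t = (\<Oplus>j\<in>{..<K}. f' j \<otimes> x [^] j) \<oplus> (\<Oplus>j\<in>{..<K}. g' j \<otimes> x [^] j)"
    using left_polys_extend[OF s(1), of K] left_polys_extend[OF t(1), of K] s t by (simp add: K_def f'_def g'_def)
  also have "\<dots> = (\<Oplus>j\<in>{..<K}. f' j \<otimes> x [^] j \<oplus> g' j \<otimes> x [^] j)"
    using A xpow by (intro finsum_addf[symmetric]) (auto simp: Acarr Pi_iff xpow)
  also have "\<dots> = (\<Oplus>j\<in>{..<K}. (f' j \<oplus> g' j) \<otimes> x [^] j)"
    using A xpow by (intro finsum_cong') (auto simp: Acarr Pi_iff xpow l_distr)
  finally have "s \<oplus> t = (\<Oplus>j\<in>{..<K}. (f' j \<oplus> g' j) \<otimes> x [^] j)" .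
  moreover have "(\<lambda>j. f' j \<oplus> g' j) \<in> {..<K} \<rightarrow> A" using A Asub(7) by auto
  ultimately show ?thesis unfolding left_polys_def mem_Collect_eq
    by (intro exI[of _ K] exI[of _ "\<lambda>j. f' j \<oplus> g' j"] conjI)
qed

lemma left_polys_mono: assumes "a \<in> A" shows "a \<otimes> x [^] (j::nat) \<in> P"
proof -
  have "(\<Oplus>i\<in>{..<Suc j}. (if i = j then a else \<zero>) \<otimes> x [^] i) = (\<Oplus>i\<in>{..<Suc j}. if j = i then a \<otimes> x [^] i else \<zero>)"
    using assms xpow by (intro finsum_cong') (auto simp: Acarr Pi_iff xpow)
  also have "\<dots> = a \<otimes> x [^] j"
    using assms xpow by (subst finsum_singleton) (auto simp: Acarr Pi_iff xpow)
  finally have "a \<otimes> x [^] j = (\<Oplus>i\<in>{..<Suc j}. (if i = j then a else \<zero>) \<otimes> x [^] i)" by simp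
  moreover have "(\<lambda>i. if i = j then a else \<zero>) \<in> {..<Suc j} \<rightarrow> A" using assms Asub by auto
  ultimately show ?thesis unfolding left_polys_def mem_Collect_eq
    by (intro exI[of _ "Suc j"] exI[of _ "\<lambda>i. if i = j then a else \<zero>"] conjI)
qed

lemma left_polys_zero: "\<zero> \<in> P"
  using left_polys_mono[of \<zero> 0] Asub xpow by simp

lemma left_polys_A: "a \<in> A \<Longrightarrow> a \<in> P"
  using left_polys_mono[of a 0] Acarr by simp

lemma left_polys_induct [consumes 1, case_names zero add]:
  assumes "s \<in> P" "R \<zero>" "\<And>a j s. a \<in> A \<Longrightarrow> s \<in> P \<Longrightarrow> R s \<Longrightarrow> R (a \<otimes> x [^] (j::nat) \<oplus> s)"
  shows "R s"
proof -
  obtain N f where s: "f \<in> {..<N} \<rightarrow> A" "s = (\<Oplus>j\<in>{..<N}. f j \<otimes> x [^] (j::nat))"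
    using assms unfolding left_polys_def by blast
  have "R (\<Oplus>j\<in>{..<N}. f j \<otimes> x [^] (j::nat)) \<and> (\<Oplus>j\<in>{..<N}. f j \<otimes> x [^] (j::nat)) \<in> P"
    using s(1)
  proof (induction N)
    case 0 thus ?case using assms left_polys_zero by simp
  next
    case (Suc N)
    have "(\<lambda>j. f j \<otimes> x [^] j) \<in> {..<N} \<rightarrow> carrier Q" "f N \<otimes> x [^] N \<in> carrier Q"
      using Suc.prems xpow by (auto simp: Acarr Pi_iff xpow)
    hence "(\<Oplus>j\<in>{..<Suc N}. f j \<otimes> x [^] j) = f N \<otimes> x [^] N \<oplus> (\<Oplus>j\<in>{..<N}. f j \<otimes> x [^] j)"
      unfolding lessThan_Suc by (subst finsum_insert) auto
    moreover have "f N \<in> A" "f \<in> {..<N} \<rightarrow> A" using Suc.prems by auto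
    ultimately show ?case using Suc.IH assms(3)[of "f N"] left_polys_add[OF left_polys_mono[of "f N" N]] by presburger
  qed
  thus ?thesis using s by simp
qed

lemma left_polys_carrier: "s \<in> P \<Longrightarrow> s \<in> carrier Q"
  by (induction s rule: left_polys_induct) (auto simp: Acarr Pi_iff xpow)

lemma left_polys_left_A: assumes "s \<in> P" "b \<in> A" shows "b \<otimes> s \<in> P"
  using assms(1)
proof (induction s rule: left_polys_induct)
  case zero thus ?case using left_polys_zero assms Acarr by simp
next
  case (add a j s)
  have "b \<otimes> (a \<otimes> x [^] j \<oplus> s) = (b \<otimes> a) \<otimes> x [^] j \<oplus> b \<otimes> s"
    using add assms xpow left_polys_carrier by (simp add: r_distr m_assoc Acarr)
  thus ?case using left_polys_add left_polys_mono add Asub(6)[OF assms(2)] by auto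
qed

text \<open>Rewriting \<open>x a\<close> as \<open>b x + d\<close> moves \<open>x\<close> past the
  coefficient. With \<open>left_polys_left_A\<close> this puts every word in \<open>x\<close> and
  elements of \<open>A\<close> into \<open>P\<close>, so that \<open>P\<close> need not be shown to
  be a subring first.\<close>

lemma left_polys_left_x: assumes "s \<in> P" shows "x \<otimes> s \<in> P"
  using assms(1)
proof (induction s rule: left_polys_induct)
  case zero thus ?case using left_polys_zero x by simp
next
  case (add a j s)
  obtain b d where bd: "b \<in> A" "d \<in> A" "x \<otimes> a = (b \<otimes> x) \<oplus> d" using comm add by blast
  have "x [^] Suc j = x \<otimes> x [^] j" using x by (rule nat_pow_Suc2)
  hence "x \<otimes> (a \<otimes> x [^] j \<oplus> s) = (b \<otimes> x [^] Suc j \<oplus> d \<otimes> x [^] j) \<oplus> x \<otimes> s"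
    using add bd xpow x left_polys_carrier
    by (simp add: r_distr Acarr l_distr m_assoc[symmetric] del: nat_pow_Suc)
  moreover have "b \<otimes> x [^] Suc j \<oplus> d \<otimes> x [^] j \<oplus> x \<otimes> s \<in> P"
    by (intro left_polys_add left_polys_mono bd add)
  ultimately show ?case by presburger
qed

text \<open>The instance of freeness with two coefficients, \<open>d\<close> at power 0 and
  \<open>b\<close> at power 1; it is what uniqueness of \<open>x a = b x + d\<close> rests
  on.\<close>

lemma two_terms:
  assumes free: "\<And>N f. f \<in> {..<N} \<rightarrow> A \<Longrightarrow> finsum Q (\<lambda>j. f j \<otimes> x [^] (j::nat)) {..<N} = \<zero> \<Longrightarrow> (\<forall>j<N. f j = \<zero>)"
    and that: "b \<in> A" "d \<in> A" "(b \<otimes> x) \<oplus> d = \<zero>"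
  shows "b = \<zero> \<and> d = \<zero>"
proof -
  let ?f = "\<lambda>j::nat. if j = 0 then d else b"
  have "(\<lambda>j. ?f j \<otimes> x [^] j) \<in> {0::nat} \<rightarrow> carrier Q" "(\<lambda>j. ?f j \<otimes> x [^] j) \<in> {0,1::nat} \<rightarrow> carrier Q" using that(1,2) x by (auto simp: Acarr)
  moreover have "{..<2::nat} = insert 1 {0}" by auto
  ultimately have "finsum Q (\<lambda>j. ?f j \<otimes> x [^] (j::nat)) {..<2} = (b \<otimes> x) \<oplus> d"
    using that(1,2) x by (simp add: finsum_insert Acarr Pi_iff)
  hence S: "finsum Q (\<lambda>j. ?f j \<otimes> x [^] (j::nat)) {..<2} = \<zero>" using that(3) by (rule trans)
  have F: "?f \<in> {..<2} \<rightarrow> A" using that(1,2) by auto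
  have "\<forall>j<2. ?f j = \<zero>" by (rule free[OF F S])
  from this[rule_format, of 0] this[rule_format, of 1] show ?thesis by simp
qed

text \<open>Freeness makes the decomposition \<open>x a = b x + d\<close> unique, so every law for \<open>\<tau>\<close> and \<open>\<delta>\<close>
  follows by comparing coefficients; no law has to be checked on generators.\<close>
lemma ore_extensionI:
  fixes sc :: "'k \<Rightarrow> 'a"
  assumes free: "\<And>N f. f \<in> {..<N} \<rightarrow> A \<Longrightarrow> finsum Q (\<lambda>j. f j \<otimes> x [^] (j::nat)) {..<N} = \<zero> \<Longrightarrow> (\<forall>j<N. f j = \<zero>)"
    and inj: "\<And>a d. a \<in> A \<Longrightarrow> d \<in> A \<Longrightarrow> x \<otimes> a = d \<Longrightarrow> a = \<zero>"
    and surj: "\<And>b. b \<in> A \<Longrightarrow> \<exists>a\<in>A. \<exists>d\<in>A. x \<otimes> a = (b \<otimes> x) \<oplus> d"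
    and sc: "\<And>c. sc c \<in> A" "\<And>c a. a \<in> carrier Q \<Longrightarrow> a \<otimes> sc c = sc c \<otimes> a"
  shows "\<exists>\<tau> \<delta>. ore_extension Q sc A P x \<tau> \<delta>"
proof -
  note zero2 = two_terms[OF free]
  have uniq: "b = b' \<and> d = d'" if "b \<in> A" "d \<in> A" "b' \<in> A" "d' \<in> A" "(b \<otimes> x) \<oplus> d = (b' \<otimes> x) \<oplus> d'" for b d b' d'
  proof -
    have c: "b \<in> carrier Q" "d \<in> carrier Q" "b' \<in> carrier Q" "d' \<in> carrier Q" using that Acarr by auto
    have "((b \<ominus> b') \<otimes> x) \<oplus> (d \<ominus> d') = ((b \<otimes> x) \<oplus> d) \<ominus> ((b' \<otimes> x) \<oplus> d')"
      using c x by algebra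
    also have "\<dots> = \<zero>" unfolding that(5) using c x by (simp add: r_neg a_minus_def)
    finally have "b \<ominus> b' = \<zero> \<and> d \<ominus> d' = \<zero>" using that Asub by (intro zero2) (auto simp: a_minus_def)
    thus ?thesis using c by (simp add: r_right_minus_eq)
  qed
  obtain \<tau> \<delta> where td: "\<And>a. a \<in> A \<Longrightarrow> \<tau> a \<in> A \<and> \<delta> a \<in> A \<and> x \<otimes> a = (\<tau> a \<otimes> x) \<oplus> \<delta> a"
    using comm by metis
  have eqI: "\<tau> a = b \<and> \<delta> a = d" if "a \<in> A" "b \<in> A" "d \<in> A" "x \<otimes> a = (b \<otimes> x) \<oplus> d" for a b d
    using uniq[of "\<tau> a" "\<delta> a" b d] td[OF that(1)] that by simp
  have add: "\<tau> (a \<oplus> b) = \<tau> a \<oplus> \<tau> b \<and> \<delta> (a \<oplus> b) = \<delta> a \<oplus> \<delta> b" if "a \<in> A" "b \<in> A" for a b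
  proof (rule eqI)
    have c: "a \<in> carrier Q" "b \<in> carrier Q" "\<tau> a \<in> carrier Q" "\<tau> b \<in> carrier Q" "\<delta> a \<in> carrier Q" "\<delta> b \<in> carrier Q"
      using that td Acarr by auto
    have "x \<otimes> (a \<oplus> b) = ((\<tau> a \<otimes> x) \<oplus> \<delta> a) \<oplus> ((\<tau> b \<otimes> x) \<oplus> \<delta> b)"
      using td that c x by (simp add: r_distr)
    also have "\<dots> = ((\<tau> a \<oplus> \<tau> b) \<otimes> x) \<oplus> (\<delta> a \<oplus> \<delta> b)" using c x by algebra
    finally show "x \<otimes> (a \<oplus> b) = ((\<tau> a \<oplus> \<tau> b) \<otimes> x) \<oplus> (\<delta> a \<oplus> \<delta> b)" .
  qed (use that td Asub in auto)
  have mul: "\<tau> (a \<otimes> b) = \<tau> a \<otimes> \<tau> b \<and> \<delta> (a \<otimes> b) = (\<tau> a \<otimes> \<delta> b) \<oplus> (\<delta> a \<otimes> b)" if "a \<in> A" "b \<in> A" for a b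
  proof (rule eqI)
    have c: "a \<in> carrier Q" "b \<in> carrier Q" "\<tau> a \<in> carrier Q" "\<tau> b \<in> carrier Q" "\<delta> a \<in> carrier Q" "\<delta> b \<in> carrier Q"
      using that td Acarr by auto
    have "x \<otimes> (a \<otimes> b) = ((\<tau> a \<otimes> x) \<oplus> \<delta> a) \<otimes> b"
      using td that c x by (simp add: m_assoc[symmetric])
    also have "\<dots> = (\<tau> a \<otimes> (x \<otimes> b)) \<oplus> (\<delta> a \<otimes> b)" using c x by (simp add: l_distr m_assoc)
    also have "\<dots> = (\<tau> a \<otimes> ((\<tau> b \<otimes> x) \<oplus> \<delta> b)) \<oplus> (\<delta> a \<otimes> b)" using td that by simp
    also have "\<dots> = ((\<tau> a \<otimes> \<tau> b) \<otimes> x) \<oplus> ((\<tau> a \<otimes> \<delta> b) \<oplus> (\<delta> a \<otimes> b))"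
      using c x by (simp add: r_distr m_assoc a_assoc)
    finally show "x \<otimes> (a \<otimes> b) = ((\<tau> a \<otimes> \<tau> b) \<otimes> x) \<oplus> ((\<tau> a \<otimes> \<delta> b) \<oplus> (\<delta> a \<otimes> b))" .
  qed (use that td Asub in auto)
  have scal: "\<tau> (sc c) = sc c \<and> \<delta> (sc c) = \<zero>" for c
    by (rule eqI) (use sc x Asub Acarr in auto)
  have one: "\<tau> \<one> = \<one>"
    using eqI[of \<one> \<one> \<zero>] Asub x by auto
  have bij: "bij_betw \<tau> A A"
  proof (rule bij_betwI')
    fix a b assume ab: "a \<in> A" "b \<in> A"
    show "(\<tau> a = \<tau> b) = (a = b)"
    proof
      assume e: "\<tau> a = \<tau> b"
      have c: "a \<in> carrier Q" "b \<in> carrier Q" "\<tau> a \<in> carrier Q" "\<tau> b \<in> carrier Q" "\<delta> a \<in> carrier Q" "\<delta> b \<in> carrier Q"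
        using ab td Acarr by auto
      \<comment> \<open>Equal images cancel the terms containing \<open>x\<close>, so
        \<open>x\<close> times the difference falls into \<open>A\<close>; by \<open>inj\<close>
        this happens only for the difference zero.\<close>
      have "x \<otimes> (a \<ominus> b) = ((\<tau> a \<otimes> x) \<oplus> \<delta> a) \<ominus> ((\<tau> b \<otimes> x) \<oplus> \<delta> b)"
        using c x td ab by (simp add: r_distr a_minus_def r_minus)
      also have "\<dots> = \<delta> a \<ominus> \<delta> b" unfolding e using c x by algebra
      finally have "a \<ominus> b = \<zero>" using ab td Asub by (intro inj) (auto simp: a_minus_def)
      thus "a = b" using c by (simp add: r_right_minus_eq)
    qed simp
  next
    show "\<tau> a \<in> A" if "a \<in> A" for a using td that by blast
    fix b assume "b \<in> A"
    then obtain a d where "a \<in> A" "d \<in> A" "x \<otimes> a = (b \<otimes> x) \<oplus> d" using surj by blast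
    thus "\<exists>a\<in>A. b = \<tau> a" using eqI[of a b d] \<open>b \<in> A\<close> by auto
  qed
  have hom: "\<tau> \<in> ring_hom (Q\<lparr>carrier := A\<rparr>) (Q\<lparr>carrier := A\<rparr>)"
    by (rule ring_hom_memI) (use td add mul one in auto)
  have "ore_extension Q sc A P x \<tau> \<delta>"
    unfolding ore_extension_def
  proof (intro conjI allI ballI)
    fix c a assume a: "a \<in> A"
    show "\<delta> (sc c \<otimes> a) = sc c \<otimes> \<delta> a"
      using mul[OF sc(1)[of c] a] scal[of c] td[OF a] a sc Acarr by simp
  next
    show "P = {finsum Q (\<lambda>j. f j \<otimes> x [^] (j::nat)) {..<N} | N f. f \<in> {..<N} \<rightarrow> A}"
      unfolding left_polys_def ..
  qed (use td add mul scal bij hom free in auto)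
  thus ?thesis by blast
qed

end

section \<open>The exchange rule between the two rows\<close>

locale quantum_space =
  fixes n :: nat and q :: "'k::field"
  assumes q0: "q \<noteq> 0" and n1: "n \<ge> 1"
begin

abbreviation qh where "qh \<equiv> q - inverse q"

text \<open>\<open>p i\<close> is the paper's \<open>i'\<close>. With \<open>v i\<close> the last five families of relations become a single rule: \<open>X\<^sub>2\<^sub>a X\<^sub>1\<^sub>b\<close> equals
  \<open>L a b\<close> applied to \<open>X\<^sub>1\<^sub>c X\<^sub>2\<^sub>d\<close>. A functional on products of two letters of one row is a
  function \<open>g\<close> of two indices, and \<open>row_rel g\<close> says that it kills the relations of that row.\<close>
definition p :: "nat \<Rightarrow> nat" where "p i = 2 * n + 1 - i"

definition v :: "nat \<Rightarrow> 'k" where "v i = q ^ (if i \<le> n then i else i - 1)"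

definition diag :: "nat \<Rightarrow> nat \<Rightarrow> 'k" where
  "diag a b = (if a = b then inverse q else if a = p b then q else 1)"

definition Om :: "(nat \<Rightarrow> nat \<Rightarrow> 'k) \<Rightarrow> nat \<Rightarrow> 'k" where
  "Om g s = (\<Sum>l\<in>{s+1..n}. q ^ (l - s - 1) * g l (p l))"

definition row_rel :: "(nat \<Rightarrow> nat \<Rightarrow> 'k) \<Rightarrow> bool" where
  "row_rel g \<longleftrightarrow>
    (\<forall>s t. 1 \<le> s \<and> s < t \<and> t \<le> 2*n \<and> t \<noteq> p s \<longrightarrow> g t s = inverse q * g s t) \<and>
    (\<forall>s. 1 \<le> s \<and> s \<le> n \<longrightarrow> g (p s) s = g s (p s) + qh * Om g s)"

text \<open>The coefficient of \<open>X\<^sub>2\<^sub>e\<close> in \<open>X\<^sub>2\<^sub>a X\<^sub>1\<^sub>b\<close>, evaluated by a functional \<open>x\<close> on the first row.\<close>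
definition Lam :: "nat \<Rightarrow> nat \<Rightarrow> nat \<Rightarrow> (nat \<Rightarrow> 'k) \<Rightarrow> 'k" where
  "Lam b a e x = (if a = e then diag a b * x b else 0) - (if b < a \<and> e = b then qh * x a else 0)
     + (if a = p b \<and> e < a then qh * v a / v e * x (p e) else 0)"

definition L :: "nat \<Rightarrow> nat \<Rightarrow> (nat \<Rightarrow> nat \<Rightarrow> 'k) \<Rightarrow> 'k" where
  "L a b H = diag a b * H b a - (if b < a then qh * H a b else 0)
     + (if a = p b then qh * (\<Sum>d\<in>{1..<a}. v a / v d * H (p d) d) else 0)"

text \<open>Minus a discrete primitive of \<open>g (p d) d / v d\<close>, valid on both halves of the index range; it removes
  the only inner sum that occurs in the overlap computations.\<close>
definition W :: "(nat \<Rightarrow> nat \<Rightarrow> 'k) \<Rightarrow> nat \<Rightarrow> 'k" where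
  "W g d = (if d \<le> n then Om g d / (q * v d) else - Om g (2*n-d) / v d)"

section \<open>Dual pairs within a row and the telescoping primitive\<close>

lemma v0: "v i \<noteq> 0" by (simp add: v_def q0)

text \<open>The only irregular step of \<open>v\<close> is from \<open>n\<close> to
  \<open>n + 1\<close>, where it stays constant; this is why computations that reach the middle of
  the index range split off a special case.\<close>

lemma v_Suc: "v (Suc i) = (if i = n then v i else q * v i)"
  using n1 by (cases i) (auto simp: v_def)

lemma p_p: "i \<le> 2*n+1 \<Longrightarrow> p (p i) = i" by (simp add: p_def)

text \<open>Sorting by the second-row letter \<open>e\<close> that survives lets the overlaps be
  checked for one \<open>e\<close> at a time, with a functional of first-row letters only.\<close>

lemma L_Lam: assumes "a \<in> {1..2*n}" "b \<in> {1..2*n}"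
  shows "L a b H = (\<Sum>e\<in>{1..2*n}. Lam b a e (\<lambda>c. H c e))"
proof -
  have 1: "(\<Sum>e\<in>{1..2*n}. if a = e then diag a b * H b e else 0) = diag a b * H b a"
    using assms by (simp add: sum.delta)
  have 2: "(\<Sum>e\<in>{1..2*n}. if b < a \<and> e = b then qh * H a e else 0) = (if b < a then qh * H a b else 0)"
    using assms by (cases "b < a") (simp_all add: sum.delta)
  have "(\<Sum>e\<in>{1..2*n}. if a = p b \<and> e < a then qh * v a / v e * H (p e) e else 0)
     = (\<Sum>e\<in>{1..<a}. if a = p b then qh * v a / v e * H (p e) e else 0)"
    using assms by (intro sum.mono_neutral_cong_right) auto
  also have "\<dots> = (if a = p b then qh * (\<Sum>d\<in>{1..<a}. v a / v d * H (p d) d) else 0)"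
    by (simp add: sum_distrib_left mult.assoc)
  finally show ?thesis unfolding Lam_def L_def sum.distrib sum_subtractf 1 2 by simp
qed

text \<open>Lowering \<open>s\<close> by one adds the term of index \<open>s\<close> and raises
  every other exponent by one. Both formulas for a dual pair come from this recursion.\<close>

lemma Om_rec: assumes "1 \<le> s" "s \<le> n" shows "Om g (s-1) = g s (p s) + q * Om g s"
proof -
  have "{s - 1 + 1..n} = insert s {s+1..n}" using assms by auto
  hence "Om g (s-1) = g s (p s) + (\<Sum>l\<in>{s+1..n}. q ^ (l - (s-1) - 1) * g l (p l))"
    using assms by (simp add: Om_def)
  also have "(\<Sum>l\<in>{s+1..n}. q ^ (l - (s-1) - 1) * g l (p l)) = q * Om g s"
    unfolding Om_def sum_distrib_left
  proof (rule sum.cong)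
    fix l assume "l \<in> {s+1..n}"
    hence "l - (s-1) - 1 = Suc (l - s - 1)" using assms by auto
    thus "q ^ (l - (s-1) - 1) * g l (p l) = q * (q ^ (l - s - 1) * g l (p l))"
      by (simp only: power_Suc mult.assoc)
  qed simp
  finally show ?thesis .
qed

lemma Om_n [simp]: "Om g n = 0" by (simp add: Om_def)

lemma row_comm: assumes "row_rel g" "1 \<le> s" "s < t" "t \<le> 2*n" "t \<noteq> p s" shows "g t s = g s t / q"
  using assms by (auto simp: row_rel_def field_simps)

lemma row_pair1: assumes "1 \<le> s" "s \<le> n" shows "g s (p s) = Om g (s-1) - q * Om g s"
  using Om_rec[OF assms, of g] by simp

lemma row_pair2: assumes "row_rel g" "1 \<le> s" "s \<le> n" shows "g (p s) s = Om g (s-1) - Om g s / q"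
  using Om_rec[OF assms(2,3), of g] assms by (simp add: row_rel_def algebra_simps divide_inverse)

text \<open>The pair \<open>p d\<close>, \<open>d\<close> is in descending order for
  \<open>d \<le> n\<close> and in ascending order for \<open>d > n\<close>, so the two halves of
  \<open>W\<close> come from different dual-pair formulas. They fit together in the middle because
  \<open>Om g n = 0\<close>.\<close>

lemma W_pair: assumes "row_rel g" "1 \<le> d" "d \<le> 2*n" shows "g (p d) d = v d * (W g (d-1) - W g d)"
proof (cases "d \<le> n")
  case True
  obtain i where i: "d = Suc i" using assms by (cases d) auto
  have g: "g (p d) d = Om g i - Om g d / q" using row_pair2[OF assms(1,2) True] by (simp add: i)
  have "v d = q * v i" using v_Suc[of i] True i by simp
  thus ?thesis unfolding g using True v0[of i] q0
    by (simp add: W_def i field_simps)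
next
  case False
  obtain i where i: "d = Suc i" using assms by (cases d) auto
  have pd: "1 \<le> p d" "p d \<le> n" "p (p d) = d" using False assms by (auto simp: p_def)
  have e: "p d - 1 = 2*n - d" "2*n - i = p d" using False assms i by (auto simp: p_def)
  show ?thesis
  proof (cases "i = n")
    case True
    thus ?thesis using row_pair1[OF pd(1,2), of g] pd e v0[of d] q0 i
      by (simp add: W_def field_simps)
  next
    case F: False
    have g: "g (p d) d = Om g (2*n-d) - q * Om g (p d)" using row_pair1[OF pd(1,2), of g] pd e by simp
    have "v d = q * v i" using v_Suc[of i] F i by simp
    thus ?thesis unfolding g using v0[of i] q0 i False F e
      by (simp add: W_def field_simps)
  qed
qed

lemma W_sum: assumes "row_rel g" "c < a" "a \<le> 2*n+1"
  shows "(\<Sum>d\<in>{c<..<a}. g (p d) d / v d) = W g c - W g (a-1)"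
  using assms(2,3)
proof (induction a)
  case (Suc a)
  show ?case
  proof (cases "c = a")
    case True
    hence "{c<..<Suc a} = {}" by auto
    thus ?thesis using True by simp
  next
    case False
    hence "{c<..<Suc a} = insert a {c<..<a}" using Suc by auto
    moreover have "g (p a) a / v a = W g (a-1) - W g a"
      using Suc False W_pair[OF assms(1), of a] v0[of a] by simp
    ultimately show ?thesis using Suc False by simp
  qed
qed simp

text \<open>Of the three parts of \<open>Lam\<close>, the first survives only at
  \<open>d = e\<close> and the third only at \<open>d = p c\<close>. The second leaves a genuine sum
  of \<open>g (p d) d / v d\<close>, which \<open>W_sum\<close> telescopes.\<close>

lemma Lam_sum: assumes "row_rel g" "a \<in> {1..2*n}" "c \<in> {1..2*n}" "e \<in> {1..2*n}"
  shows "(\<Sum>d\<in>{1..<a}. v a / v d * Lam c d e (g (p d))) =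
    (if e < a then v a / v e * diag e c * g (p e) c else 0)
    - (if e = c \<and> c < a then qh * v a * (W g c - W g (a-1)) else 0)
    + (if p c < a \<and> e < p c then qh * v a / v e * g c (p e) else 0)"
proof -
  have A: "(\<Sum>d\<in>{1..<a}. v a / v d * (if d = e then diag d c * g (p d) c else 0))
     = (if e < a then v a / v e * diag e c * g (p e) c else 0)"
    using assms by (auto simp: sum.delta if_distrib mult.assoc cong: if_cong)
  have B: "(\<Sum>d\<in>{1..<a}. v a / v d * (if c < d \<and> e = c then qh * g (p d) d else 0))
     = (if e = c \<and> c < a then qh * v a * (W g c - W g (a-1)) else 0)"
  proof (cases "e = c \<and> c < a")
    case True
    have "{d\<in>{1..<a}. c < d} = {c<..<a}" using True assms by auto
    hence "(\<Sum>d\<in>{1..<a}. v a / v d * (if c < d \<and> e = c then qh * g (p d) d else 0))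
      = (\<Sum>d\<in>{c<..<a}. v a / v d * (qh * g (p d) d))"
      using True by (simp add: if_distrib sum.If_cases Int_def cong: if_cong)
    also have "\<dots> = qh * v a * (\<Sum>d\<in>{c<..<a}. g (p d) d / v d)"
      by (simp add: sum_distrib_left algebra_simps)
    finally show ?thesis using True W_sum[OF assms(1), of c a] assms by auto
  next
    case False
    have "(\<Sum>d\<in>{1..<a}. v a / v d * (if c < d \<and> e = c then qh * g (p d) d else 0)) = 0"
      by (rule sum.neutral) (use False in auto)
    thus ?thesis using False by auto
  qed
  have C: "(\<Sum>d\<in>{1..<a}. v a / v d * (if d = p c \<and> e < d then qh * v d / v e * g (p d) (p e) else 0))
     = (if p c < a \<and> e < p c then qh * v a / v e * g c (p e) else 0)"
  proof -
    have "(\<Sum>d\<in>{1..<a}. v a / v d * (if d = p c \<and> e < d then qh * v d / v e * g (p d) (p e) else 0))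
      = (\<Sum>d\<in>{1..<a}. if d = p c then (if e < p c then qh * v a / v e * g c (p e) else 0) else 0)"
      using assms v0 by (intro sum.cong) (auto simp: p_p)
    thus ?thesis using assms by (auto simp: sum.delta p_def)
  qed
  show ?thesis unfolding Lam_def
    by (simp only: distrib_left right_diff_distrib sum.distrib sum_subtractf A B C)
qed

text \<open>The coefficient of \<open>X\<^sub>2\<^sub>e\<close> in \<open>X\<^sub>2\<^sub>a X\<^sub>1\<^sub>b X\<^sub>1\<^sub>c\<close>, evaluated by \<open>g\<close> on the first row.\<close>
definition M where "M g b c a e = L a b (\<lambda>c1 d. Lam c d e (g c1))"

lemma M_eq: assumes "row_rel g" "a \<in> {1..2*n}" "c \<in> {1..2*n}" "e \<in> {1..2*n}"
  shows "M g b c a e = diag a b * Lam c a e (g b) - (if b < a then qh * Lam c b e (g a) else 0)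
   + (if a = p b then qh * ((if e < a then v a / v e * diag e c * g (p e) c else 0)
    - (if e = c \<and> c < a then qh * v a * (W g c - W g (a-1)) else 0)
    + (if p c < a \<and> e < p c then qh * v a / v e * g c (p e) else 0)) else 0)"
  unfolding M_def L_def Lam_sum[OF assms] ..

section \<open>Overlaps of a second-row letter with two first-row letters that commute up to a power
  of q\<close>

lemma p_ne: "p i \<noteq> i"
  unfolding p_def by presburger

text \<open>With \<open>a\<close> dual to neither \<open>b\<close> nor \<open>c\<close>, every sum
  over dual pairs drops out. What remains is the overlap of ordinary quantum matrices, where only
  the order of \<open>a\<close>, \<open>b\<close>, \<open>c\<close> matters.\<close>

lemma M_commute_generic:
  assumes g: "row_rel g" and r: "1 \<le> b" "b < c" "c \<le> 2*n" "c \<noteq> p b"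
    "a \<in> {1..2*n}" "e \<in> {1..2*n}" and a: "a \<noteq> p b" "a \<noteq> p c"
  shows "M g c b a e = M g b c a e / q"
proof -
  have p: "p b \<noteq> c" "b \<noteq> p c" "p b \<noteq> b" "p c \<noteq> c" "p a \<noteq> a" "p a \<noteq> b" "p a \<noteq> c" using r a p_ne[of b] p_ne[of c] p_ne[of a] unfolding p_def by auto
  have kk: "diag b c = 1" "diag c b = 1" using r p by (auto simp: diag_def)
  have cr: "c \<in> {1..2*n}" "b \<in> {1..2*n}" "\<not> c < b" "c \<noteq> b" "b \<noteq> c" using r by auto
  have M1: "M g b c a e = diag a b * Lam c a e (g b) - (if b < a then qh * Lam c b e (g a) else 0)"
    by (simp add: M_eq[OF g r(5) cr(1) r(6)] a)
  have M2: "M g c b a e = diag a c * Lam b a e (g c) - (if c < a then qh * Lam b c e (g a) else 0)"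
    by (simp add: M_eq[OF g r(5) cr(2) r(6)] a)
  have bc: "g c b = g b c / q" using row_comm[OF g] r by auto
  have La: "Lam c a e (g b) = (if a = e then diag a c * g b c else 0) - (if c < a \<and> e = c then qh * g b a else 0)"
    and Lb: "Lam c b e (g a) = (if b = e then g a c else 0)"
    and Lc: "Lam b a e (g c) = (if a = e then diag a b * g c b else 0) - (if b < a \<and> e = b then qh * g c a else 0)"
    and Ld: "Lam b c e (g a) = (if c = e then g a b else 0) - (if e = b then qh * g a c else 0)"
    using r(2,4) cr(3-5) kk by (auto simp add: Lam_def p a)
  consider "a < b" | "a = b" | "b < a" "a < c" | "a = c" | "c < a" by linarith
  thus ?thesis
  proof cases
    case 1
    thus ?thesis unfolding M1 M2 La Lb Lc Ld bc using r by simp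
  next
    case 2
    have k: "diag a b = inverse q" "diag a c = 1" using 2 kk by (auto simp: diag_def)
    show ?thesis unfolding M1 M2 La Lb Lc Ld unfolding k unfolding 2 bc using r(2) q0
      by (simp add: field_simps)
  next
    case 3
    have h: "g c a = g a c / q" using row_comm[OF g, of a c] 3 r(3,5) p(7) by auto
    have k: "diag a b = 1" "diag a c = 1" using 3 a by (auto simp: diag_def)
    show ?thesis unfolding M1 M2 La Lb Lc Ld bc k h using 3 r q0
      by (simp add: field_simps)
  next
    case 4
    have k: "diag a b = 1" "diag a c = inverse q" using 4 kk by (auto simp: diag_def)
    show ?thesis unfolding M1 M2 La Lb Lc Ld unfolding k unfolding 4 bc using r(2) q0
      by (simp add: field_simps)
  next
    case 5
    have h: "g a c = g c a / q" "g a b = g b a / q"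
      using row_comm[OF g, of c a] row_comm[OF g, of b a] 5 r(1,2,5) a cr(1) by auto
    have k: "diag a b = 1" "diag a c = 1" using 5 a r by (auto simp: diag_def)
    have l: "b < a" "c \<noteq> b" using 5 r by auto
    consider "e = b" | "e = c" | "e \<noteq> b" "e \<noteq> c" by blast
    thus ?thesis
    proof cases
      case 1
      show ?thesis unfolding M1 M2 La Lb Lc Ld unfolding bc k h 1 using 5 l q0 by (simp add: field_simps)
    next
      case 2
      show ?thesis unfolding M1 M2 La Lb Lc Ld unfolding bc k h 2 using 5 l q0 by (simp add: field_simps)
    next
      case 3
      show ?thesis unfolding M1 M2 La Lb Lc Ld bc k h using 3 5 l q0 by simp
    qed
  qed
qed

lemma W_lt: "d \<le> n \<Longrightarrow> W g d = Om g d / (q * v d)"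
  by (simp add: W_def)

lemma W_gt: "n < d \<Longrightarrow> d \<le> 2*n \<Longrightarrow> W g d = - Om g (2*n-d) / v d"
  by (simp add: W_def)

text \<open>This evaluates the upper end of the telescoped sum when \<open>a = p b\<close>;
  multiplying by \<open>v\<close> clears the denominator. At \<open>b = n\<close> both sides
  vanish.\<close>

lemma W_pred: assumes "1 \<le> b" "b \<le> n" shows "v (p b) * W g (p b - 1) = - q * Om g b"
proof (cases "b = n")
  case True thus ?thesis by (simp add: W_def p_def)
next
  case False
  have "p b = Suc (2*n - b)" "p b - 1 = 2*n-b" using assms by (auto simp: p_def)
  hence "v (p b) = q * v (p b - 1)" using v_Suc[of "2*n-b"] assms False by auto
  moreover have "W g (p b - 1) = - Om g b / v (p b - 1)" using assms False W_gt[of "p b - 1"] by (auto simp: p_def)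
  ultimately show ?thesis using v0 by simp
qed

text \<open>The dual pair of \<open>c\<close> is rewritten through \<open>v c * W g c\<close>, the
  quantity that the telescoped sum contributes. Afterwards \<open>W g c\<close> can be treated as an
  unknown and the overlap identity is a rational identity in \<open>q\<close>.
  \<open>W_pair_r\<close> does the same on the other half.\<close>

lemma W_pair_l: assumes "row_rel g" "1 \<le> c" "c \<le> n"
  shows "g c (p c) = Om g (c-1) - q * (q * v c * W g c)" "g (p c) c = Om g (c-1) - v c * W g c"
  using row_pair1[OF assms(2,3), of g] row_pair2[OF assms] W_lt[OF assms(3), of g] v0[of c] q0 by simp_all

lemma W_pair_r: assumes "row_rel g" "n < c" "c \<le> 2*n"
  shows "g c (p c) = - v c * W g c - Om g (p c) / q" "g (p c) c = - v c * W g c - q * Om g (p c)"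
proof -
  have pc: "1 \<le> p c" "p c \<le> n" "p (p c) = c" "p c - 1 = 2*n - c" using assms by (auto simp: p_def)
  show "g c (p c) = - v c * W g c - Om g (p c) / q" "g (p c) c = - v c * W g c - q * Om g (p c)"
  using row_pair1[OF pc(1,2), of g] row_pair2[OF assms(1) pc(1,2)] W_gt[OF assms(2,3), of g] pc v0[of c] q0 by simp_all
qed

text \<open>The sum created when \<open>X\<^sub>2\<^sub>a\<close> passes its dual letter
  \<open>b\<close> must still cross \<open>c\<close>. The delicate coefficient is
  \<open>e = c\<close>: there the telescoped sum is compared with the dual pair of \<open>c\<close>,
  whose formula depends on the half containing \<open>c\<close>.\<close>

lemma M_commute_dual_first:
  assumes g: "row_rel g" and r: "1 \<le> b" "b < c" "c \<le> 2*n" "c \<noteq> p b"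
    "a \<in> {1..2*n}" "e \<in> {1..2*n}" and a: "a = p b"
  shows "M g c b a e = M g b c a e / q"
proof -
  have p: "p b \<noteq> c" "b \<noteq> p c" "p b \<noteq> b" "p c \<noteq> c" "p a = b" "a \<noteq> b" "a \<noteq> c" "a \<noteq> p c" "p c < a"
    using r a p_ne[of b] p_ne[of c] p_ne[of a] unfolding p_def by auto
  have kk: "diag b c = 1" "diag c b = 1" "diag a b = q" "diag a c = 1" using r p a by (auto simp: diag_def)
  have cr: "c \<in> {1..2*n}" "b \<in> {1..2*n}" "\<not> c < b" "c \<noteq> b" "b \<noteq> c" using r by auto
  have M1: "M g b c a e = q * Lam c a e (g b) - (if b < a then qh * Lam c b e (g a) else 0)
   + qh * ((if e < a then v a / v e * diag e c * g (p e) c else 0)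
    - (if e = c \<and> c < a then qh * v a * (W g c - W g (a-1)) else 0)
    + (if e < p c then qh * v a / v e * g c (p e) else 0))"
    by (simp add: M_eq[OF g r(5) cr(1) r(6)] a[THEN eqTrueI] kk p(9))
  have M2: "M g c b a e = Lam b a e (g c) - (if c < a then qh * Lam b c e (g a) else 0)"
    by (simp add: M_eq[OF g r(5) cr(2) r(6)] p(8) kk)
  have bc: "g c b = g b c / q" using row_comm[OF g] r by auto
  have ac: "c < a \<Longrightarrow> g a c = g c a / q" using row_comm[OF g, of c a] cr(1) r(5) p(8) by auto
  have nb: "b < a \<longleftrightarrow> b \<le> n" "c < a \<longleftrightarrow> b < p c" using a r(1-3) unfolding p_def by arith+
  have La: "Lam c a e (g b) = (if a = e then g b c else 0) - (if c < a \<and> e = c then qh * g b a else 0)"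
    and Lb: "Lam c b e (g a) = (if b = e then g a c else 0)"
    and Lc: "Lam b a e (g c) = (if a = e then q * g c b else 0) - (if b < a \<and> e = b then qh * g c a else 0)
      + (if e < a then qh * v a / v e * g c (p e) else 0)"
    and Ld: "Lam b c e (g a) = (if c = e then g a b else 0) - (if e = b then qh * g a c else 0)"
    using r(2,4) cr(3-5) kk by (auto simp add: Lam_def p a[THEN eqTrueI])
  consider "e = a" | "e = b" | "e = c" | "e \<noteq> a" "e \<noteq> b" "e \<noteq> c" by blast
  thus ?thesis
  proof cases
    case 1
    thus ?thesis unfolding M1 M2 La Lb Lc Ld using r p bc q0 by (simp add: field_simps)
  next
    case 2
    have k: "diag e c = 1" "p e = a" using 2 kk a by auto
    have vb: "v b \<noteq> 0" by (rule v0)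
    show ?thesis
    proof (cases "c < a")
      case True
      hence t: "b < a" "b < p c" using r nb by auto
      show ?thesis unfolding M1 M2 La Lb Lc Ld k ac[OF True] using True t 2 r p a
        apply (simp)
        using q0 vb by (simp add: field_simps)
    next
      case False
      hence t: "\<not> b < p c" using r nb by auto
      have ca: "b < a \<Longrightarrow> g c a = g a c / q" using row_comm[OF g, of a c] False r(3,5) p(5,7) cr(4) by auto
      show ?thesis
      proof (cases "b < a")
        case b: True
        show ?thesis unfolding M1 M2 La Lb Lc Ld k ca[OF b] using b False t 2 r p
          apply simp
          using q0 vb by (simp add: field_simps)
      next
        case b: False
        show ?thesis unfolding M1 M2 La Lb Lc Ld k using b False t 2 r p by simp
      qed
    qed
  next
    case 3
    have k: "diag e c = inverse q" using 3 by (auto simp: diag_def)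
    have vc: "v c \<noteq> 0" by (rule v0)
    show ?thesis
    proof (cases "c < a")
      case True
      hence b: "b < a" "b \<le> n" using r nb by auto
      have "v a * W g (a - 1) = - q * Om g b" using W_pred[of b g] b r a by auto
      hence w: "qh * v a * (W g c - W g (a-1)) = qh * (v a * W g c + q * Om g b)" by (simp add: algebra_simps)
      have gb: "g b a = Om g (b-1) - q * Om g b" "g a b = Om g (b-1) - Om g b / q"
        using row_pair1[of b g] row_pair2[OF g, of b] r b a by auto
      show ?thesis
      proof (cases "c \<le> n")
        case T: True
        have t: "c < p c" using T by (auto simp: p_def)
        note gc = W_pair_l[OF g _ T]
        show ?thesis unfolding M1 M2 La Lb Lc Ld k w using True t 3 r p b
          apply (simp add: gb gc)
          using q0 vc by (simp add: field_simps)
      next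
        case F: False
        have t: "\<not> c < p c" using F by (auto simp: p_def)
        have "n < c" using F by simp
        note gc = W_pair_r[OF g this r(3)]
        show ?thesis unfolding M1 M2 La Lb Lc Ld k w using True t 3 r p b
          apply (simp add: gb gc)
          using q0 vc by (simp add: field_simps)
      qed
    next
      case False
      have nc: "\<not> c < p c" using False a r(2) unfolding p_def by arith
      show ?thesis unfolding M1 M2 La Lb Lc Ld k using 3 False nc p(6,7) cr(3-5) by simp
    qed
  next
    case 4
    have ve: "v e \<noteq> 0" by (rule v0)
    have pe: "p e \<noteq> p c" "1 \<le> p e" "p e \<le> 2*n" using r 4 by (auto simp: p_def)
    consider "e = p c" | "e < p c" | "p c < e" "e < a" | "a < e" using 4 by linarith
    thus ?thesis
    proof cases
      case 1
      hence "p e = c" "diag e c = q" using r p by (auto simp: p_p diag_def)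
      thus ?thesis unfolding M1 M2 La Lb Lc Ld using p(6-9) ve 4 1 q0
        by (simp add: field_simps)
    next
      case 2
      hence k: "diag e c = 1" using 4 by (auto simp: diag_def)
      have "c < p e" using 2 r by (auto simp: p_def)
      hence h: "g (p e) c = g c (p e) / q" using row_comm[OF g, of c "p e"] r(1,3) cr pe by auto
      show ?thesis unfolding M1 M2 La Lb Lc Ld k h using p(6-9) ve 4 2 q0
        by (simp add: field_simps)
    next
      case 3
      hence k: "diag e c = 1" using 4 by (auto simp: diag_def)
      have "p e < c" using 3 r by (auto simp: p_def)
      hence h: "g c (p e) = g (p e) c / q" using row_comm[OF g, of "p e" c] r(3) pe 4(3) p_p[of e] r(6) by auto
      show ?thesis unfolding M1 M2 La Lb Lc Ld k h using p(6-9) ve 4 3 q0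
        by (simp add: field_simps)
    next
      case 4
      thus ?thesis unfolding M1 M2 La Lb Lc Ld using p(9) \<open>e \<noteq> a\<close> \<open>e \<noteq> b\<close> \<open>e \<noteq> c\<close> by simp
    qed
  qed
qed

text \<open>Now the sum arises on passing \<open>c\<close>, and in the product with \<open>c\<close>
  first it must cross \<open>b\<close>, so the delicate coefficient is \<open>e = b\<close>. The end
  point \<open>a - 1\<close> of the telescoped sum is at least \<open>n\<close> if
  \<open>c < a\<close> and below \<open>n\<close> otherwise, which gives two different evaluations
  of \<open>v a * W g (a - 1)\<close>.\<close>

lemma M_commute_dual_second:
  assumes g: "row_rel g" and r: "1 \<le> b" "b < c" "c \<le> 2*n" "c \<noteq> p b"
    "a \<in> {1..2*n}" "e \<in> {1..2*n}" and a: "a = p c"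
  shows "M g c b a e = M g b c a e / q"
proof -
  have p: "p b \<noteq> c" "b \<noteq> p c" "p b \<noteq> b" "p c \<noteq> c" "p a = c" "a \<noteq> b" "a \<noteq> c" "a \<noteq> p b" "\<not> p b < a"
    using r a p_ne[of b] p_ne[of c] p_ne[of a] unfolding p_def by auto
  have kk: "diag b c = 1" "diag c b = 1" "diag a b = 1" "diag a c = q" using r p a by (auto simp: diag_def)
  have cr: "c \<in> {1..2*n}" "b \<in> {1..2*n}" "\<not> c < b" "c \<noteq> b" "b \<noteq> c" using r by auto
  have M1: "M g b c a e = Lam c a e (g b) - (if b < a then qh * Lam c b e (g a) else 0)"
    by (simp add: M_eq[OF g r(5) cr(1) r(6)] p(8) kk)
  have M2: "M g c b a e = q * Lam b a e (g c) - (if c < a then qh * Lam b c e (g a) else 0)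
   + qh * ((if e < a then v a / v e * diag e b * g (p e) b else 0)
    - (if e = b \<and> b < a then qh * v a * (W g b - W g (a-1)) else 0))"
    by (simp add: M_eq[OF g r(5) cr(2) r(6)] a[THEN eqTrueI] kk p(9))
  have bc: "g c b = g b c / q" using row_comm[OF g] r by auto
  have ab: "b < a \<Longrightarrow> g a b = g b a / q" using row_comm[OF g r(1), of a] r(5) p(8) by auto
  have nb: "c < a \<longleftrightarrow> c \<le> n" "c < a \<Longrightarrow> b < a" "b < a \<longleftrightarrow> c < p b" using a r(1-3) unfolding p_def by arith+
  have La: "Lam c a e (g b) = (if a = e then q * g b c else 0) - (if c < a \<and> e = c then qh * g b a else 0)
      + (if e < a then qh * v a / v e * g b (p e) else 0)"
    and Lb: "Lam c b e (g a) = (if b = e then g a c else 0)"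
    and Lc: "Lam b a e (g c) = (if a = e then g c b else 0) - (if b < a \<and> e = b then qh * g c a else 0)"
    and Ld: "Lam b c e (g a) = (if c = e then g a b else 0) - (if e = b then qh * g a c else 0)"
    using r(2,4) cr(3-5) kk by (auto simp add: Lam_def p a[THEN eqTrueI])
  consider "e = a" | "e = b" | "e = c" | "e \<noteq> a" "e \<noteq> b" "e \<noteq> c" by blast
  thus ?thesis
  proof cases
    case 1
    thus ?thesis unfolding M1 M2 La Lb Lc Ld using r p bc q0 by (simp add: field_simps)
  next
    case 2
    have k: "diag e b = inverse q" using 2 by (auto simp: diag_def)
    have vb: "v b \<noteq> 0" by (rule v0)
    show ?thesis
    proof (cases "b < a")
      case True
      have bn: "b \<le> n" using True r a by (auto simp: p_def)
      note gb = W_pair_l[OF g r(1) bn]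
      show ?thesis
      proof (cases "c < a")
        case T: True
        have cn: "c \<le> n" using T nb by simp
        have "v a * W g (a - 1) = - q * Om g c" using W_pred[of c g] cn r a by auto
        hence w: "qh * v a * (W g b - W g (a-1)) = qh * (v a * W g b + q * Om g c)" by (simp add: algebra_simps)
        have gc: "g c a = Om g (c-1) - q * Om g c" "g a c = Om g (c-1) - Om g c / q"
          using row_pair1[of c g] row_pair2[OF g, of c] r cn a by auto
        show ?thesis unfolding M1 M2 La Lb Lc Ld k w using True T 2 r p
          apply (simp add: gb gc)
          using q0 vb by (simp add: field_simps)
      next
        case F: False
        have cn: "1 \<le> a" "a \<le> n" "p a = c" using F r a nb by (auto simp: p_def)
        obtain i where i: "a = Suc i" using cn by (cases a) auto
        have "v a = q * v i" using v_Suc[of i] i cn by auto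
        hence "v a * W g (a - 1) = Om g (a-1)" using W_lt[of i g] i cn v0[of i] q0 by (simp add: field_simps)
        hence w: "qh * v a * (W g b - W g (a-1)) = qh * (v a * W g b - Om g (a-1))" by (simp add: algebra_simps)
        have gc: "g a c = Om g (a-1) - q * Om g a" "g c a = Om g (a-1) - Om g a / q"
          using row_pair1[of a g] row_pair2[OF g, of a] r cn by auto
        show ?thesis unfolding M1 M2 La Lb Lc Ld k w using True F 2 r p
          apply (simp add: gb gc)
          using q0 vb by (simp add: field_simps)
      qed
    next
      case False
      thus ?thesis unfolding M1 M2 La Lb Lc Ld k using 2 r p nb q0
        by (auto simp: field_simps)
    qed
  next
    case 3
    have k: "diag e b = 1" "p e = a" using 3 kk a by auto
    have vc: "v c \<noteq> 0" by (rule v0)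
    show ?thesis
    proof (cases "b < a")
      case b: True
      show ?thesis unfolding M1 M2 La Lb Lc Ld k ab[OF b] using b 3 r p
        apply simp
        using q0 vc by (simp add: field_simps)
    next
      case b: False
      show ?thesis unfolding M1 M2 La Lb Lc Ld k using b nb(2) 3 p(6,7) cr(3-5) by auto
    qed
  next
    case 4
    have ve: "v e \<noteq> 0" by (rule v0)
    have pe: "p e \<noteq> p b" "1 \<le> p e" "p e \<le> 2*n" using r 4 by (auto simp: p_def)
    consider "e < a" | "a < e" using 4 by linarith
    thus ?thesis
    proof cases
      case 1
      hence k: "diag e b = 1" using 4 1 r a by (auto simp: diag_def p_def)
      have "b < p e" using 1 r a by (auto simp: p_def)
      hence h: "g (p e) b = g b (p e) / q" using row_comm[OF g, of b "p e"] r(1,3) cr pe by auto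
      show ?thesis unfolding M1 M2 La Lb Lc Ld k h using p(6-9) ve 4 1 q0
        by (simp add: field_simps)
    next
      case 2
      thus ?thesis unfolding M1 M2 La Lb Lc Ld using 4 by simp
    qed
  qed
qed

text \<open>The coefficient of \<open>X\<^sub>2\<^sub>e\<close> in \<open>X\<^sub>2\<^sub>a\<close> times the quadratic element \<open>\<Omega>\<^sub>s\<close> that \<open>Om g s\<close> evaluates.\<close>
definition Z where
  "Z g s a e = (if a = e then Om g s else 0) + qh * g a (p e) / v e *
     ((if s < a \<and> e \<le> s then v s else 0) - (if p s \<le> a \<and> e < p s then v (p s) else 0))"

text \<open>\<open>M\<close> obeys \<open>row_pair1\<close> and \<open>row_pair2\<close> with
  \<open>Z\<close> in the role of \<open>Om\<close>. The first formula is a recursion that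
  determines \<open>Z\<close> from its value at \<open>n\<close>; the difference of the two is the
  dual-pair relation for \<open>M\<close>.\<close>

lemma M_pair:
  assumes g: "row_rel g" and r: "1 \<le> s" "s \<le> n" "a \<in> {1..2*n}" "e \<in> {1..2*n}"
  shows "M g s (p s) a e = Z g (s-1) a e - q * Z g s a e"
    and "M g (p s) s a e = Z g (s-1) a e - Z g s a e / q"
proof -
  have p: "p s \<noteq> s" "s < p s" "p (p s) = s" "\<not> p s < s" "p (s-1) = Suc (p s)" "p s \<in> {1..2*n}" "s \<in> {1..2*n}"
    using r by (auto simp: p_def)
  have kk: "diag s s = inverse q" "diag s (p s) = q" "diag (p s) s = q" "diag (p s) (p s) = inverse q"
    using p by (auto simp: diag_def)
  have vs: "v (s-1) = v s / q" using v_Suc[of "s-1"] r q0 by auto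
  have vp: "v (p (s-1)) = q * v (p s)" using v_Suc[of "p s"] p r by (auto simp: p_def)
  have c: "s - 1 < a \<longleftrightarrow> s \<le> a" "e \<le> s - 1 \<longleftrightarrow> e < s" "p (s-1) \<le> a \<longleftrightarrow> p s < a" "e < p (s-1) \<longleftrightarrow> e \<le> p s"
    using r p(5) by linarith+
  have Z1: "Z g (s-1) a e = (if a = e then Om g (s-1) else 0) + qh * g a (p e) / v e *
     ((if s \<le> a \<and> e < s then v s / q else 0) - (if p s < a \<and> e \<le> p s then q * v (p s) else 0))"
    unfolding Z_def c vs vp ..
  have M1: "M g s (p s) a e = diag a s * Lam (p s) a e (g s) - (if s < a then qh * Lam (p s) s e (g a) else 0)
   + (if a = p s then qh * ((if e < a then v a / v e * diag e (p s) * g (p e) (p s) else 0)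
    + (if e < s then qh * v a / v e * g (p s) (p e) else 0)) else 0)"
    using M_eq[OF g r(3) p(6) r(4), of s] p by simp
  have M2: "M g (p s) s a e = diag a (p s) * Lam s a e (g (p s)) - (if p s < a then qh * Lam s (p s) e (g a) else 0)
   + (if a = s then qh * (if e < a then v a / v e * diag e s * g (p e) s else 0) else 0)"
    using M_eq[OF g r(3) p(7) r(4), of "p s"] p by auto
  have La: "Lam (p s) a e x = (if a = e then diag a (p s) * x (p s) else 0) - (if p s < a \<and> e = p s then qh * x a else 0)
     + (if a = s \<and> e < a then qh * v a / v e * x (p e) else 0)"
   and Lb: "Lam (p s) s e x = (if s = e then q * x (p s) else 0)
     + (if e < s then qh * v s / v e * x (p e) else 0)"
   and Lc: "Lam s a e x = (if a = e then diag a s * x s else 0) - (if s < a \<and> e = s then qh * x a else 0)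
     + (if a = p s \<and> e < a then qh * v a / v e * x (p e) else 0)"
   and Ld: "Lam s (p s) e x = (if p s = e then q * x s else 0) - (if e = s then qh * x (p s) else 0)
     + (if e < p s then qh * v (p s) / v e * x (p e) else 0)" for x
    unfolding Lam_def using p kk by auto
  note Z2 = Z_def[of g s a e]
  have ve: "v e \<noteq> 0" by (rule v0)
  have g1: "g s (p s) = Om g (s-1) - q * Om g s" by (rule row_pair1[OF r(1,2)])
  have g2: "g (p s) s = Om g (s-1) - Om g s / q" by (rule row_pair2[OF g r(1,2)])
  consider "a < s" | "a = s" | "s < a" "a < p s" | "a = p s" | "p s < a" by linarith
  hence "M g s (p s) a e = Z g (s-1) a e - q * Z g s a e \<and> M g (p s) s a e = Z g (s-1) a e - Z g s a e / q"
  proof cases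
    case 1
    have k: "diag a s = 1" "diag a (p s) = 1" using 1 p by (auto simp: diag_def)
    have n: "\<not> s < a" "\<not> p s < a" "a \<noteq> s" "a \<noteq> p s" "\<not> s \<le> a" "\<not> p s \<le> a" using 1 p by auto
    show ?thesis unfolding M1 M2 La Lb Lc Ld Z1 Z2 k using n g1 g2 by simp
  next
    case 2
    have k: "e < s \<Longrightarrow> diag e s = 1" using p by (auto simp: diag_def)
    have h: "e < s \<Longrightarrow> g (p e) s = g s (p e) / q"
      using row_comm[OF g, of s "p e"] r by (auto simp: p_def)
    have n: "\<not> s < a" "\<not> p s < a" "a \<noteq> p s" "s \<le> a" "\<not> p s \<le> a" using 2 p by auto
    consider "e < s" | "e = s" | "s < e" by linarith
    thus ?thesis
    proof cases
      case 1
      show ?thesis unfolding M1 M2 La Lb Lc Ld Z1 Z2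
        unfolding 2 kk k[OF 1] h[OF 1] using 1 p q0 ve
        by (simp add: field_simps)
    next
      case e: 2
      show ?thesis unfolding M1 M2 La Lb Lc Ld Z1 Z2 using e 2 n kk p g1 g2 q0 ve
        by simp
    next
      case 3
      show ?thesis unfolding M1 M2 La Lb Lc Ld Z1 Z2 using 3 2 n kk p q0 ve
        by simp
    qed
  next
    case 3
    have k: "diag a s = 1" "diag a (p s) = 1" using 3 p by (auto simp: diag_def)
    have n: "\<not> p s < a" "a \<noteq> s" "a \<noteq> p s" "s \<le> a" "\<not> p s \<le> a" using 3 p by auto
    have h: "g (p s) a = g a (p s) / q"
      using row_comm[OF g, of a "p s"] 3 n r by (auto simp: p_def)
    consider "e < s" | "e = s" | "s < e" by linarith
    thus ?thesis
    proof cases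
      case 1
      show ?thesis unfolding M1 M2 La Lb Lc Ld Z1 Z2 k using 1 3 n p q0 ve
        by (simp add: field_simps)
    next
      case 2
      show ?thesis unfolding M1 M2 La Lb Lc Ld Z1 Z2 k
        unfolding 2 h using 3 n p q0 v0
        by (simp add: field_simps)
    next
      case e: 3
      show ?thesis unfolding M1 M2 La Lb Lc Ld Z1 Z2 k using e 3 n p q0 ve g1 g2
        by simp
    qed
  next
    case 4
    have n: "\<not> p s < a" "a \<noteq> s" "s < a" "s \<le> a" "p s \<le> a" using 4 p by auto
    consider "e < s" | "e = s" | "s < e" "e < p s" | "e = p s" | "p s < e" by linarith
    thus ?thesis
    proof cases
      case 1
      have k: "diag e (p s) = 1" using 1 p by (auto simp: diag_def)
      have h: "g (p e) (p s) = g (p s) (p e) / q"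
        using row_comm[OF g, of "p s" "p e"] r 1 p by (auto simp: p_def)
      show ?thesis unfolding M1 M2 La Lb Lc Ld Z1 Z2
        unfolding 4 kk k h using 1 p q0 ve
        by (simp add: field_simps)
    next
      case 2
      show ?thesis unfolding M1 M2 La Lb Lc Ld Z1 Z2
        unfolding 4 2 kk using p q0 v0
        by (simp add: field_simps)
    next
      case 3
      have k: "diag e (p s) = 1" using 3 p by (auto simp: diag_def)
      have h: "g (p s) (p e) = g (p e) (p s) / q"
        using row_comm[OF g, of "p e" "p s"] r 3 p by (auto simp: p_def)
      show ?thesis unfolding M1 M2 La Lb Lc Ld Z1 Z2
        unfolding 4 kk k h using 3 p q0 ve
        by (simp add: field_simps)
    next
      case e: 4
      show ?thesis unfolding M1 M2 La Lb Lc Ld Z1 Z2 using e 4 n kk p q0 ve g1 g2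
        by simp
    next
      case 5
      show ?thesis unfolding M1 M2 La Lb Lc Ld Z1 Z2 using 5 4 n kk p q0 ve
        by simp
    qed
  next
    case 5
    have k: "diag a s = 1" "diag a (p s) = 1" using 5 p by (auto simp: diag_def)
    have n: "s < a" "a \<noteq> s" "a \<noteq> p s" "s \<le> a" "p s \<le> a" using 5 p by auto
    have h: "g a s = g s a / q" "g a (p s) = g (p s) a / q"
      using row_comm[OF g, of s a] row_comm[OF g, of "p s" a] 5 n r p by (auto simp: p_def)
    consider "e < s" | "e = s" | "s < e" "e < p s" | "e = p s" | "p s < e" by linarith
    thus ?thesis
    proof cases
      case 1
      show ?thesis unfolding M1 M2 La Lb Lc Ld Z1 Z2 k using 1 5 n p q0 ve
        by (simp add: field_simps)
    next
      case 2
      show ?thesis unfolding M1 M2 La Lb Lc Ld Z1 Z2 k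
        unfolding 2 h using 5 n p q0 v0
        by (simp add: field_simps)
    next
      case 3
      show ?thesis unfolding M1 M2 La Lb Lc Ld Z1 Z2 k using 3 5 n p q0 ve
        by (simp add: field_simps)
    next
      case 4
      show ?thesis unfolding M1 M2 La Lb Lc Ld Z1 Z2 k
        unfolding 4 p(3) h using 5 n p q0 v0
        by (simp add: field_simps)
    next
      case e: 5
      show ?thesis unfolding M1 M2 La Lb Lc Ld Z1 Z2 k using e 5 n p q0 ve g1 g2
        by simp
    qed
  qed
  thus "M g s (p s) a e = Z g (s-1) a e - q * Z g s a e"
    and "M g (p s) s a e = Z g (s-1) a e - Z g s a e / q" by auto
qed

text \<open>The two boundary terms cancel because \<open>p n = n + 1\<close> and \<open>v\<close>
  agrees at \<open>n\<close> and \<open>n + 1\<close>.\<close>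

lemma Z_n: assumes "a \<in> {1..2*n}" "e \<in> {1..2*n}" shows "Z g n a e = 0"
proof -
  have "p n = Suc n" by (simp add: p_def)
  thus ?thesis using v_Suc[of n] by (auto simp: Z_def)
qed

text \<open>Both sides satisfy the recursion of \<open>Om_rec\<close> and vanish at
  \<open>n\<close>, hence a downward induction.\<close>

lemma Om_M: assumes "row_rel g" "a \<in> {1..2*n}" "e \<in> {1..2*n}" "s \<le> n"
  shows "Om (\<lambda>b c. M g b c a e) s = Z g s a e"
  using assms(4)
proof (induction s rule: inc_induct)
  case base
  show ?case using Z_n[OF assms(2,3)] by simp
next
  case (step s)
  have "Om (\<lambda>b c. M g b c a e) (Suc s - 1) = M g (Suc s) (p (Suc s)) a e + q * Z g (Suc s) a e"
    using step Om_rec[of "Suc s" "\<lambda>b c. M g b c a e"] by simp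
  thus ?case using M_pair(1)[OF assms(1) _ _ assms(2,3), of "Suc s"] step by simp
qed

lemma row_rel_M: assumes g: "row_rel g" and ae: "a \<in> {1..2*n}" "e \<in> {1..2*n}"
  shows "row_rel (\<lambda>b c. M g b c a e)"
  unfolding row_rel_def
proof (intro conjI allI impI)
  fix s t assume "1 \<le> s \<and> s < t \<and> t \<le> 2 * n \<and> t \<noteq> p s"
  hence "M g t s a e = M g s t a e / q"
    using M_commute_generic[OF g _ _ _ _ ae, of s t] M_commute_dual_first[OF g _ _ _ _ ae, of s t] M_commute_dual_second[OF g _ _ _ _ ae, of s t] by blast
  thus "M g t s a e = inverse q * M g s t a e" by (simp add: field_simps)
next
  fix s assume s: "1 \<le> s \<and> s \<le> n"
  show "M g (p s) s a e = M g s (p s) a e + qh * Om (\<lambda>b c. M g b c a e) s"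
    using M_pair[OF g _ _ ae, of s] s Om_M[OF g ae, of s] by (simp add: field_simps)
qed

section \<open>From single coefficients to the overlaps of both kinds\<close>

lemma L_sum_arg: "finite A \<Longrightarrow> L a b (\<lambda>c d. \<Sum>i\<in>A. f i c d) = (\<Sum>i\<in>A. L a b (f i))"
  unfolding L_def
  by (auto simp: sum.distrib sum_subtractf sum_distrib_left sum.swap[of _ A])

lemma row_rel_sum: assumes "finite A" "\<And>i. i \<in> A \<Longrightarrow> row_rel (f i)"
  shows "row_rel (\<lambda>c d. \<Sum>i\<in>A. f i c d)"
proof -
  have "Om (\<lambda>c d. \<Sum>i\<in>A. f i c d) s = (\<Sum>i\<in>A. Om (f i) s)" for s
    unfolding Om_def by (simp add: sum_distrib_left sum.swap[of _ A])
  thus ?thesis using assms(2) unfolding row_rel_def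
    by (auto simp: sum_distrib_left sum.distrib)
qed

lemma row_rel_cong: assumes "\<And>b c. b \<in> {1..2*n} \<Longrightarrow> c \<in> {1..2*n} \<Longrightarrow> f b c = g b c"
  "row_rel f" shows "row_rel g"
proof -
  have r: "s \<in> {1..2*n} \<Longrightarrow> p s \<in> {1..2*n}" for s by (auto simp: p_def)
  have h: "f s (p s) = g s (p s)" "f (p s) s = g (p s) s" if "1 \<le> s" "s \<le> n" for s
    using assms(1)[OF _ r, of s s] assms(1)[OF r, of s s] that by auto
  moreover have "Om f s = Om g s" for s unfolding Om_def by (rule sum.cong) (auto simp: h)
  ultimately show ?thesis using assms unfolding row_rel_def by auto
qed

text \<open>The overlaps \<open>X\<^sub>2 X\<^sub>1 X\<^sub>1\<close> are resolvable.\<close>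
lemma row_rel_L_left:
  assumes "\<And>e. e \<in> {1..2*n} \<Longrightarrow> row_rel (\<lambda>c1 c2. G c1 c2 e)" "a \<in> {1..2*n}"
  shows "row_rel (\<lambda>b c. L a b (\<lambda>c1 d. L d c (\<lambda>c2 e. G c1 c2 e)))"
proof (rule row_rel_cong)
  show "row_rel (\<lambda>b c. \<Sum>e\<in>{1..2*n}. M (\<lambda>c1 c2. G c1 c2 e) b c a e)"
    using assms by (intro row_rel_sum row_rel_M) auto
  fix b c assume bc: "b \<in> {1..2*n}" "c \<in> {1..2*n}"
  have "L a b (\<lambda>c1 d. L d c (\<lambda>c2 e. G c1 c2 e)) =
    L a b (\<lambda>c1 d. \<Sum>e\<in>{1..2*n}. Lam c d e (\<lambda>c2. G c1 c2 e))"
    unfolding L_Lam[OF assms(2) bc(1)] using bc by (auto simp: L_Lam intro!: sum.cong)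
  also have "\<dots> = (\<Sum>e\<in>{1..2*n}. M (\<lambda>c1 c2. G c1 c2 e) b c a e)"
    by (simp add: L_sum_arg M_def)
  finally show "(\<Sum>e\<in>{1..2*n}. M (\<lambda>c1 c2. G c1 c2 e) b c a e) =
    L a b (\<lambda>c1 d. L d c (\<lambda>c2 e. G c1 c2 e))" by simp
qed

text \<open>Replacing \<open>(a, b)\<close> by \<open>(p b, p a)\<close> preserves
  \<open>diag\<close>, the condition \<open>b < a\<close> and the condition \<open>a = p b\<close>,
  and the flip \<open>H (p d) (p c)\<close> fixes the values on dual pairs that enter the
  sum.\<close>

lemma L_sym: assumes "a \<in> {1..2*n}" "b \<in> {1..2*n}"
  shows "L a b H = L (p b) (p a) (\<lambda>c d. H (p d) (p c))"
proof -
  have "diag (p b) (p a) = diag a b" "p a < p b \<longleftrightarrow> b < a" "p b = p (p a) \<longleftrightarrow> a = p b" 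
    using assms unfolding diag_def p_def by auto
  moreover have "p (p d) = d" if "d \<in> {1..<a}" for d using that assms by (auto simp: p_def)
  ultimately show ?thesis unfolding L_def using assms by (simp add: p_p)
qed

lemma L_cong: assumes "\<And>c d. c \<in> {1..2*n} \<Longrightarrow> d \<in> {1..2*n} \<Longrightarrow> H c d = K c d"
  "a \<in> {1..2*n}" "b \<in> {1..2*n}" shows "L a b H = L a b K"
proof -
  have "p d \<in> {1..2*n}" if "d \<in> {1..<a}" for d using that assms by (auto simp: p_def)
  hence "(\<Sum>d\<in>{1..<a}. v a / v d * H (p d) d) = (\<Sum>d\<in>{1..<a}. v a / v d * K (p d) d)"
    using assms by (intro sum.cong) auto
  thus ?thesis unfolding L_def using assms(1)[of a b] assms(1)[of b a] assms(2,3) by presburger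
qed

lemma row_rel_flip: assumes "row_rel g" shows "row_rel (\<lambda>c d. g (p d) (p c))"
  unfolding row_rel_def
proof (intro conjI allI impI)
  fix s t assume st: "1 \<le> s \<and> s < t \<and> t \<le> 2 * n \<and> t \<noteq> p s"
  have "1 \<le> p t" "p t < p s" "p s \<le> 2*n" "p s \<noteq> p (p t)" using st by (auto simp: p_def)
  thus "g (p s) (p t) = inverse q * g (p t) (p s)" using assms unfolding row_rel_def by blast
next
  fix s assume s: "1 \<le> s \<and> s \<le> n"
  have "Om (\<lambda>c d. g (p d) (p c)) s = Om g s"
    unfolding Om_def by (rule sum.cong) (auto simp: p_p)
  thus "g (p s) (p (p s)) = g (p (p s)) (p s) + qh * Om (\<lambda>c d. g (p d) (p c)) s"
    using assms s unfolding row_rel_def by (auto simp: p_p)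
qed

text \<open>The overlaps \<open>X\<^sub>2 X\<^sub>2 X\<^sub>1\<close> follow from the previous ones by the anti-automorphism
  \<open>X\<^sub>1\<^sub>s \<leftrightarrow> X\<^sub>2\<^sub>p\<^sub>s\<close>, which on the level of coefficients is \<open>L_sym\<close>.\<close>
lemma row_rel_L_right:
  assumes "\<And>c. c \<in> {1..2*n} \<Longrightarrow> row_rel (G c)" "c \<in> {1..2*n}"
  shows "row_rel (\<lambda>a b. L b c (\<lambda>c1 e2. L a c1 (\<lambda>c2 e1. G c2 e1 e2)))"
proof -
  have pr: "i \<in> {1..2*n} \<Longrightarrow> p i \<in> {1..2*n}" for i by (auto simp: p_def)
  have pp: "i \<in> {1..2*n} \<Longrightarrow> p (p i) = i" for i by (auto simp: p_def)
  let ?K = "\<lambda>b c'. L (p c) b (\<lambda>x d. L d c' (\<lambda>y e. G (p e) (p y) (p x)))"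
  have "row_rel (\<lambda>x y. G (p e) (p y) (p x))" if "e \<in> {1..2*n}" for e
    using row_rel_flip[OF assms(1)[OF pr[OF that]]] .
  hence "row_rel ?K" using row_rel_L_left[of "\<lambda>x y e. G (p e) (p y) (p x)" "p c"] pr assms(2) by blast
  hence "row_rel (\<lambda>a b. ?K (p b) (p a))" by (rule row_rel_flip)
  thus ?thesis
  proof (rule row_rel_cong[rotated])
    fix a b assume ab: "a \<in> {1..2*n}" "b \<in> {1..2*n}"
    have "L b c (\<lambda>c1 e2. L a c1 (\<lambda>c2 e1. G c2 e1 e2)) = L (p c) (p b) (\<lambda>x d. L a (p d) (\<lambda>c2 e1. G c2 e1 (p x)))"
      by (rule L_sym[OF ab(2) assms(2)])
    also have "\<dots> = ?K (p b) (p a)"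
    proof (rule L_cong)
      fix x d assume xd: "x \<in> {1..2*n}" "d \<in> {1..2*n}"
      show "L a (p d) (\<lambda>c2 e1. G c2 e1 (p x)) = L d (p a) (\<lambda>y e. G (p e) (p y) (p x))"
        using L_sym[OF ab(1) pr[OF xd(2)], of "\<lambda>c2 e1. G c2 e1 (p x)"] pp[OF xd(2)] by simp
    qed (use pr ab assms in auto)
    finally show "?K (p b) (p a) = L b c (\<lambda>c1 e2. L a c1 (\<lambda>c2 e1. G c2 e1 e2))" by simp
  qed
qed

end

section \<open>Functionals on words in both rows\<close>

context quantum_space begin

section \<open>Linearity of the row relations and of the exchange rule\<close>

lemma row_rel_add: "row_rel f \<Longrightarrow> row_rel g \<Longrightarrow> row_rel (\<lambda>x y. f x y + g x y)"
  unfolding row_rel_def Om_def by (simp add: distrib_left sum.distrib)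

lemma row_rel_diff: "row_rel f \<Longrightarrow> row_rel g \<Longrightarrow> row_rel (\<lambda>x y. f x y - g x y)"
  unfolding row_rel_def Om_def by (simp add: right_diff_distrib sum_subtractf)

lemma row_rel_smult: "row_rel f \<Longrightarrow> row_rel (\<lambda>x y. c * f x y)"
proof -
  have "Om (\<lambda>x y. c * f x y) s = c * Om f s" for s
    unfolding Om_def sum_distrib_left by (simp add: mult.left_commute)
  thus "row_rel f \<Longrightarrow> ?thesis" unfolding row_rel_def by (simp add: distrib_left mult.left_commute)
qed

lemma row_rel_0: "row_rel (\<lambda>x y. 0)" unfolding row_rel_def Om_def by simp

lemma row_rel_L:
  assumes "\<And>c d. c \<in> {1..2*n} \<Longrightarrow> d \<in> {1..2*n} \<Longrightarrow> row_rel (\<lambda>x y. H x y c d)"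
    "a \<in> {1..2*n}" "b \<in> {1..2*n}"
  shows "row_rel (\<lambda>x y. L a b (H x y))"
proof -
  have "p d \<in> {1..2*n}" "d \<in> {1..2*n}" if "d \<in> {1..<a}" for d using that assms by (auto simp: p_def)
  hence 1: "row_rel (\<lambda>x y. \<Sum>d\<in>{1..<a}. v a / v d * H x y (p d) d)"
    using assms by (intro row_rel_sum row_rel_smult) auto
  have 2: "row_rel (\<lambda>x y. if b < a then qh * H x y a b else 0)"
    using assms by (cases "b < a") (auto intro: row_rel_smult row_rel_0)
  have 3: "row_rel (\<lambda>x y. if a = p b then qh * (\<Sum>d\<in>{1..<a}. v a / v d * H x y (p d) d) else 0)"
    using row_rel_smult[OF 1] row_rel_0 by (cases "a = p b") auto
  show ?thesis unfolding L_def
    by (intro row_rel_add row_rel_diff 2 3 row_rel_smult assms)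
qed

lemma L_add: "L a b (\<lambda>c d. F c d + G c d) = L a b F + L a b G"
  unfolding L_def by (simp add: sum.distrib algebra_simps add_divide_distrib)

lemma L_smult: "L a b (\<lambda>c d. k * F c d) = k * L a b F"
  unfolding L_def by (simp add: sum_distrib_left algebra_simps)

lemma L_diff: "L a b (\<lambda>c d. F c d - G c d) = L a b F - L a b G"
  using L_add[of a b F "\<lambda>c d. -1 * G c d"] unfolding L_smult by simp

lemma L_zero: "L a b (\<lambda>c d. 0) = 0"
  unfolding L_def by simp

lemma L_if: "L a b (\<lambda>c d. if P then F c d else 0) = (if P then L a b F else 0)"
  by (simp add: L_zero)

lemma L_swap: "L a b (\<lambda>c d. L x y (\<lambda>c' d'. F c d c' d')) = L x y (\<lambda>c' d'. L a b (\<lambda>c d. F c d c' d'))"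
  unfolding L_def[of x y] by (simp only: L_add L_diff L_smult L_if L_sum_arg finite_atLeastLessThan)

text \<open>\<open>push u a h\<close> evaluates \<open>h\<close> on the result of moving the second-row letter \<open>a\<close> to the right of the
  first-row word \<open>u\<close>.\<close>
primrec push :: "nat list \<Rightarrow> nat \<Rightarrow> (nat list \<Rightarrow> nat \<Rightarrow> 'k) \<Rightarrow> 'k" where
  "push [] = (\<lambda>a h. h [] a)"
| "push (b # u) = (\<lambda>a h. L a b (\<lambda>c d. push u d (\<lambda>u' e. h (c # u') e)))"

lemma push_L: "push u a (\<lambda>u' e. L x y (\<lambda>c d. F c d u' e)) = L x y (\<lambda>c d. push u a (F c d))"
proof (induction u arbitrary: a F)
  case (Cons b u)
  show ?case by (simp add: Cons[of _ "\<lambda>c d u' e. F c d (_ # u') e"] L_swap[of a b x y])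
qed simp

abbreviation "rng \<equiv> {1..2*n}"

lemma push_row:
  assumes "\<And>u' e. u' \<in> lists rng \<Longrightarrow> e \<in> rng \<Longrightarrow> row_rel (\<lambda>x y. H x y u' e)"
    "u \<in> lists rng" "a \<in> rng"
  shows "row_rel (\<lambda>x y. push u a (H x y))"
  using assms(2,3,1)
proof (induction u arbitrary: a H)
  case Nil
  thus ?case by auto
next
  case (Cons b u)
  show ?case unfolding push.simps
  proof (rule row_rel_L)
    fix c d assume "c \<in> rng" "d \<in> rng"
    thus "row_rel (\<lambda>x y. push u d (\<lambda>u' e. H x y (c # u') e))"
      by (intro Cons.IH Cons.prems) auto
  qed (use Cons in auto)
qed

definition row_fun :: "(nat list \<Rightarrow> 'k) \<Rightarrow> bool" where
  "row_fun f \<longleftrightarrow> (\<forall>u\<in>lists rng. \<forall>w\<in>lists rng. row_rel (\<lambda>x y. f (u @ [x,y] @ w)))"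

lemma row_funD: "row_fun f \<Longrightarrow> u \<in> lists rng \<Longrightarrow> w \<in> lists rng \<Longrightarrow> row_rel (\<lambda>x y. f (u @ [x,y] @ w))"
  unfolding row_fun_def by blast

text \<open>Letters before the pair \<open>x\<close>, \<open>y\<close> are crossed linearly. At the
  pair the overlap lemma \<open>row_rel_L_left\<close> applies, with the rest of the word hidden in
  the functional.\<close>

lemma push_row_fun:
  assumes "\<And>e. e \<in> rng \<Longrightarrow> row_fun (\<lambda>u. h u e)" "a \<in> rng"
  shows "row_fun (\<lambda>u. push u a h)"
  unfolding row_fun_def
proof (intro ballI)
  fix u w assume u: "u \<in> lists rng" and w: "w \<in> lists rng"
  show "row_rel (\<lambda>x y. push (u @ [x,y] @ w) a h)"
    using u assms
  proof (induction u arbitrary: a h)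
    case Nil
    have "row_rel (\<lambda>c1 c2. push w e (\<lambda>u' e'. h (c1 # c2 # u') e'))" if "e \<in> rng" for e
    proof (rule push_row[OF _ w that])
      fix u' e' assume "u' \<in> lists rng" "e' \<in> rng"
      thus "row_rel (\<lambda>x y. h (x # y # u') e')"
        using row_funD[OF Nil(1)[of e'], of "[]" u'] by simp
    qed
    thus ?case using row_rel_L_left[of "\<lambda>c1 c2 e. push w e (\<lambda>u' e'. h (c1 # c2 # u') e')" a] Nil by simp
  next
    case (Cons b u)
    have "row_rel (\<lambda>x y. L a b (\<lambda>c d. push (u @ [x, y] @ w) d (\<lambda>u'. h (c # u'))))"
    proof (rule row_rel_L)
      fix c d assume cd: "c \<in> rng" "d \<in> rng"
      show "row_rel (\<lambda>x y. push (u @ [x, y] @ w) d (\<lambda>u'. h (c # u')))"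
      proof (rule Cons.IH)
        fix e assume e: "e \<in> rng"
        show "row_fun (\<lambda>u. h (c # u) e)"
          unfolding row_fun_def
        proof (intro ballI)
          fix u w assume "u \<in> lists rng" "w \<in> lists rng"
          thus "row_rel (\<lambda>x y. h (c # u @ [x, y] @ w) e)"
            using row_funD[OF Cons.prems(1)[OF e], of "c#u" w] cd by simp
        qed
      qed (use cd in auto)
    qed (use Cons in auto)
    thus ?case by simp
  qed
qed

text \<open>By \<open>push_L\<close> both second-row letters can cross the head \<open>b\<close>
  before either crosses the tail; crossing \<open>b\<close> is the overlap
  \<open>row_rel_L_right\<close>.\<close>

lemma push_push:
  assumes "u \<in> lists rng" "\<And>u e. u \<in> lists rng \<Longrightarrow> row_rel (\<lambda>e' e. H u e' e)"
  shows "row_rel (\<lambda>x y. push u y (\<lambda>u' e. push u' x (\<lambda>u'' e'. H u'' e' e)))"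
  using assms
proof (induction u arbitrary: H)
  case (Cons b u)
  let ?G = "\<lambda>c2 d2 d. push u d (\<lambda>u' e. push u' d2 (\<lambda>u'' e'. H (c2 # u'') e' e))"
  have "row_rel (\<lambda>d2 d. ?G c2 d2 d)" if "c2 \<in> rng" for c2
    using Cons.IH[of "\<lambda>u. H (c2 # u)"] Cons.prems that by auto
  moreover have "b \<in> rng" by (rule Cons.hyps)
  ultimately have "row_rel (\<lambda>x y. L y b (\<lambda>c d. L x c (\<lambda>c2 d2. ?G c2 d2 d)))"
    by (rule row_rel_L_right)
  thus ?case by (simp add: push_L)
qed simp

text \<open>The transposed action of a generator on functionals of (first-row word, second-row word).\<close>
fun act :: "gen \<Rightarrow> (nat list \<Rightarrow> nat list \<Rightarrow> 'k) \<Rightarrow> nat list \<Rightarrow> nat list \<Rightarrow> 'k" where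
  "act (r, j) h = (\<lambda>u w. if r = 1 then h (j # u) w else push u j (\<lambda>u' e. h u' (e # w)))"

text \<open>\<open>Phi z h\<close> is the value of \<open>h\<close> on \<open>z\<close> after all
  second-row letters have been moved to the right; the first letter of \<open>z\<close> is
  transposed first because transposition reverses composition.\<close>

primrec Phi :: "gen list \<Rightarrow> (nat list \<Rightarrow> nat list \<Rightarrow> 'k) \<Rightarrow> 'k" where
  "Phi [] = (\<lambda>h. h [] [])"
| "Phi (x # z) = (\<lambda>h. Phi z (act x h))"

text \<open>Only the relations inside each row are imposed. The mixed relations hold for every
  functional by construction of \<open>act\<close>, see \<open>Phi_mixed\<close>.\<close>

definition compatible :: "(nat list \<Rightarrow> nat list \<Rightarrow> 'k) \<Rightarrow> bool" where
  "compatible h \<longleftrightarrow> (\<forall>w\<in>lists rng. row_fun (\<lambda>u. h u w)) \<and> (\<forall>u\<in>lists rng. row_fun (h u))"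

lemma gens_lists: "(r, j) \<in> gens n \<Longrightarrow> j \<in> rng" "(r, j) \<in> gens n \<Longrightarrow> r \<in> {1,2}"
  by (auto simp: gens_def)

lemma row_funI: "(\<And>u w. u \<in> lists rng \<Longrightarrow> w \<in> lists rng \<Longrightarrow> row_rel (\<lambda>x y. f (u @ [x,y] @ w))) \<Longrightarrow> row_fun f"
  unfolding row_fun_def by blast

lemma row_fun_Cons: "row_fun f \<Longrightarrow> c \<in> rng \<Longrightarrow> row_fun (\<lambda>u. f (c # u))"
proof (rule row_funI)
  fix u w assume "row_fun f" "c \<in> rng" "u \<in> lists rng" "w \<in> lists rng"
  thus "row_rel (\<lambda>x y. f (c # u @ [x, y] @ w))" using row_funD[of f "c#u" w] by simp
qed

text \<open>For a second-row letter the first argument is the content of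
  \<open>push_row_fun\<close>; the second argument merely receives one more letter in front.\<close>

lemma compatible_act: assumes "compatible h" "x \<in> gens n" shows "compatible (act x h)"
proof -
  obtain r j where x: "x = (r,j)" "r \<in> {1,2}" "j \<in> rng" using assms gens_lists by (cases x) auto
  have h1: "row_fun (\<lambda>u. h u w)" if "w \<in> lists rng" for w using assms that by (auto simp: compatible_def)
  have h2: "row_fun (h u)" if "u \<in> lists rng" for u using assms that by (auto simp: compatible_def)
  show ?thesis
  proof (cases "r = 1")
    case True
    thus ?thesis using x h1 h2 unfolding compatible_def by (auto intro!: row_fun_Cons)
  next
    case False
    have a: "row_fun (\<lambda>u. push u j (\<lambda>u' e. h u' (e # w)))" if "w \<in> lists rng" for w
      using that x by (intro push_row_fun h1) auto
    have "row_fun (\<lambda>w. push u j (\<lambda>u' e. h u' (e # w)))" if u: "u \<in> lists rng" for u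
    proof (rule row_funI)
      fix w1 w2 assume w: "w1 \<in> lists rng" "w2 \<in> lists rng"
      show "row_rel (\<lambda>x y. push u j (\<lambda>u' e. h u' (e # w1 @ [x, y] @ w2)))"
      proof (rule push_row[OF _ u x(3)])
        fix u' e assume "u' \<in> lists rng" "e \<in> rng"
        thus "row_rel (\<lambda>x y. h u' (e # w1 @ [x, y] @ w2))"
          using row_funD[OF h2, of u' "e # w1" w2] w by simp
      qed
    qed
    thus ?thesis using a x False unfolding compatible_def by auto
  qed
qed

lemma Phi_append: "Phi (z1 @ z2) h = Phi z2 (foldl (\<lambda>h x. act x h) h z1)"
  by (induction z1 arbitrary: h) auto

lemma compatible_acts: assumes "compatible h" "z \<in> lists (gens n)" shows "compatible (foldl (\<lambda>h x. act x h) h z)"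
  using assms(2,1) by (induction z arbitrary: h) (auto simp: compatible_act simp del: act.simps)

lemma Phi_L: "Phi z (\<lambda>u w. L a b (\<lambda>c d. F c d u w)) = L a b (\<lambda>c d. Phi z (F c d))"
proof (induction z arbitrary: F)
  case (Cons x z)
  obtain r j where x: "x = (r,j)" by (cases x) auto
  have "act x (\<lambda>u w. L a b (\<lambda>c d. F c d u w)) = (\<lambda>u w. L a b (\<lambda>c d. act x (F c d) u w))"
    unfolding x act.simps by (simp add: push_L fun_eq_iff)
  thus ?case using Cons by (simp del: act.simps)
qed simp

lemma Phi_row:
  assumes "\<And>u w. u \<in> lists rng \<Longrightarrow> w \<in> lists rng \<Longrightarrow> row_rel (\<lambda>x y. F x y u w)"
   "z \<in> lists (gens n)"
  shows "row_rel (\<lambda>x y. Phi z (F x y))"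
  using assms(2,1)
proof (induction z arbitrary: F)
  case Nil
  thus ?case by simp
next
  case (Cons a z)
  obtain r j where a: "a = (r,j)" "r \<in> {1,2}" "j \<in> rng" using Cons gens_lists by (cases a) auto
  have "row_rel (\<lambda>x y. act a (F x y) u w)" if "u \<in> lists rng" "w \<in> lists rng" for u w
  proof (cases "r = 1")
    case True thus ?thesis using a that Cons.prems[of "j#u" w] by simp
  next
    case False
    have "row_rel (\<lambda>x y. push u j (\<lambda>u' e. F x y u' (e # w)))"
      by (rule push_row) (use a that Cons.prems in auto)
    thus ?thesis using False a by simp
  qed
  thus ?case using Cons.IH[of "\<lambda>x y. act a (F x y)"] by (simp del: act.simps)
qed

text \<open>The prefix is absorbed into another compatible functional and the suffix acts linearly,
  so only the two letters count: compatibility handles the first row, \<open>push_push\<close> the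
  second.\<close>

lemma Phi_row_rel:
  assumes "compatible h" "z1 \<in> lists (gens n)" "z2 \<in> lists (gens n)" "r \<in> {1,2}"
  shows "row_rel (\<lambda>x y. Phi (z1 @ [(r,x),(r,y)] @ z2) h)"
proof -
  define k where "k = foldl (\<lambda>h x. act x h) h z1"
  have k: "compatible k" unfolding k_def using compatible_acts assms by blast
  have "row_rel (\<lambda>x y. Phi z2 (act (r,y) (act (r,x) k)))"
  proof (rule Phi_row[OF _ assms(3)])
    fix u w assume uw: "u \<in> lists rng" "w \<in> lists rng"
    show "row_rel (\<lambda>x y. act (r, y) (act (r, x) k) u w)"
    proof (cases "r = 1")
      case True
      have "row_fun (\<lambda>u. k u w)" using k uw by (auto simp: compatible_def)
      thus ?thesis using row_funD[of _ "[]" u] True uw by fastforce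
    next
      case False
      have "row_rel (\<lambda>x y. push u y (\<lambda>u' e. push u' x (\<lambda>u'' e'. k u'' (e' # e # w))))"
      proof (rule push_push[OF uw(1)])
        fix u assume "u \<in> lists rng"
        hence "row_fun (k u)" using k by (auto simp: compatible_def)
        thus "row_rel (\<lambda>e' e. k u (e' # e # w))" using row_funD[of _ "[]" w] uw by fastforce
      qed
      thus ?thesis using False by simp
    qed
  qed
  thus ?thesis by (simp add: Phi_append k_def del: act.simps)
qed

lemma Phi_mixed: "Phi (z1 @ [(2,a),(1,b)] @ z2) h = L a b (\<lambda>c d. Phi (z1 @ [(1,c),(2,d)] @ z2) h)"
proof -
  define k where "k = foldl (\<lambda>h x. act x h) h z1"
  have "act (1,b) (act (2,a) k) = (\<lambda>u w. L a b (\<lambda>c d. act (2,d) (act (1,c) k) u w))"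
    by (simp add: fun_eq_iff)
  hence "Phi z2 (act (1,b) (act (2,a) k)) = L a b (\<lambda>c d. Phi z2 (act (2,d) (act (1,c) k)))"
    using Phi_L by metis
  thus ?thesis by (simp add: Phi_append k_def del: act.simps)
qed

lemma Phi_ordered: "Phi (map (Pair 1) u @ map (Pair 2) w) h = h u w"
proof -
  have "Phi (map (Pair 2) w) h = h [] w" for h
    by (induction w arbitrary: h) auto
  thus ?thesis by (induction u arbitrary: h) auto
qed

end

section \<open>Functionals on words in one row\<close>
definition addv :: "nat \<Rightarrow> 'a::ab_semigroup_add \<Rightarrow> (nat \<Rightarrow> 'a) \<Rightarrow> nat \<Rightarrow> 'a" where
  "addv i c f = (\<lambda>j. if j = i then f j + c else f j)"

lemma addv_commute: "addv i c (addv j d f) = addv j d (addv i c f)"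
  by (auto simp: addv_def fun_eq_iff add.assoc add.commute[of c d])

lemma addv_cancel: "addv i (-1) (addv i 1 f) = f" "addv i 1 (addv i (-1) f) = f" for f :: "nat \<Rightarrow> int"
  by (auto simp: addv_def fun_eq_iff)

lemma addv_same: "addv i c f i = f i + c" by (simp add: addv_def)

lemma addv_other: "i \<noteq> j \<Longrightarrow> addv i c f j = f j" by (simp add: addv_def)

context quantum_space begin

section \<open>The Laurent monomial model of a single row\<close>

definition S :: "(nat \<Rightarrow> int) \<Rightarrow> nat \<Rightarrow> int" where "S \<alpha> s = (\<Sum>l\<in>{1..<s}. \<alpha> l)"

lemma S_addv: "S (addv t c \<alpha>) s = S \<alpha> s + (if 1 \<le> t \<and> t < s then c else 0)"
proof -
  have "S (addv t c \<alpha>) s = (\<Sum>l\<in>{1..<s}. \<alpha> l + (if l = t then c else 0))"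
    unfolding S_def addv_def by (rule sum.cong) auto
  thus ?thesis by (simp add: sum.distrib S_def)
qed

lemma S_Suc: "1 \<le> s \<Longrightarrow> S \<alpha> (Suc s) = S \<alpha> s + \<alpha> s" by (simp add: S_def)

text \<open>Transposed left multiplication operators of the row algebra on a space with basis \<open>X\<^sup>\<alpha> \<Omega>\<^sup>\<beta>\<close> with
  \<open>\<alpha> \<in> \<int>\<^sup>n\<close>, \<open>\<beta> \<in> \<nat>\<^sup>n\<close>: inverting \<open>X\<^sub>s\<close> turns \<open>X\<^sub>s X\<^sub>p\<^sub>s = \<Omega>\<^sub>s\<^sub>-\<^sub>1 - q \<Omega>\<^sub>s\<close> into a definition of \<open>X\<^sub>p\<^sub>s\<close>.\<close>
definition fock_op :: "nat \<Rightarrow> ((nat \<Rightarrow> int) \<Rightarrow> (nat \<Rightarrow> nat) \<Rightarrow> 'k) \<Rightarrow> (nat \<Rightarrow> int) \<Rightarrow> (nat \<Rightarrow> nat) \<Rightarrow> 'k" where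
  "fock_op s h \<alpha> \<beta> = (if s \<le> n then q powi (- S \<alpha> s) * h (addv s 1 \<alpha>) \<beta>
     else q powi (- S \<alpha> (p s)) * (h (addv (p s) (-1) \<alpha>) (addv (p s - 1) 1 \<beta>)
        - (if p s < n then q powi (1 - 2 * \<alpha> (p s)) * h (addv (p s) (-1) \<alpha>) (addv (p s) 1 \<beta>) else 0)))"

text \<open>Transposed multiplication by \<open>\<Omega>\<^sub>s\<close>, which is zero at
  \<open>s = n\<close> and picks up \<open>q\<^sup>-\<^sup>2\<close> when it passes any of the first
  \<open>s\<close> letters. These factors also explain the exponent
  \<open>1 - 2 * \<alpha> (p s)\<close> in \<open>fock_op\<close>.\<close>

definition OmC where "OmC h \<alpha> \<beta> s = (if s < n then q powi (- 2 * S \<alpha> (Suc s)) * h \<alpha> (addv s 1 \<beta>) else 0)"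

lemma powi_arith: "q powi (a + b) = q powi a * q powi b" "q powi (a - b) = q powi a / q powi b"
  "q powi (- a) = 1 / q powi a" "q powi a \<noteq> 0" "q powi (2 * a) = q powi a * q powi a" 
proof -
  show add: "q powi (a + b) = q powi a * q powi b" for a b using q0 by (simp add: power_int_add)
  show "q powi (2 * a) = q powi a * q powi a" using add[of a a] by simp
qed (use q0 in \<open>auto simp: power_int_diff power_int_minus_divide\<close>)

text \<open>The outer operator belongs to the right-hand letter, since the operators are transposed:
  the first identity is the formula for \<open>X\<^sub>s X\<^sub>s\<^sub>'\<close>, the second that
  for \<open>X\<^sub>s\<^sub>' X\<^sub>s\<close>.\<close>

lemma fock_op_pair: assumes "1 \<le> s" "s \<le> n"
  shows "fock_op (p s) (fock_op s h) \<alpha> \<beta> = OmC h \<alpha> \<beta> (s-1) - q * OmC h \<alpha> \<beta> s"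
    "fock_op s (fock_op (p s) h) \<alpha> \<beta> = OmC h \<alpha> \<beta> (s-1) - OmC h \<alpha> \<beta> s / q"
proof -
  have ps: "\<not> p s \<le> n" "p (p s) = s" "s - 1 < n" using assms by (auto simp: p_def)
  show "fock_op (p s) (fock_op s h) \<alpha> \<beta> = OmC h \<alpha> \<beta> (s-1) - q * OmC h \<alpha> \<beta> s"
    unfolding fock_op_def[of "p s"] fock_op_def[of s] OmC_def using ps assms q0
    by (simp add: S_addv S_Suc addv_cancel powi_arith field_simps)
  show "fock_op s (fock_op (p s) h) \<alpha> \<beta> = OmC h \<alpha> \<beta> (s-1) - OmC h \<alpha> \<beta> s / q"
    unfolding fock_op_def[of "p s"] fock_op_def[of s] OmC_def using ps assms q0
    by (simp add: S_addv S_Suc addv_cancel powi_arith addv_same field_simps)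
qed

lemma fock_op_comm: assumes "1 \<le> s" "s < t" "t \<le> 2*n" "t \<noteq> p s"
  shows "fock_op s (fock_op t h) \<alpha> \<beta> = inverse q * fock_op t (fock_op s h) \<alpha> \<beta>"
proof -
  consider "t \<le> n" | "s \<le> n" "\<not> t \<le> n" "p t < s" | "s \<le> n" "\<not> t \<le> n" "s < p t" | "\<not> s \<le> n" "\<not> t \<le> n"
    using assms unfolding p_def by linarith
  thus ?thesis
  proof cases
    case 1
    thus ?thesis unfolding fock_op_def[of s] fock_op_def[of t] using assms q0
      by (simp add: S_addv addv_commute powi_arith field_simps)
  next
    case 2
    hence "1 \<le> p t" "p t \<noteq> s" "\<not> s < p t" using assms by (auto simp: p_def)
    thus ?thesis unfolding fock_op_def[of s] fock_op_def[of t] using assms q0 2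
      by (simp add: S_addv addv_commute[of s] addv_other powi_arith field_simps)
  next
    case 3
    hence "1 \<le> p t" "p t \<noteq> s" "\<not> p t < s" using assms by (auto simp: p_def)
    thus ?thesis unfolding fock_op_def[of s] fock_op_def[of t] using assms q0 3
      by (simp add: S_addv addv_commute[of s] addv_other powi_arith field_simps)
  next
    case 4
    hence "1 \<le> p t" "p t < p s" "\<not> p s < p t" "p s \<noteq> p t" "p t < n" using assms by (auto simp: p_def)
    thus ?thesis unfolding fock_op_def[of s] fock_op_def[of t] using assms q0 4
      by (auto simp: S_addv addv_commute[of "p s"] addv_commute[of "p s - Suc 0"] addv_other powi_arith field_simps)
  qed
qed

lemma row_rel_rop2: "row_rel (\<lambda>x y. fock_op y (fock_op x h) \<alpha> \<beta>)"
proof -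
  let ?g = "\<lambda>x y. fock_op y (fock_op x h) \<alpha> \<beta>"
  have "Om ?g s = OmC h \<alpha> \<beta> s" if "s \<le> n" for s
    using that
  proof (induction s rule: inc_induct)
    case base
    show ?case by (simp add: OmC_def)
  next
    case (step s)
    show ?case using Om_rec[of "Suc s" ?g] step fock_op_pair(1)[of "Suc s" h \<alpha> \<beta>] by simp
  qed
  thus ?thesis unfolding row_rel_def using fock_op_comm fock_op_pair
    by (auto simp: field_simps)
qed

lemma row_rel_rop: assumes "\<And>\<alpha> \<beta>. row_rel (\<lambda>x y. F x y \<alpha> \<beta>)" shows "row_rel (\<lambda>x y. fock_op z (F x y) \<alpha> \<beta>)"
proof -
  have "row_rel (\<lambda>x y. if p z < n then q powi (1 - 2 * \<alpha> (p z)) * F x y (addv (p z) (-1) \<alpha>) (addv (p z) 1 \<beta>) else 0)"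
    using assms by (cases "p z < n") (auto intro: row_rel_smult row_rel_0)
  thus ?thesis unfolding fock_op_def using assms
    by (cases "z \<le> n") (auto intro!: row_rel_smult row_rel_diff)
qed

primrec fock_val :: "nat list \<Rightarrow> ((nat \<Rightarrow> int) \<Rightarrow> (nat \<Rightarrow> nat) \<Rightarrow> 'k) \<Rightarrow> 'k" where
  "fock_val [] = (\<lambda>h. h (\<lambda>_. 0) (\<lambda>_. 0))"
| "fock_val (x # w) = (\<lambda>h. fock_val w (fock_op x h))"

lemma fock_val_row: assumes "\<And>\<alpha> \<beta>. row_rel (\<lambda>x y. F x y \<alpha> \<beta>)" shows "row_rel (\<lambda>x y. fock_val w (F x y))"
  using assms
proof (induction w arbitrary: F)
  case (Cons a w)
  show ?case unfolding fock_val.simps by (rule Cons.IH[OF row_rel_rop[OF Cons.prems]])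
qed simp

lemma row_fun_rf: "row_fun (\<lambda>w. fock_val w h)"
proof (rule row_funI)
  fix u w
  show "row_rel (\<lambda>x y. fock_val (u @ [x,y] @ w) h)"
  proof (induction u arbitrary: h)
    case Nil
    show ?case using fock_val_row[OF row_rel_rop2] by simp
  qed simp
qed

text \<open>\<open>weight\<close> and \<open>shift\<close> are the exponents \<open>\<alpha>\<close>
  and \<open>\<beta>\<close> of the leading term of a word. A letter \<open>p s\<close> lowers
  \<open>\<alpha>\<close> at \<open>s\<close> and raises \<open>\<beta>\<close> at
  \<open>s - 1\<close>, the index of \<open>\<Omega>\<^sub>s\<^sub>-\<^sub>1\<close>; hence the
  \<open>Suc\<close> in \<open>shift\<close>.\<close>

definition weight :: "nat list \<Rightarrow> nat \<Rightarrow> int" where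
  "weight w = (\<lambda>s. if 1 \<le> s \<and> s \<le> n then int (count_list w s) - int (count_list w (p s)) else 0)"

definition shift :: "nat list \<Rightarrow> nat \<Rightarrow> nat" where
  "shift w = (\<lambda>s. if s < n then count_list w (p (Suc s)) else 0)"

text \<open>The weights are chosen so that taking \<open>\<Omega>\<^sub>s\<close> instead of
  \<open>\<Omega>\<^sub>s\<^sub>-\<^sub>1\<close> raises the level by exactly one.\<close>

definition level :: "(nat \<Rightarrow> nat) \<Rightarrow> nat" where "level \<beta> = (\<Sum>i\<le>n. i * \<beta> i)"

lemma level_addv: "i \<le> n \<Longrightarrow> level (addv i 1 \<beta>) = level \<beta> + i"
proof -
  assume i: "i \<le> n"
  have "level (addv i 1 \<beta>) = (\<Sum>j\<le>n. j * \<beta> j + (if j = i then i else 0))"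
    unfolding level_def addv_def by (rule sum.cong) auto
  thus ?thesis using i by (simp add: sum.distrib level_def)
qed

text \<open>Choosing the term \<open>\<Omega>\<^sub>s\<^sub>-\<^sub>1\<close> in every factor \<open>X\<^sub>p\<^sub>s\<close> gives the unique term of least level.\<close>
lemma fock_val_leading:
  assumes "w \<in> lists rng"
  shows "\<exists>c. c \<noteq> 0 \<and> (\<forall>h. (\<forall>\<beta>. level \<beta> > level (shift w) \<longrightarrow> h (weight w) \<beta> = 0) \<longrightarrow> fock_val w h = c * h (weight w) (shift w))"
  using assms
proof (induction w)
  case Nil
  have "weight [] = (\<lambda>_. 0)" "shift [] = (\<lambda>_. 0)" by (auto simp: weight_def shift_def fun_eq_iff)
  thus ?case by (intro exI[of _ 1]) simp
next
  case (Cons x w)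
  then obtain c where c: "c \<noteq> 0" "\<And>h. (\<And>\<beta>. level \<beta> > level (shift w) \<Longrightarrow> h (weight w) \<beta> = 0) \<Longrightarrow> fock_val w h = c * h (weight w) (shift w)"
    by blast
  have x: "1 \<le> x" "x \<le> 2*n" using Cons by auto
  show ?case
  proof (cases "x \<le> n")
    case True
    have A: "weight (x # w) = addv x 1 (weight w)" using True x by (auto simp: weight_def addv_def fun_eq_iff p_def)
    have B: "shift (x # w) = shift w" using True by (auto simp: shift_def fun_eq_iff p_def)
    let ?k = "q powi (- S (weight w) x)"
    have "fock_val (x # w) h = (c * ?k) * h (weight (x#w)) (shift (x#w))"
      if h: "\<And>\<beta>. level \<beta> > level (shift (x#w)) \<Longrightarrow> h (weight (x#w)) \<beta> = 0" for h
    proof -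
      have "fock_val w (fock_op x h) = c * fock_op x h (weight w) (shift w)"
        by (rule c(2)) (use h True in \<open>auto simp: fock_op_def A B\<close>)
      thus ?thesis using True by (simp add: fock_op_def A B)
    qed
    thus ?thesis using c(1) q0 by (intro exI[of _ "c * ?k"]) auto
  next
    case False
    define t where "t = p x"
    have t: "1 \<le> t" "t \<le> n" "p x = t" "x = p t" using False x by (auto simp: t_def p_def)
    have A: "weight (x # w) = addv t (-1) (weight w)" using t by (auto simp: weight_def addv_def fun_eq_iff p_def)
    have B: "shift (x # w) = addv (t-1) 1 (shift w)" using t x by (auto simp: shift_def addv_def fun_eq_iff p_def)
    have lB: "level (shift (x # w)) = level (shift w) + (t - 1)" unfolding B by (rule level_addv) (use t in auto)
    let ?k = "q powi (- S (weight w) t)"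
    have "fock_val (x # w) h = (c * ?k) * h (weight (x#w)) (shift (x#w))"
      if h: "\<And>\<beta>. level \<beta> > level (shift (x#w)) \<Longrightarrow> h (weight (x#w)) \<beta> = 0" for h
    proof -
      have z1: "h (weight (x#w)) (addv (t-1) 1 \<beta>) = 0" if "level \<beta> > level (shift w)" for \<beta>
        using h[of "addv (t-1) 1 \<beta>"] lB level_addv[of "t-1" \<beta>] t that by simp
      \<comment> \<open>Equality is allowed here, unlike in \<open>z1\<close>: this term raises the
        level by \<open>t\<close>, one more than the leading term does.\<close>
      have z2: "h (weight (x#w)) (addv t 1 \<beta>) = 0" if "level \<beta> \<ge> level (shift w)" for \<beta>
        using h[of "addv t 1 \<beta>"] lB level_addv[of "t" \<beta>] t that by simp
      have "fock_op x h (weight w) \<beta> = 0" if "level \<beta> > level (shift w)" for \<beta>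
        using z1[OF that] z2[of \<beta>] that False t(3) by (simp add: fock_op_def A)
      hence "fock_val w (fock_op x h) = c * fock_op x h (weight w) (shift w)" by (rule c(2))
      thus ?thesis using False z2[of "shift w"] t(3) by (simp add: fock_op_def A B)
    qed
    thus ?thesis using c(1) q0 by (intro exI[of _ "c * ?k"]) auto
  qed
qed

text \<open>\<open>shift\<close> recovers the multiplicities of the letters above \<open>n\<close>,
  then \<open>weight\<close> those up to \<open>n\<close>, and a sorted word is determined by its
  multiplicities.\<close>

lemma wt_inj: assumes "sorted u" "sorted w" "u \<in> lists rng" "w \<in> lists rng" "weight u = weight w" "shift u = shift w"
  shows "u = w"
proof -
  have 1: "count_list u (p s) = count_list w (p s)" if "1 \<le> s" "s \<le> n" for s
  proof -
    have "s - 1 < n" "Suc (s-1) = s" using that by auto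
    thus ?thesis using fun_cong[OF assms(6), of "s-1"] by (simp add: shift_def)
  qed
  have 2: "count_list u s = count_list w s" if "1 \<le> s" "s \<le> n" for s
    using fun_cong[OF assms(5), of s] 1[OF that] that by (auto simp: weight_def)
  have "count_list u x = count_list w x" for x
  proof (cases "x \<in> rng")
    case True
    show ?thesis
    proof (cases "x \<le> n")
      case False
      hence "x = p (p x)" "1 \<le> p x" "p x \<le> n" using True by (auto simp: p_def)
      thus ?thesis using 1[of "p x"] by simp
    qed (use True 2 in auto)
  next
    case False
    hence "x \<notin> set u" "x \<notin> set w" using assms by auto
    thus ?thesis by (simp add: count_list_0_iff)
  qed
  hence "mset u = mset w" by (simp add: multiset_eq_iff count_mset)
  thus ?thesis using assms(1,2) by (metis properties_for_sort)
qed

definition detect :: "nat list \<Rightarrow> nat list \<Rightarrow> 'k" where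
  "detect u w = fock_val w (\<lambda>\<alpha> \<beta>. if \<alpha> = weight u \<and> \<beta> = shift u then 1 else 0)"

lemma detect_same: "u \<in> lists rng \<Longrightarrow> detect u u \<noteq> 0"
  using fock_val_leading[of u] unfolding detect_def by auto

text \<open>By the level hypothesis the delta function of \<open>u\<close> lives at or below the
  leading level of \<open>w\<close>, so only the leading term of \<open>w\<close> could meet it;
  that term sits at another point by \<open>wt_inj\<close>.\<close>

lemma detect_other: assumes "sorted u" "sorted w" "u \<in> lists rng" "w \<in> lists rng" "level (shift u) \<le> level (shift w)" "u \<noteq> w"
  shows "detect u w = 0"
proof -
  have "\<not> (weight w = weight u \<and> shift w = shift u)" using wt_inj[of u w] assms by auto
  thus ?thesis using fock_val_leading[OF assms(4)] assms(5) unfolding detect_def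
    by (elim exE conjE) (drule spec[of _ "(\<lambda>\<alpha> \<beta>. if \<alpha> = weight u \<and> \<beta> = shift u then 1 else 0)"], auto)
qed

lemma compatible_det: "compatible (\<lambda>u w. detect u1 u * detect u2 w)"
proof -
  have "row_fun (\<lambda>w. c * detect u w)" for u c
    unfolding detect_def by (rule row_funI, rule row_rel_smult, rule row_funD[OF row_fun_rf])
  moreover have "row_fun (\<lambda>w. detect u w * c)" for u c using calculation[of c u] by (simp add: mult.commute)
  ultimately show ?thesis unfolding compatible_def by blast
qed

end

section \<open>The free algebra and its functionals\<close>
definition fa_supp :: "('k::field) fa \<Rightarrow> gen list set" where "fa_supp f = {w. f w \<noteq> 0}"

definition fa_over :: "gen set \<Rightarrow> ('k::field) fa set" where
  "fa_over X = {f. finite (fa_supp f) \<and> fa_supp f \<subseteq> lists X}"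

lemma FA_eq: "FA n = fa_over (gens n)"
  unfolding FA_def fa_over_def fa_supp_def by (auto simp: in_lists_conv_set subset_iff)

lemma FA_def': "FA n = {f. finite (fa_supp f) \<and> fa_supp f \<subseteq> lists (gens n)}"
  unfolding FA_eq fa_over_def ..

lemma fa_supp_simps:
  "fa_supp (fa_add f g) \<subseteq> fa_supp f \<union> fa_supp g"
  "fa_supp (fa_sub f g) \<subseteq> fa_supp f \<union> fa_supp g"
  "fa_supp (fa_smult c f) \<subseteq> fa_supp f"
  "fa_supp (fa_word w) = {w}"
  "fa_supp (fa_sum F S) \<subseteq> (\<Union>i\<in>S. fa_supp (F i))"
  unfolding fa_supp_def fa_add_def fa_sub_def fa_smult_def fa_word_def fa_sum_def
  by (auto dest: sum.not_neutral_contains_not_neutral)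

lemma append_pairs: "(\<lambda>i. (take i w, drop i w)) ` {..length w} = {(u, v). u @ v = w}"
proof (intro equalityI subsetI)
  fix x assume "x \<in> {(u, v). u @ v = w}"
  hence "x = (take (length (fst x)) w, drop (length (fst x)) w)" "length (fst x) \<in> {..length w}" by auto
  thus "x \<in> (\<lambda>i. (take i w, drop i w)) ` {..length w}" by (rule image_eqI)
qed auto

lemma fa_mult_sum_pairs: "fa_mult f g w = (\<Sum>(u, v)\<in>{(u, v). u @ v = w}. f u * g v)"
proof -
  have "inj_on (\<lambda>i. (take i w, drop i w)) {..length w}"
  proof (rule inj_onI)
    fix i j assume "i \<in> {..length w}" "j \<in> {..length w}" "(take i w, drop i w) = (take j w, drop j w)"
    hence "length (take i w) = length (take j w)" "i \<le> length w" "j \<le> length w" by auto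
    thus "i = j" by simp
  qed
  thus ?thesis unfolding fa_mult_def append_pairs[symmetric] by (subst sum.reindex) auto
qed

lemma finite_append_pairs: "finite {(u, v). u @ v = w}"
  unfolding append_pairs[symmetric] by simp

lemma fa_mult_supp_sum:
  assumes "finite (fa_supp f)" "finite (fa_supp g)"
  shows "fa_mult f g w = (\<Sum>(u, v)\<in>fa_supp f \<times> fa_supp g. if u @ v = w then f u * g v else 0)"
proof -
  let ?S = "fa_supp f \<times> fa_supp g"
  have "(\<Sum>(u, v)\<in>?S. if u @ v = w then f u * g v else 0) = (\<Sum>(u, v)\<in>?S \<inter> {(u, v). u @ v = w}. f u * g v)"
    using assms by (intro sum.mono_neutral_cong_right) (auto split: if_splits)
  also have "\<dots> = fa_mult f g w" unfolding fa_mult_sum_pairs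
    by (intro sum.mono_neutral_left finite_append_pairs) (auto simp: fa_supp_def)
  finally show ?thesis by simp
qed

lemma fa_supp_mult: "fa_supp (fa_mult f g) \<subseteq> (\<lambda>(u, v). u @ v) ` (fa_supp f \<times> fa_supp g)"
proof
  fix w assume "w \<in> fa_supp (fa_mult f g)"
  hence "(\<Sum>(u, v)\<in>{(u, v). u @ v = w}. f u * g v) \<noteq> 0" by (simp add: fa_supp_def fa_mult_sum_pairs)
  then obtain x where "x \<in> {(u, v). u @ v = w}" "(case x of (u, v) \<Rightarrow> f u * g v) \<noteq> 0"
    by (rule sum.not_neutral_contains_not_neutral)
  thus "w \<in> (\<lambda>(u, v). u @ v) ` (fa_supp f \<times> fa_supp g)" by (force simp: fa_supp_def)
qed

lemma fa_mult_assoc: "fa_mult (fa_mult f g) h = fa_mult f (fa_mult g h)"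
proof
  fix w
  have "fa_mult (fa_mult f g) h w =
    (\<Sum>i\<le>length w. \<Sum>j\<le>i. f (take j w) * g (drop j (take i w)) * h (drop i w))"
    unfolding fa_mult_def by (intro sum.cong) (auto simp: sum_distrib_right min_def)
  also have "\<dots> = (\<Sum>(i, j)\<in>(SIGMA i:{..length w}. {..i}). f (take j w) * g (drop j (take i w)) * h (drop i w))"
    by (simp add: sum.Sigma)
  also have "\<dots> = (\<Sum>(j, k)\<in>(SIGMA j:{..length w}. {..length w - j}).
      f (take j w) * (g (take k (drop j w)) * h (drop k (drop j w))))"
    by (rule sum.reindex_bij_witness[where i="\<lambda>(j,k). (j + k, j)" and j="\<lambda>(i,j). (j, i - j)"])
       (auto simp: drop_take mult.assoc add.commute)
  also have "\<dots> = fa_mult f (fa_mult g h) w"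
    unfolding fa_mult_def by (simp add: sum.Sigma sum_distrib_left)
  finally show "fa_mult (fa_mult f g) h w = fa_mult f (fa_mult g h) w" .
qed

lemma fa_mult_word_left: "fa_mult (fa_word u) f w = (if take (length u) w = u then f (drop (length u) w) else 0)"
proof (cases "take (length u) w = u")
  case True
  hence w: "w = u @ drop (length u) w" by (metis append_take_drop_id)
  have "fa_mult (fa_word u) f w = (\<Sum>(x, v)\<in>{(u, drop (length u) w)}. fa_word u x * f v)"
    unfolding fa_mult_sum_pairs using w
    by (intro sum.mono_neutral_right finite_append_pairs) (auto simp: fa_word_def split: if_splits)
  thus ?thesis using True by (simp add: fa_word_def)
next
  case False
  thus ?thesis unfolding fa_mult_sum_pairs by (intro trans[OF sum.neutral]) (auto simp: fa_word_def)
qed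

lemma fa_mult_word_right: "fa_mult f (fa_word u) (x @ u) = f x"
proof -
  have "fa_mult f (fa_word u) (x @ u) = (\<Sum>(y, v)\<in>{(x, u)}. f y * fa_word u v)"
    unfolding fa_mult_sum_pairs
    by (intro sum.mono_neutral_right finite_append_pairs) (auto simp: fa_word_def split: if_splits)
  thus ?thesis by (simp add: fa_word_def)
qed

lemma fa_mult_words: "fa_mult (fa_word u) (fa_word v) = fa_word (u @ v)"
proof
  fix w
  have "take (length u) w = u \<and> drop (length u) w = v \<longleftrightarrow> w = u @ v"
    by (metis append_take_drop_id append_eq_conv_conj)
  thus "fa_mult (fa_word u) (fa_word v) w = fa_word (u @ v) w" unfolding fa_mult_word_left by (auto simp: fa_word_def)
qed

lemma fa_mult_one_left: "fa_mult (fa_word []) f = f"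
  by (rule ext) (simp add: fa_mult_word_left)

lemma fa_mult_one_right: "fa_mult f (fa_word []) = f"
  using fa_mult_word_right[of f "[]"] by (intro ext) simp

lemma fa_mult_add_left: "fa_mult (fa_add f g) h = fa_add (fa_mult f h) (fa_mult g h)"
  unfolding fa_mult_def fa_add_def by (simp add: distrib_right sum.distrib)

lemma fa_mult_add_right: "fa_mult h (fa_add f g) = fa_add (fa_mult h f) (fa_mult h g)"
  unfolding fa_mult_def fa_add_def by (simp add: distrib_left sum.distrib)

lemma fa_mult_smult_left: "fa_mult (fa_smult c f) g = fa_smult c (fa_mult f g)"
  unfolding fa_mult_def fa_smult_def by (simp add: sum_distrib_left mult.assoc)

lemma fa_mult_smult_right: "fa_mult f (fa_smult c g) = fa_smult c (fa_mult f g)"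
  unfolding fa_mult_def fa_smult_def by (simp add: sum_distrib_left mult.left_commute)

lemma fa_over_closed:
  "f \<in> fa_over X \<Longrightarrow> g \<in> fa_over X \<Longrightarrow> fa_add f g \<in> fa_over X"
  "f \<in> fa_over X \<Longrightarrow> g \<in> fa_over X \<Longrightarrow> fa_sub f g \<in> fa_over X"
  "f \<in> fa_over X \<Longrightarrow> fa_smult c f \<in> fa_over X"
  "w \<in> lists (X) \<Longrightarrow> fa_word w \<in> fa_over X"
  "finite S \<Longrightarrow> (\<And>i. i \<in> S \<Longrightarrow> F i \<in> fa_over X) \<Longrightarrow> fa_sum F S \<in> fa_over X"
  "f \<in> fa_over X \<Longrightarrow> g \<in> fa_over X \<Longrightarrow> fa_mult f g \<in> fa_over X"
  "(\<lambda>_. 0) \<in> fa_over X"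
proof -
  show "f \<in> fa_over X \<Longrightarrow> g \<in> fa_over X \<Longrightarrow> fa_add f g \<in> fa_over X"
    using fa_supp_simps(1)[of f g] unfolding fa_over_def by (auto intro: finite_subset)
  show "f \<in> fa_over X \<Longrightarrow> g \<in> fa_over X \<Longrightarrow> fa_sub f g \<in> fa_over X"
    using fa_supp_simps(2)[of f g] unfolding fa_over_def by (auto intro: finite_subset)
  show "f \<in> fa_over X \<Longrightarrow> fa_smult c f \<in> fa_over X"
    using fa_supp_simps(3)[of c f] unfolding fa_over_def by (auto intro: finite_subset)
  show "w \<in> lists (X) \<Longrightarrow> fa_word w \<in> fa_over X"
    unfolding fa_over_def by (simp add: fa_supp_simps(4))
  show "finite S \<Longrightarrow> (\<And>i. i \<in> S \<Longrightarrow> F i \<in> fa_over X) \<Longrightarrow> fa_sum F S \<in> fa_over X"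
    using fa_supp_simps(5)[of F S] unfolding fa_over_def
    by (simp, intro conjI, metis (no_types, lifting) finite_UN finite_subset, blast)
  show "(\<lambda>_. 0) \<in> fa_over X" unfolding fa_over_def fa_supp_def by simp
  assume fg: "f \<in> fa_over X" "g \<in> fa_over X"
  have sub: "(\<lambda>(u, v). u @ v) ` (fa_supp f \<times> fa_supp g) \<subseteq> lists (X)"
    using fg unfolding fa_over_def by fastforce
  have fin: "finite ((\<lambda>(u, v). u @ v) ` (fa_supp f \<times> fa_supp g))" using fg unfolding fa_over_def by simp
  show "fa_mult f g \<in> fa_over X" unfolding fa_over_def mem_Collect_eq
    by (intro conjI finite_subset[OF fa_supp_mult fin] subset_trans[OF fa_supp_mult sub])
qed

lemmas FA_closed = fa_over_closed[where X = "gens n" for n, folded FA_eq]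

lemma free_alg_simps: "carrier (free_alg n) = FA n" "\<zero>\<^bsub>free_alg n\<^esub> = (\<lambda>_. 0)" "\<one>\<^bsub>free_alg n\<^esub> = fa_word []"
  "f \<otimes>\<^bsub>free_alg n\<^esub> g = fa_mult f g" "f \<oplus>\<^bsub>free_alg n\<^esub> g = fa_add f g"
  by (simp_all add: free_alg_def)

lemma ring_free_alg: "ring (free_alg n :: ('k::field) fa ring)"
proof (rule ringI)
  show "abelian_group (free_alg n :: 'k fa ring)"
  proof (rule abelian_groupI)
    fix f :: "'k fa" assume "f \<in> carrier (free_alg n)"
    hence "fa_smult (-1) f \<in> carrier (free_alg n)" "fa_smult (-1) f \<oplus>\<^bsub>free_alg n\<^esub> f = \<zero>\<^bsub>free_alg n\<^esub>"
      by (auto simp: free_alg_simps FA_closed) (simp add: fa_add_def fa_smult_def)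
    thus "\<exists>g\<in>carrier (free_alg n). g \<oplus>\<^bsub>free_alg n\<^esub> f = \<zero>\<^bsub>free_alg n\<^esub>" by blast
  qed (auto simp: free_alg_simps FA_closed, auto simp: fa_add_def ac_simps)
  show "monoid (free_alg n :: 'k fa ring)"
    by (rule monoidI) (auto simp: free_alg_simps FA_closed fa_mult_assoc fa_mult_one_left fa_mult_one_right)
qed (auto simp: free_alg_simps fa_mult_add_left fa_mult_add_right)

text \<open>An arbitrary function on words is a linear functional on the free algebra.\<close>
definition pair :: "(gen list \<Rightarrow> 'k::field) \<Rightarrow> 'k fa \<Rightarrow> 'k" where
  "pair \<phi> f = (\<Sum>w\<in>fa_supp f. f w * \<phi> w)"

lemma pair_superset: "finite T \<Longrightarrow> fa_supp f \<subseteq> T \<Longrightarrow> pair \<phi> f = (\<Sum>w\<in>T. f w * \<phi> w)"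
  unfolding pair_def by (intro sum.mono_neutral_left) (auto simp: fa_supp_def)

lemma pair_add: assumes "finite (fa_supp f)" "finite (fa_supp g)" shows "pair \<phi> (fa_add f g) = pair \<phi> f + pair \<phi> g"
proof -
  have T: "finite (fa_supp f \<union> fa_supp g)" using assms by simp
  show ?thesis using pair_superset[OF T fa_supp_simps(1), of \<phi>] pair_superset[OF T, of f \<phi>] pair_superset[OF T, of g \<phi>]
    by (simp add: fa_add_def distrib_right sum.distrib)
qed

lemma pair_sub: assumes "finite (fa_supp f)" "finite (fa_supp g)" shows "pair \<phi> (fa_sub f g) = pair \<phi> f - pair \<phi> g"
proof -
  have T: "finite (fa_supp f \<union> fa_supp g)" using assms by simp
  show ?thesis using pair_superset[OF T fa_supp_simps(2), of \<phi>] pair_superset[OF T, of f \<phi>] pair_superset[OF T, of g \<phi>]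
    by (simp add: fa_sub_def left_diff_distrib sum_subtractf)
qed

lemma pair_smult: assumes "finite (fa_supp f)" shows "pair \<phi> (fa_smult c f) = c * pair \<phi> f"
  using pair_superset[OF assms fa_supp_simps(3), of \<phi>]
  by (simp add: pair_def fa_smult_def sum_distrib_left mult.assoc)

lemma pair_word: "pair \<phi> (fa_word w) = \<phi> w"
  unfolding pair_def fa_supp_simps(4) by (simp add: fa_word_def)

lemma finite_supp_fa_sum: "finite S \<Longrightarrow> (\<And>i. i \<in> S \<Longrightarrow> finite (fa_supp (F i))) \<Longrightarrow> finite (fa_supp (fa_sum F S))"
  using fa_supp_simps(5)[of F S] by (auto intro: finite_subset)

lemma pair_sum: assumes "finite S" "\<And>i. i \<in> S \<Longrightarrow> finite (fa_supp (F i))"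
  shows "pair \<phi> (fa_sum F S) = (\<Sum>i\<in>S. pair \<phi> (F i))"
proof -
  let ?T = "\<Union>i\<in>S. fa_supp (F i)"
  have T: "finite ?T" using assms by auto
  have "pair \<phi> (fa_sum F S) = (\<Sum>w\<in>?T. \<Sum>i\<in>S. F i w * \<phi> w)"
    using pair_superset[OF T fa_supp_simps(5), of \<phi>] by (simp add: fa_sum_def sum_distrib_right)
  also have "\<dots> = (\<Sum>i\<in>S. \<Sum>w\<in>?T. F i w * \<phi> w)" by (rule sum.swap)
  also have "\<dots> = (\<Sum>i\<in>S. pair \<phi> (F i))"
    by (intro sum.cong refl pair_superset[OF T, symmetric]) auto
  finally show ?thesis .
qed

lemma pair_mult: assumes "finite (fa_supp f)" "finite (fa_supp g)"
  shows "pair \<phi> (fa_mult f g) = (\<Sum>u\<in>fa_supp f. \<Sum>v\<in>fa_supp g. f u * g v * \<phi> (u @ v))"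
proof -
  let ?S = "fa_supp f \<times> fa_supp g"
  let ?T = "(\<lambda>(u, v). u @ v) ` ?S"
  have "pair \<phi> (fa_mult f g) = (\<Sum>w\<in>?T. \<Sum>x\<in>?S. if fst x @ snd x = w then f (fst x) * g (snd x) * \<phi> w else 0)"
    using pair_superset[of ?T "fa_mult f g" \<phi>] fa_supp_mult[of f g] assms
    by (simp add: fa_mult_supp_sum sum_distrib_right case_prod_unfold if_distrib[of "\<lambda>x. x * _"] cong: if_cong)
  also have "\<dots> = (\<Sum>x\<in>?S. \<Sum>w\<in>?T. if fst x @ snd x = w then f (fst x) * g (snd x) * \<phi> w else 0)"
    by (rule sum.swap)
  also have "\<dots> = (\<Sum>x\<in>?S. f (fst x) * g (snd x) * \<phi> (fst x @ snd x))"
    using assms by (intro sum.cong refl) (auto simp: sum.delta)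
  also have "\<dots> = (\<Sum>u\<in>fa_supp f. \<Sum>v\<in>fa_supp g. f u * g v * \<phi> (u @ v))"
    by (simp add: sum.cartesian_product case_prod_unfold)
  finally show ?thesis .
qed

text \<open>The largest two-sided ideal on which the functional vanishes. Since the contexts
  \<open>u\<close> and \<open>v\<close> are built in, this is an ideal for any function on
  words.\<close>

definition annih :: "nat \<Rightarrow> (gen list \<Rightarrow> 'k::field) \<Rightarrow> 'k fa set" where
  "annih n \<phi> = {f \<in> FA n. \<forall>u\<in>lists (gens n). \<forall>v\<in>lists (gens n). pair (\<lambda>w. \<phi> (u @ w @ v)) f = 0}"

lemma ideal_annih: "ideal (annih n \<phi>) (free_alg n)"
proof (rule idealI[OF ring_free_alg])
  interpret ring "free_alg n :: 'a fa ring" by (rule ring_free_alg)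
  have FAf: "f \<in> FA n \<Longrightarrow> finite (fa_supp f)" for f :: "'a fa" unfolding FA_def' by simp
  have FAs: "f \<in> FA n \<Longrightarrow> w \<in> fa_supp f \<Longrightarrow> w \<in> lists (gens n)" for f :: "'a fa" and w unfolding FA_def' by auto
  show "subgroup (annih n \<phi>) (add_monoid (free_alg n))"
  proof (rule add.subgroupI)
    show "annih n \<phi> \<subseteq> carrier (free_alg n)" by (auto simp: annih_def free_alg_simps)
    have "(\<lambda>_. 0) \<in> annih n \<phi>" by (simp add: annih_def FA_closed pair_def fa_supp_def)
    thus "annih n \<phi> \<noteq> {}" by blast
    fix f assume f: "f \<in> annih n \<phi>"
    have m: "fa_smult (-1) f \<in> annih n \<phi>" using f by (auto simp: annih_def FA_closed pair_smult FAf)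
    have "fa_smult (-1) f \<oplus>\<^bsub>free_alg n\<^esub> f = \<zero>\<^bsub>free_alg n\<^esub>" by (simp add: free_alg_simps fa_add_def fa_smult_def)
    hence "\<ominus>\<^bsub>free_alg n\<^esub> f = fa_smult (-1) f"
      using f m by (intro minus_equality) (auto simp: free_alg_simps annih_def)
    thus "\<ominus>\<^bsub>free_alg n\<^esub> f \<in> annih n \<phi>" using m by simp
  next
    fix f g assume "f \<in> annih n \<phi>" "g \<in> annih n \<phi>"
    thus "f \<oplus>\<^bsub>free_alg n\<^esub> g \<in> annih n \<phi>" by (auto simp: annih_def free_alg_simps FA_closed pair_add FAf)
  qed
  fix a f :: "'a fa" assume a: "f \<in> carrier (free_alg n)" and f: "a \<in> annih n \<phi>"
  hence fin: "f \<in> FA n" "a \<in> FA n" by (auto simp: annih_def free_alg_simps)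
  have ann: "(\<Sum>w\<in>fa_supp a. a w * \<phi> (u @ w @ v)) = 0" if "u \<in> lists (gens n)" "v \<in> lists (gens n)" for u v
    using f that by (auto simp: annih_def pair_def)
  \<comment> \<open>The other factor is expanded into words, and each of them is absorbed into the
    context.\<close>
  have "pair (\<lambda>w. \<phi> (u @ w @ v)) (fa_mult f a) = 0" if "u \<in> lists (gens n)" "v \<in> lists (gens n)" for u v
  proof -
    have "pair (\<lambda>w. \<phi> (u @ w @ v)) (fa_mult f a) = (\<Sum>x\<in>fa_supp f. f x * (\<Sum>w\<in>fa_supp a. a w * \<phi> ((u @ x) @ w @ v)))"
      using fin by (simp add: pair_mult FAf sum_distrib_left mult.assoc)
    also have "\<dots> = 0"
    proof (rule sum.neutral, rule ballI)
      fix x assume "x \<in> fa_supp f"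
      hence "u @ x \<in> lists (gens n)" using that FAs[OF fin(1)] by auto
      from ann[OF this that(2)] show "f x * (\<Sum>w\<in>fa_supp a. a w * \<phi> ((u @ x) @ w @ v)) = 0" by simp
    qed
    finally show ?thesis .
  qed
  thus "f \<otimes>\<^bsub>free_alg n\<^esub> a \<in> annih n \<phi>" using fin by (simp add: annih_def free_alg_simps FA_closed)
  have "pair (\<lambda>w. \<phi> (u @ w @ v)) (fa_mult a f) = 0" if "u \<in> lists (gens n)" "v \<in> lists (gens n)" for u v
  proof -
    have "pair (\<lambda>w. \<phi> (u @ w @ v)) (fa_mult a f) = (\<Sum>w\<in>fa_supp a. \<Sum>x\<in>fa_supp f. f x * (a w * \<phi> (u @ w @ (x @ v))))"
      using fin by (simp add: pair_mult FAf mult_ac)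
    also have "\<dots> = (\<Sum>x\<in>fa_supp f. f x * (\<Sum>w\<in>fa_supp a. a w * \<phi> (u @ w @ (x @ v))))"
      by (subst sum.swap) (simp add: sum_distrib_left)
    also have "\<dots> = 0"
    proof (rule sum.neutral, rule ballI)
      fix x assume "x \<in> fa_supp f"
      hence "x @ v \<in> lists (gens n)" using that FAs[OF fin(1)] by auto
      from ann[OF that(1) this] show "f x * (\<Sum>w\<in>fa_supp a. a w * \<phi> (u @ w @ (x @ v))) = 0" by simp
    qed
    finally show ?thesis .
  qed
  thus "a \<otimes>\<^bsub>free_alg n\<^esub> f \<in> annih n \<phi>" using fin by (simp add: annih_def free_alg_simps FA_closed)
qed

section \<open>Independence of the ordered words\<close>
lemma fin_supp [simp]:
  "finite (fa_supp (X2 a b))"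
  "finite (fa_supp f) \<Longrightarrow> finite (fa_supp (fa_smult c f))"
  "finite (fa_supp f) \<Longrightarrow> finite (fa_supp g) \<Longrightarrow> finite (fa_supp (fa_add f g))"
  "finite (fa_supp f) \<Longrightarrow> finite (fa_supp g) \<Longrightarrow> finite (fa_supp (fa_sub f g))"
  using fa_supp_simps(1,2)[of f g] fa_supp_simps(3)[of c f]
  by (auto simp: X2_def fa_supp_simps(4) intro: finite_subset)

lemma pair_X2: "pair \<phi> (X2 a b) = \<phi> [a, b]"
  by (simp add: X2_def pair_word)

lemma pair_sum_X2: "finite S \<Longrightarrow> pair \<phi> (fa_sum (\<lambda>l. fa_smult (c l) (X2 (a l) (b l))) S) = (\<Sum>l\<in>S. c l * \<phi> [a l, b l])"
  by (simp add: pair_sum pair_smult pair_X2)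

lemma fin_supp_sum_X2 [simp]: "finite S \<Longrightarrow> finite (fa_supp (fa_sum (\<lambda>l. fa_smult (c l) (X2 (a l) (b l))) S))"
  by (rule finite_supp_fa_sum) simp_all

lemma relations_subset_FA: "relations n q \<subseteq> FA n"
proof -
  have X: "X2 (r, i) (r', j) \<in> FA n" if "r \<in> {1,2}" "r' \<in> {1,2}" "1 \<le> i" "i \<le> 2*n" "1 \<le> j" "j \<le> 2*n" for r r' i j
    unfolding X2_def using that by (intro FA_closed) (auto simp: gens_def)
  show ?thesis unfolding relations_def Let_def
    by (intro Un_least subsetI; elim CollectE exE conjE; hypsubst; intro FA_closed X; auto)
qed

context quantum_space begin

lemma L_same: "L s s H = inverse q * H s s"
  using p_ne[of s] by (simp add: L_def diag_def)

lemma L_less: "s < t \<Longrightarrow> t \<le> 2*n \<Longrightarrow> t \<noteq> p s \<Longrightarrow> L s t H = H t s"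
  by (auto simp: L_def diag_def p_def)

lemma L_greater: "s < t \<Longrightarrow> t \<noteq> p s \<Longrightarrow> L t s H = H s t - qh * H t s"
  by (simp add: L_def diag_def)

lemma L_pair_low: assumes "1 \<le> s" "s \<le> n"
  shows "L s (p s) H = q * H (p s) s + qh * (\<Sum>l\<in>{1..s-1}. q ^ (s - l) * H (p l) l)"
proof -
  have p: "p (p s) = s" "\<not> p s < s" "s \<noteq> p s" using assms p_ne[of s] by (auto simp: p_def)
  have "v s / v l = q ^ (s - l)" if "l \<in> {1..<s}" for l
    using that assms q0 by (simp add: v_def power_diff)
  moreover have "{1..s-1} = {1..<s}" using assms by auto
  ultimately show ?thesis using p by (simp add: L_def diag_def)
qed

text \<open>The sum over \<open>d < p s\<close> is cut at \<open>n\<close>. Below,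
  \<open>v (p s) / v l\<close> is \<open>q\<close> to the power \<open>p l - s - 1\<close>, which
  accounts for the factor \<open>inverse q\<close>; the part above, reindexed by \<open>p\<close>,
  becomes the sum over \<open>s < l \<le> n\<close>.\<close>

lemma L_pair_high: assumes "1 \<le> s" "s \<le> n"
  shows "L (p s) s H = q * H s (p s) + (qh * (\<Sum>l\<in>{s+1..n}. q ^ (l - s) * H l (p l))
    + qh * inverse q * (\<Sum>l\<in>{1..n}. q ^ (p l - s) * H (p l) l)) - qh * H (p s) s"
proof -
  have p: "p s \<noteq> s" "s < p s" using assms p_ne[of s] by (auto simp: p_def)
  have split: "{1..<p s} = {1..n} \<union> {n+1..<p s}" "{1..n} \<inter> {n+1..<p s} = {}" using assms by (auto simp: p_def)
  have vps: "v (p s) = q ^ (2*n - s)" using assms by (simp add: v_def p_def)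
  have "(\<Sum>d\<in>{1..n}. v (p s) / v d * H (p d) d) = (\<Sum>l\<in>{1..n}. inverse q * (q ^ (p l - s) * H (p l) l))"
  proof (rule sum.cong[OF refl])
    fix l assume l: "l \<in> {1..n}"
    have "q ^ (2*n - s) = q ^ (2 * n - s - l) * q ^ l" using l assms by (simp flip: power_add)
    moreover have "p l - s = Suc (2 * n - s - l)" using l assms by (auto simp: p_def)
    ultimately show "v (p s) / v l * H (p l) l = inverse q * (q ^ (p l - s) * H (p l) l)"
      unfolding vps using l q0 by (simp add: v_def)
  qed
  moreover have "(\<Sum>d\<in>{n+1..<p s}. v (p s) / v d * H (p d) d) = (\<Sum>l\<in>{s+1..n}. q ^ (l - s) * H l (p l))"
  proof (rule sum.reindex_bij_witness[where i=p and j=p])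
    fix d assume d: "d \<in> {n+1..<p s}"
    hence e: "p (p d) = d" "p d \<in> {s+1..n}" using assms by (auto simp: p_def)
    show "p (p d) = d" "p d \<in> {s+1..n}" by (fact e)+
    have "2 * n - s = (p d - s) + (d - 1)" using d assms by (auto simp: p_def)
    hence "q ^ (2*n - s) = q ^ (p d - s) * q ^ (d - 1)" by (simp flip: power_add)
    thus "q ^ (p d - s) * H (p d) (p (p d)) = v (p s) / v d * H (p d) d"
      unfolding vps e using d q0 by (simp add: v_def)
  qed (use assms in \<open>auto simp: p_def\<close>)
  ultimately have "(\<Sum>d\<in>{1..<p s}. v (p s) / v d * H (p d) d) =
    inverse q * (\<Sum>l\<in>{1..n}. q ^ (p l - s) * H (p l) l) + (\<Sum>l\<in>{s+1..n}. q ^ (l - s) * H l (p l))"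
    unfolding split(1) using split(2) by (subst sum.union_disjoint) (auto simp: sum_distrib_left)
  thus ?thesis using p by (simp add: L_def diag_def algebra_simps)
qed

lemma relations_annih: assumes h: "compatible h"
  shows "relations n q \<subseteq> annih n (\<lambda>z. Phi z h)"
proof
  fix f assume f: "f \<in> relations n q"
  have "pair (\<lambda>w. Phi (z1 @ w @ z2) h) f = 0" if z: "z1 \<in> lists (gens n)" "z2 \<in> lists (gens n)" for z1 z2
  proof -
    define \<psi> where "\<psi> w = Phi (z1 @ w @ z2) h" for w
    have row: "row_rel (\<lambda>x y. \<psi> [(r,x),(r,y)])" if "r \<in> {1,2}" for r
      unfolding \<psi>_def by (rule Phi_row_rel[OF h z that])
    have mix: "\<psi> [(2,a),(Suc 0,b)] = L a b (\<lambda>c d. \<psi> [(Suc 0,c),(2,d)])" for a b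
      unfolding \<psi>_def by (rule Phi_mixed[unfolded One_nat_def])
    have pp: "2 * n + 1 - s = p s" for s by (simp add: p_def)
    note R = f[unfolded relations_def Let_def pp Un_iff mem_Collect_eq]
    have "pair \<psi> f = 0"
      using R
    proof (elim disjE exE conjE)
      fix r s t
      assume "f = fa_sub (X2 (r,t) (r,s)) (fa_smult (inverse q) (X2 (r,s) (r,t)))" "r \<in> {1,2}" "1 \<le> s" "s < t" "t \<le> 2*n" "t \<noteq> p s"
      thus ?thesis using row[of r] by (simp add: pair_sub pair_smult pair_X2 row_rel_def)
    next
      fix r s
      assume a: "f = fa_sub (X2 (r, p s) (r,s)) (fa_add (X2 (r,s) (r, p s))
          (fa_smult qh (fa_sum (\<lambda>l. fa_smult (q ^ (l - s - 1)) (X2 (r,l) (r, p l))) {s+1..n})))"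
        "r \<in> {1,2}" "1 \<le> s" "s \<le> n"
      show ?thesis unfolding a(1) using row[OF a(2)] a(3,4)
        by (simp add: pair_sub pair_add pair_smult pair_X2 pair_sum_X2 row_rel_def Om_def)
    next
      fix s
      assume a: "f = fa_sub (X2 (2,s) (1,s)) (fa_smult (inverse q) (X2 (1,s) (2,s)))"
      show ?thesis unfolding a(1) by (simp add: pair_sub pair_smult pair_X2 mix L_same)
    next
      fix s t
      assume a: "f = fa_sub (X2 (2,s) (1,t)) (X2 (1,t) (2,s))" "1 \<le> s" "s < t" "t \<le> 2*n" "t \<noteq> p s"
      show ?thesis unfolding a(1) using a(2-) by (simp add: pair_sub pair_X2 mix L_less)
    next
      fix s t
      assume a: "f = fa_sub (X2 (2,t) (1,s)) (fa_sub (X2 (1,s) (2,t)) (fa_smult qh (X2 (1,t) (2,s))))"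
        "1 \<le> s" "s < t" "t \<le> 2*n" "t \<noteq> p s"
      show ?thesis unfolding a(1) using a(2-) by (simp add: pair_sub pair_smult pair_X2 mix L_greater)
    next
      fix s
      assume a: "f = fa_sub (X2 (2,s) (1, p s))
        (fa_add (fa_smult q (X2 (1, p s) (2,s)))
          (fa_smult qh (fa_sum (\<lambda>l. fa_smult (q ^ (s - l)) (X2 (1, p l) (2,l))) {1..s-1})))"
        "1 \<le> s" "s \<le> n"
      show ?thesis unfolding a(1) using a(2-)
        by (simp add: pair_sub pair_add pair_smult pair_X2 pair_sum_X2 mix L_pair_low)
    next
      fix s
      assume a: "f = fa_sub (X2 (2, p s) (1,s))
        (fa_sub
          (fa_add (fa_smult q (X2 (1,s) (2, p s)))
            (fa_add
              (fa_smult qh (fa_sum (\<lambda>l. fa_smult (q ^ (l - s)) (X2 (1,l) (2, p l))) {s+1..n}))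
              (fa_smult (qh * inverse q)
                 (fa_sum (\<lambda>l. fa_smult (q ^ (p l - s)) (X2 (1, p l) (2,l))) {1..n}))))
          (fa_smult qh (X2 (1, p s) (2,s))))"
        "1 \<le> s" "s \<le> n"
      show ?thesis unfolding a(1) using a(2-)
        by (simp add: pair_sub pair_add pair_smult pair_X2 pair_sum_X2 mix L_pair_high)
    qed
    thus ?thesis unfolding \<psi>_def .
  qed
  thus "f \<in> annih n (\<lambda>z. Phi z h)" using f relations_subset_FA unfolding annih_def by blast
qed

lemma rel_ideal_pair: assumes "compatible h" "f \<in> rel_ideal n q" shows "pair (\<lambda>z. Phi z h) f = 0"
proof -
  have "rel_ideal n q \<subseteq> annih n (\<lambda>z. Phi z h)"
    unfolding rel_ideal_def
    by (rule ring.genideal_minimal[OF ring_free_alg ideal_annih relations_annih[OF assms(1)]])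
  hence "f \<in> annih n (\<lambda>z. Phi z h)" using assms by blast
  thus ?thesis unfolding annih_def by (auto dest!: bspec[of _ _ "[]"])
qed

definition ordw :: "gen list set" where
  "ordw = {map (Pair 1) u @ map (Pair 2) w | u w. sorted u \<and> sorted w \<and> u \<in> lists rng \<and> w \<in> lists rng}"

definition row :: "nat \<Rightarrow> gen list \<Rightarrow> nat list" where
  "row r z = map snd (filter (\<lambda>x. fst x = r) z)"

lemma row_ordered: "row 1 (map (Pair 1) u @ map (Pair 2) w) = u" "row 2 (map (Pair 1) u @ map (Pair 2) w) = w"
proof -
  have "filter (\<lambda>x. fst x = r) (map (Pair r') u) = (if r = r' then map (Pair r') u else [])" for r r' :: nat and u :: "nat list"
    by (induction u) auto
  thus "row 1 (map (Pair 1) u @ map (Pair 2) w) = u" "row 2 (map (Pair 1) u @ map (Pair 2) w) = w"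
    unfolding row_def by (simp_all add: comp_def)
qed

lemma ordw_row: "z \<in> ordw \<longleftrightarrow> z = map (Pair 1) (row 1 z) @ map (Pair 2) (row 2 z) \<and> sorted (row 1 z) \<and> sorted (row 2 z)
   \<and> row 1 z \<in> lists rng \<and> row 2 z \<in> lists rng"
  unfolding ordw_def using row_ordered by auto

text \<open>Pair with the functional attached to a word of minimal level in the support: it annihilates all
  other words there.\<close>
lemma ordw_independent: assumes "f \<in> rel_ideal n q" "fa_supp f \<subseteq> ordw" "finite (fa_supp f)" shows "fa_supp f = {}"
proof (rule ccontr)
  assume ne: "fa_supp f \<noteq> {}"
  define lv where "lv z = level (shift (row 1 z)) + level (shift (row 2 z))" for z
  obtain z where z: "z \<in> fa_supp f" "\<And>y. y \<in> fa_supp f \<Longrightarrow> lv z \<le> lv y"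
    using ex_min_if_finite[of "lv ` fa_supp f"] assms(3) ne by (metis (mono_tags, lifting) arg_min_if_finite(1) arg_min_least)
  define h where "h = (\<lambda>u w. detect (row 1 z) u * detect (row 2 z) w)"
  have P: "Phi y h = detect (row 1 z) (row 1 y) * detect (row 2 z) (row 2 y)" if "y \<in> fa_supp f" for y
    using Phi_ordered[of "row 1 y" "row 2 y" h] ordw_row[of y] that assms(2) unfolding h_def by auto
  have zo: "sorted (row 1 z)" "sorted (row 2 z)" "row 1 z \<in> lists rng" "row 2 z \<in> lists rng"
    using z assms(2) ordw_row[of z] by auto
  have "Phi y h = 0" if y: "y \<in> fa_supp f" "y \<noteq> z" for y
  proof -
    have yo: "sorted (row 1 y)" "sorted (row 2 y)" "row 1 y \<in> lists rng" "row 2 y \<in> lists rng"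
      using y assms(2) ordw_row[of y] by auto
    have "row 1 y \<noteq> row 1 z \<or> row 2 y \<noteq> row 2 z"
      using ordw_row[of y] ordw_row[of z] assms(2) y z by (metis subsetD)
    moreover have "level (shift (row 1 z)) + level (shift (row 2 z)) \<le> level (shift (row 1 y)) + level (shift (row 2 y))"
      using z(2)[OF y(1)] by (simp add: lv_def)
    \<comment> \<open>If the level of the first row drops from \<open>z\<close> to \<open>y\<close>,
      that of the second must rise, so the second rows differ and \<open>detect_other\<close>
      applies to them. Otherwise it applies to the first rows, or to the second rows when the first
      ones coincide.\<close>
    ultimately have "detect (row 1 z) (row 1 y) = 0 \<or> detect (row 2 z) (row 2 y) = 0"
      using detect_other[OF zo(1) yo(1) zo(3) yo(3)] detect_other[OF zo(2) yo(2) zo(4) yo(4)]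
      by (cases "level (shift (row 1 z)) \<le> level (shift (row 1 y))"; cases "row 1 y = row 1 z"; cases "row 2 y = row 2 z") auto
    thus ?thesis using P y by auto
  qed
  hence "pair (\<lambda>y. Phi y h) f = f z * Phi z h"
    unfolding pair_def using z(1) assms(3) by (subst sum.remove[of _ z]) auto
  moreover have "pair (\<lambda>y. Phi y h) f = 0" by (rule rel_ideal_pair[OF _ assms(1)]) (unfold h_def, rule compatible_det)
  moreover have "Phi z h \<noteq> 0" using P[OF z(1)] detect_same zo by auto
  ultimately show False using z(1) by (simp add: fa_supp_def)
qed

end

section \<open>Ordered words\<close>
lemma fa_over_mono: "X \<subseteq> Y \<Longrightarrow> fa_over X \<subseteq> fa_over Y"
  unfolding fa_over_def using lists_mono by blast

lemma fa_over_induct [consumes 1, case_names zero add]: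
  assumes "f \<in> fa_over X" "R (\<lambda>_. 0)"
    and "\<And>c w f. w \<in> lists X \<Longrightarrow> f \<in> fa_over X \<Longrightarrow> R f \<Longrightarrow> R (fa_add (fa_smult c (fa_word w)) f)"
  shows "R f"
proof -
  have "finite S \<Longrightarrow> f \<in> fa_over X \<Longrightarrow> fa_supp f = S \<Longrightarrow> R f" for S
  proof (induction S arbitrary: f rule: finite_induct)
    case empty
    hence "f = (\<lambda>_. 0)" by (auto simp: fa_supp_def)
    thus ?case using assms by simp
  next
    case (insert w S)
    let ?g = "f(w := 0)"
    have s: "fa_supp ?g = S" using insert by (auto simp: fa_supp_def)
    have g: "?g \<in> fa_over X" using insert s unfolding fa_over_def by auto
    have "f = fa_add (fa_smult (f w) (fa_word w)) ?g"
      by (auto simp: fa_add_def fa_smult_def fa_word_def fun_eq_iff)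
    moreover have "w \<in> lists X" using insert unfolding fa_over_def by auto
    ultimately show ?case using assms(3)[of w ?g "f w"] insert.IH[OF g s] g by metis
  qed
  thus ?thesis using assms(1) unfolding fa_over_def by blast
qed

lemma gen_list_simps: "length (gen_list n) = 4 * n" "set (gen_list n) = gens n" "distinct (gen_list n)"
  unfolding gen_list_def gens_def by (auto simp: distinct_map inj_on_def)

lemma gen_list_nth: assumes "m < 4 * n"
  shows "gen_list n ! m = (if m < 2*n then (1, m + 1) else (2, m + 1 - 2*n))"
  using assms unfolding gen_list_def by (auto simp: nth_append)

abbreviation gens_upto :: "nat \<Rightarrow> nat \<Rightarrow> gen set" where
  "gens_upto n m \<equiv> set (take m (gen_list n))"

text \<open>Initial segments of the list become a lexicographic condition, which can be tested on
  the letters of a relation.\<close>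

lemma gens_upto_nth: assumes "m < 4 * n" "gen_list n ! m = (r, j)"
  shows "gens_upto n m = {(r', j'). (r', j') \<in> gens n \<and> (r' < r \<or> r' = r \<and> j' < j)}"
proof -
  have e: "gens_upto n m = (!) (gen_list n) ` {..<m}"
    using assms(1) by (simp add: nth_image[symmetric] gen_list_simps lessThan_atLeast0)
  have h: "(r, j) = (if m < 2*n then (1, m + 1) else (2, m + 1 - 2*n))" using assms gen_list_nth by metis
  show ?thesis
  proof (intro equalityI subsetI)
    fix x assume "x \<in> gens_upto n m"
    then obtain i where i: "i < m" "x = gen_list n ! i" unfolding e by auto
    thus "x \<in> {(r', j'). (r', j') \<in> gens n \<and> (r' < r \<or> r' = r \<and> j' < j)}"
      using h assms(1) gen_list_nth[of i n] by (auto simp: gens_def split: if_splits)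
  next
    fix x assume x: "x \<in> {(r', j'). (r', j') \<in> gens n \<and> (r' < r \<or> r' = r \<and> j' < j)}"
    obtain r' j' where xx: "x = (r', j')" by (cases x)
    define i where "i = (if r' = 1 then j' - 1 else 2*n + j' - 1)"
    have "i < m" "gen_list n ! i = x"
      using x xx h assms(1) gen_list_nth[of i n] by (auto simp: gens_def i_def split: if_splits)
    thus "x \<in> gens_upto n m" unfolding e by auto
  qed
qed

lemma gens_upto_Suc: "m < 4 * n \<Longrightarrow> gens_upto n (Suc m) = insert (gen_list n ! m) (gens_upto n m)"
  by (simp add: take_Suc_conv_app_nth gen_list_simps)

lemma nth_notin_gens_upto: "m < 4 * n \<Longrightarrow> gen_list n ! m \<notin> gens_upto n m"
  using gens_upto_nth[of m n] by (cases "gen_list n ! m") auto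

lemma gens_upto_gens: "gens_upto n m \<subseteq> gens n"
  using set_take_subset[of m "gen_list n"] by (simp add: gen_list_simps)

definition ord_words :: "nat \<Rightarrow> nat \<Rightarrow> gen list set" where
  "ord_words n m = {concat (map2 replicate a (take m (gen_list n))) | a. length a = m}"

lemma ord_words_0: "ord_words n 0 = {[]}" by (auto simp: ord_words_def)

lemma ord_words_Suc: assumes "m < 4 * n"
  shows "ord_words n (Suc m) = {w @ replicate j (gen_list n ! m) | w j. w \<in> ord_words n m}"
proof -
  have t: "take (Suc m) (gen_list n) = take m (gen_list n) @ [gen_list n ! m]" "length (take m (gen_list n)) = m"
    using assms by (simp_all add: take_Suc_conv_app_nth gen_list_simps)
  have s: "concat (map2 replicate (b @ [j]) (take (Suc m) (gen_list n))) =
      concat (map2 replicate b (take m (gen_list n))) @ replicate j (gen_list n ! m)" if "length b = m" for b j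
    using t that by simp
  show ?thesis
  proof (intro equalityI subsetI)
    fix w assume "w \<in> ord_words n (Suc m)"
    then obtain a where a: "length a = Suc m" "w = concat (map2 replicate a (take (Suc m) (gen_list n)))"
      by (auto simp: ord_words_def)
    obtain b j where b: "a = b @ [j]" "length b = m" using a(1) by (metis length_Suc_conv_rev)
    show "w \<in> {w @ replicate j (gen_list n ! m) | w j. w \<in> ord_words n m}"
      using a(2) s[OF b(2), of j] b unfolding ord_words_def by blast
  next
    fix w assume "w \<in> {w @ replicate j (gen_list n ! m) | w j. w \<in> ord_words n m}"
    then obtain b j where "length b = m" "w = concat (map2 replicate b (take m (gen_list n))) @ replicate j (gen_list n ! m)"
      by (auto simp: ord_words_def)
    thus "w \<in> ord_words n (Suc m)" using s[of b j] unfolding ord_words_def by (auto intro!: exI[of _ "b @ [j]"])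
  qed
qed

lemma ord_words_lists: "m \<le> 4 * n \<Longrightarrow> ord_words n m \<subseteq> lists (gens_upto n m)"
proof (induction m)
  case (Suc m)
  show ?case
  proof
    fix z assume "z \<in> ord_words n (Suc m)"
    then obtain w j where w: "w \<in> ord_words n m" "z = w @ replicate j (gen_list n ! m)" using Suc ord_words_Suc[of m n] by auto
    have "w \<in> lists (gens_upto n m)" using Suc w by auto
    thus "z \<in> lists (gens_upto n (Suc m))" using w Suc.prems gens_upto_Suc[of m n] by auto
  qed
qed (simp add: ord_words_0)

lemma ord_words_mono: assumes "m \<le> m'" "m' \<le> 4 * n" shows "ord_words n m \<subseteq> ord_words n m'"
  using assms
proof (induction m' rule: dec_induct)
  case (step k)
  have "ord_words n k \<subseteq> ord_words n (Suc k)"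
  proof
    fix w assume "w \<in> ord_words n k"
    moreover have "w = w @ replicate 0 (gen_list n ! k)" by simp
    moreover have "k < 4 * n" using step by simp
    ultimately show "w \<in> ord_words n (Suc k)" unfolding ord_words_Suc[OF \<open>k < 4 * n\<close>] by blast
  qed
  thus ?case using step by auto
qed simp

lemma ord_words_ord_word: "ord_words n (4 * n) = ord_word n ` exps n"
  unfolding ord_words_def ord_word_def exps_def by (auto simp: gen_list_simps)

lemma concat_replicate_map: "concat (map2 replicate a (map f xs)) = map f (concat (map2 replicate a xs))"
proof (induction a arbitrary: xs)
  case (Cons k a) thus ?case by (cases xs) (auto simp: map_replicate)
qed simp

lemma set_concat_replicate: "set (concat (map2 replicate a xs)) \<subseteq> set xs"
proof (induction a arbitrary: xs)
  case (Cons k a) thus ?case by (cases xs) auto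
qed simp

lemma sorted_concat_replicate: "sorted xs \<Longrightarrow> sorted (concat (map2 replicate a xs))"
proof (induction a arbitrary: xs)
  case (Cons k a)
  show ?case
  proof (cases xs)
    case (Cons x ys)
    thus ?thesis using Cons.IH[of ys] Cons.prems set_concat_replicate[of a ys] by (auto simp: sorted_append)
  qed simp
qed simp

lemma count_concat_replicate:
  "length a = length xs \<Longrightarrow> distinct xs \<Longrightarrow> map (count_list (concat (map2 replicate a xs))) xs = a"
proof (induction a xs rule: list_induct2)
  case (Cons k a x xs)
  have r: "count_list (replicate k x) y = (if x = y then k else 0)" for y by (induction k) auto
  define c where "c = concat (map2 replicate a xs)"
  have "x \<notin> set c"
    unfolding c_def using set_concat_replicate[of a xs] Cons.prems by (meson distinct.simps(2) subsetD)
  hence 1: "count_list (replicate k x @ c) x = k" by (simp add: r)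
  have 2: "map (count_list (replicate k x @ c)) xs = map (count_list c) xs"
    using Cons.prems by (intro map_cong) (auto simp: r)
  have 3: "map (count_list c) xs = a" unfolding c_def using Cons by simp
  have e: "concat (map2 replicate (k # a) (x # xs)) = replicate k x @ c" by (simp add: c_def)
  show ?case unfolding e list.map(2) 1 2 3 ..
qed simp

lemma inj_ord_word: "inj_on (ord_word n) (exps n)"
  unfolding ord_word_def exps_def
proof (rule inj_onI, unfold mem_Collect_eq)
  fix a b assume ab: "length a = 4 * n" "length b = 4 * n"
    and e: "concat (map2 replicate a (gen_list n)) = concat (map2 replicate b (gen_list n))"
  have "map (count_list (concat (map2 replicate a (gen_list n)))) (gen_list n) = a"
    by (rule count_concat_replicate) (simp_all add: ab gen_list_simps)
  moreover have "map (count_list (concat (map2 replicate b (gen_list n)))) (gen_list n) = b"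
    by (rule count_concat_replicate) (simp_all add: ab gen_list_simps)
  ultimately show "a = b" unfolding e by (rule trans[OF sym])
qed

context quantum_space begin

lemma ord_words_ordw: assumes "m \<le> 4 * n" shows "ord_words n m \<subseteq> ordw"
proof -
  have "ord_word n a \<in> ordw" if "a \<in> exps n" for a
  proof -
    define xs where "xs = [1..<2*n+1]"
    have xs: "set xs = rng" "sorted xs" "length xs = 2 * n" by (auto simp: xs_def simp del: upt_Suc)
    define a1 a2 where "a1 = take (2*n) a" and "a2 = drop (2*n) a"
    have a: "a = a1 @ a2" "length a1 = 2 * n" using that by (auto simp: a1_def a2_def exps_def)
    have "ord_word n a = concat (map2 replicate a1 (map (Pair 1) xs)) @ concat (map2 replicate a2 (map (Pair 2) xs))"
      unfolding ord_word_def gen_list_def xs_def[symmetric] a(1) using a(2) xs(3) by simp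
    also have "\<dots> = map (Pair 1) (concat (map2 replicate a1 xs)) @ map (Pair 2) (concat (map2 replicate a2 xs))"
      by (simp only: concat_replicate_map)
    finally have e: "ord_word n a = map (Pair 1) (concat (map2 replicate a1 xs)) @ map (Pair 2) (concat (map2 replicate a2 xs))" .
    have s: "sorted (concat (map2 replicate b xs))" for b by (rule sorted_concat_replicate[OF xs(2)])
    have l: "concat (map2 replicate b xs) \<in> lists rng" for b
      unfolding in_lists_conv_set xs(1)[symmetric] using set_concat_replicate[of b xs] by (intro ballI) (rule subsetD)
    show ?thesis unfolding ordw_def mem_Collect_eq
      by (intro exI conjI) (rule e s l)+
  qed
  hence "ord_words n (4 * n) \<subseteq> ordw" unfolding ord_words_ord_word by (rule image_subsetI)
  with ord_words_mono[OF assms order_refl] show ?thesis by (rule subset_trans)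
qed

end

section \<open>The quotient algebra\<close>

context quantum_space begin

section \<open>Classes modulo the relation ideal\<close>

abbreviation "RI \<equiv> rel_ideal n q"

abbreviation "Q \<equiv> Xalg n q"

abbreviation "cl \<equiv> cls n q"

abbreviation "sc c \<equiv> cls n q (fa_scal c)"

lemma ideal_RI: "ideal RI (free_alg n)"
  unfolding rel_ideal_def
  by (rule ring.genideal_ideal[OF ring_free_alg]) (use relations_subset_FA in \<open>simp add: free_alg_simps\<close>)

lemma ring_Q: "ring Q"
  unfolding Xalg_def by (rule ideal.quotient_is_ring[OF ideal_RI])

sublocale Q: ring Q by (rule ring_Q)

lemma cl_hom: "cl \<in> ring_hom (free_alg n) Q"
proof -
  have "cl = (+>\<^bsub>free_alg n\<^esub>) RI" by (simp add: fun_eq_iff cls_def)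
  thus ?thesis unfolding Xalg_def using ideal.rcos_ring_hom[OF ideal_RI] by simp
qed

lemma cl_carrier [simp]: "f \<in> FA n \<Longrightarrow> cl f \<in> carrier Q"
  using ring_hom_closed[OF cl_hom] by (simp add: free_alg_simps)

lemma cl_mult: "f \<in> FA n \<Longrightarrow> g \<in> FA n \<Longrightarrow> cl (fa_mult f g) = cl f \<otimes>\<^bsub>Q\<^esub> cl g"
  using ring_hom_mult[OF cl_hom, of f g] by (simp add: free_alg_simps)

lemma cl_add: "f \<in> FA n \<Longrightarrow> g \<in> FA n \<Longrightarrow> cl (fa_add f g) = cl f \<oplus>\<^bsub>Q\<^esub> cl g"
  using ring_hom_add[OF cl_hom, of f g] by (simp add: free_alg_simps)

lemma cl_one: "cl (fa_word []) = \<one>\<^bsub>Q\<^esub>"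
  using ring_hom_one[OF cl_hom] by (simp add: free_alg_simps)

lemma cl_zero: "cl (\<lambda>_. 0) = \<zero>\<^bsub>Q\<^esub>"
proof -
  have e: "fa_add (\<lambda>_. 0) (\<lambda>_. 0) = ((\<lambda>_. 0) :: 'k fa)" by (simp add: fa_add_def)
  have z: "(\<lambda>_. 0) \<in> FA n" by (rule FA_closed)
  have "cl (\<lambda>_. 0) \<oplus>\<^bsub>Q\<^esub> cl (\<lambda>_. 0) = cl (\<lambda>_. 0)" using cl_add[OF z z, unfolded e] by (rule sym)
  thus ?thesis using cl_carrier[OF z] by simp
qed

lemma cl_eq_iff: "f \<in> FA n \<Longrightarrow> g \<in> FA n \<Longrightarrow> cl f = cl g \<longleftrightarrow> fa_sub f g \<in> RI"
proof -
  interpret R: ring "free_alg n :: 'k fa ring" by (rule ring_free_alg)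
  assume fg: "f \<in> FA n" "g \<in> FA n"
  have "fa_add (fa_smult (-1) g) g = (\<lambda>_. 0)" by (simp add: fa_add_def fa_smult_def)
  hence "\<ominus>\<^bsub>free_alg n\<^esub> g = fa_smult (-1) g"
    using fg by (intro R.minus_equality) (auto simp: free_alg_simps FA_closed)
  hence "f \<ominus>\<^bsub>free_alg n\<^esub> g = fa_sub f g"
    by (simp add: a_minus_def free_alg_simps) (simp add: fa_add_def fa_smult_def fa_sub_def)
  thus ?thesis using R.quotient_eq_iff_same_a_r_cos[OF ideal_RI, of f g] fg
    by (simp add: cls_def free_alg_simps)
qed

lemma cl_zero_iff: "f \<in> FA n \<Longrightarrow> cl f = \<zero>\<^bsub>Q\<^esub> \<longleftrightarrow> f \<in> RI"
  using cl_eq_iff[of f "\<lambda>_. 0"] FA_closed(7)[of n] by (simp add: cl_zero fa_sub_def)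

lemma carrier_Q: "carrier Q = cl ` FA n"
  unfolding Xalg_def cls_def FactRing_def A_RCOSETS_def' by (auto simp: free_alg_simps)

lemma scal_FA: "fa_scal c \<in> fa_over X"
  unfolding fa_scal_def by (intro fa_over_closed) simp

lemma scal_FA' [simp]: "fa_scal c \<in> FA n" using scal_FA FA_eq by blast

lemma scal_mult: "fa_mult (fa_scal c) f = fa_smult c f" "fa_mult f (fa_scal c) = fa_smult c f"
  by (simp_all add: fa_scal_def fa_mult_smult_left fa_mult_smult_right fa_mult_one_left fa_mult_one_right)

lemma cl_smult: "f \<in> FA n \<Longrightarrow> cl (fa_smult c f) = sc c \<otimes>\<^bsub>Q\<^esub> cl f"
  using cl_mult[of "fa_scal c" f] by (simp add: scal_mult)

lemma sc_central: "a \<in> carrier Q \<Longrightarrow> a \<otimes>\<^bsub>Q\<^esub> sc c = sc c \<otimes>\<^bsub>Q\<^esub> a"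
  unfolding carrier_Q using cl_mult[of _ "fa_scal c"] cl_smult by (auto simp: scal_mult)

section \<open>The chain of subalgebras\<close>

abbreviation A where "A m \<equiv> subalg n q m"

abbreviation G where "G m \<equiv> gens_upto n m"

lemma fa_over_G: "fa_over (G m) \<subseteq> FA n"
  unfolding FA_eq by (rule fa_over_mono[OF gens_upto_gens])

lemma subalg_image: "A m = cl ` fa_over (G m)"
proof -
  have "(f \<in> FA n \<and> (\<forall>w. f w \<noteq> 0 \<longrightarrow> set w \<subseteq> G m)) \<longleftrightarrow> f \<in> fa_over (G m)" for f :: "'k fa"
    using fa_over_G[of m] unfolding fa_over_def FA_def' fa_supp_def by (auto simp: in_lists_conv_set subset_iff)
  thus ?thesis unfolding subalg_def by blast
qed

lemma subalg_carrier: "A m \<subseteq> carrier Q"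
  unfolding subalg_image carrier_Q using fa_over_G by blast

lemma subring_A: "subring (A m) Q"
proof (rule Q.subringI)
  have FG: "f \<in> FA n" if "f \<in> fa_over (G m)" for f :: "'k fa" using fa_over_G that by blast
  show "A m \<subseteq> carrier Q" by (rule subalg_carrier)
  show "\<one>\<^bsub>Q\<^esub> \<in> A m" unfolding subalg_image cl_one[symmetric] by (intro imageI fa_over_closed) simp
  fix a assume "a \<in> A m"
  then obtain f where f: "a = cl f" "f \<in> fa_over (G m)" by (auto simp: subalg_image)
  have "fa_add (fa_smult (-1) f) f = (\<lambda>_. 0)" by (simp add: fa_add_def fa_smult_def)
  hence "cl (fa_smult (-1) f) \<oplus>\<^bsub>Q\<^esub> a = \<zero>\<^bsub>Q\<^esub>"
    using cl_add[of "fa_smult (-1) f" f] f FG by (simp add: cl_zero FA_closed)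
  hence "\<ominus>\<^bsub>Q\<^esub> a = cl (fa_smult (-1) f)" using f FG by (intro Q.minus_equality) (auto simp: FA_closed)
  thus "\<ominus>\<^bsub>Q\<^esub> a \<in> A m" using f by (auto simp: subalg_image fa_over_closed)
  fix b assume "b \<in> A m"
  then obtain g where g: "b = cl g" "g \<in> fa_over (G m)" by (auto simp: subalg_image)
  show "a \<otimes>\<^bsub>Q\<^esub> b \<in> A m" "a \<oplus>\<^bsub>Q\<^esub> b \<in> A m"
    using f g FG by (simp_all add: cl_mult[symmetric] cl_add[symmetric] subalg_image fa_over_closed)
qed

lemma word_A: "w \<in> lists (G m) \<Longrightarrow> cl (fa_word w) \<in> A m"
  by (simp add: subalg_image fa_over_closed)

lemma sc_A: "sc c \<in> A m"
  using scal_FA[of c "G m"] by (simp add: subalg_image)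

lemma word_FA: "w \<in> lists (gens n) \<Longrightarrow> fa_word w \<in> FA n" by (rule FA_closed)

lemma cl_word_append: "u \<in> lists (gens n) \<Longrightarrow> w \<in> lists (gens n) \<Longrightarrow> cl (fa_word (u @ w)) = cl (fa_word u) \<otimes>\<^bsub>Q\<^esub> cl (fa_word w)"
  by (simp add: fa_mult_words[symmetric] cl_mult word_FA)

lemma cl_word_Cons: "x \<in> gens n \<Longrightarrow> w \<in> lists (gens n) \<Longrightarrow> cl (fa_word (x # w)) = cl (fa_word [x]) \<otimes>\<^bsub>Q\<^esub> cl (fa_word w)"
  using cl_word_append[of "[x]" w] by simp

lemma cl_word_pow: "x \<in> gens n \<Longrightarrow> cl (fa_word (replicate j x)) = cl (fa_word [x]) [^]\<^bsub>Q\<^esub> j"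
proof (induction j)
  case (Suc j)
  have "cl (fa_word (replicate j x @ [x])) = cl (fa_word (replicate j x)) \<otimes>\<^bsub>Q\<^esub> cl (fa_word [x])"
    using Suc.prems by (intro cl_word_append) auto
  thus ?case using Suc by (simp add: replicate_append_same)
qed (simp add: cl_one)

text \<open>The defining relations, read as rules for moving a later generator to the right.\<close>
lemma swap_relation:
  assumes m: "m < 4 * n" and y: "y \<in> G m"
  shows "\<exists>\<kappa> D. \<kappa> \<noteq> 0 \<and> D \<in> fa_over (G m) \<and>
    fa_sub (fa_word [gen_list n ! m, y]) (fa_add (fa_smult \<kappa> (fa_word [y, gen_list n ! m])) D) \<in> relations n q"
proof -
  obtain r j where g: "gen_list n ! m = (r, j)" by fastforce
  obtain r' j' where yy: "y = (r', j')" by fastforce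
  have gG: "(r, j) \<in> gens n" using g m gen_list_simps[of n] nth_mem[of m "gen_list n"] by simp
  note Gm = gens_upto_nth[OF m g]
  have y': "(r', j') \<in> gens n" "r' < r \<or> r' = r \<and> j' < j" using y yy Gm by auto
  have inG: "(a, b) \<in> G m \<longleftrightarrow> (a, b) \<in> gens n \<and> (a < r \<or> a = r \<and> b < j)" for a b using Gm by auto
  have X: "X2 u w \<in> fa_over (G m)" if "u \<in> G m" "w \<in> G m" for u w
    unfolding X2_def using that by (intro fa_over_closed) auto
  have zero: "(\<lambda>_. 0) \<in> fa_over (G m)" by (rule fa_over_closed)
  have pp: "2 * n + 1 - s = p s" for s by (simp add: p_def)
  have goalI: ?thesis if "\<kappa> \<noteq> 0" "D \<in> fa_over (G m)" "fa_sub (X2 (r,j) (r',j')) (fa_add (fa_smult \<kappa> (X2 (r',j') (r,j))) D) \<in> relations n q" for \<kappa> D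
    using that unfolding g yy X2_def by blast
  have bounds: "1 \<le> j" "j \<le> 2*n" "1 \<le> j'" "j' \<le> 2*n" "r \<in> {1,2}" "r' \<in> {1,2}" using gG y' by (auto simp: gens_def)
  have gin: "(a, b) \<in> gens n \<longleftrightarrow> a \<in> {1,2} \<and> 1 \<le> b \<and> b \<le> 2*n" for a b by (auto simp: gens_def)
  have cs: "r' = r \<and> j' < j \<or> r' = 1 \<and> r = 2" using y'(2) bounds(5,6) by auto
  \<comment> \<open>One case for each of the seven families of defining relations.\<close>
  consider (row) "r' = r" "j' < j" "j \<noteq> p j'" | (rowp) "r' = r" "j' < j" "j = p j'"
    | (eq) "r' = 1" "r = 2" "j = j'" | (lt) "r' = 1" "r = 2" "j < j'" "j' \<noteq> p j"
    | (gt) "r' = 1" "r = 2" "j' < j" "j \<noteq> p j'" | (low) "r' = 1" "r = 2" "j < j'" "j' = p j"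
    | (high) "r' = 1" "r = 2" "j' < j" "j = p j'"
    using cs less_linear[of j j'] by blast
  thus ?thesis
  proof cases
    case row
    have "fa_sub (X2 (r,j) (r,j')) (fa_smult (inverse q) (X2 (r,j') (r,j))) \<in> relations n q"
      unfolding relations_def Let_def pp using row bounds by blast
    moreover have "fa_add (fa_smult (inverse q) (X2 (r,j') (r,j))) (\<lambda>_. 0) = fa_smult (inverse q) (X2 (r,j') (r,j))"
      by (simp add: fa_add_def)
    ultimately show ?thesis using zero q0 row by (intro goalI[of "inverse q" "\<lambda>_. 0"]) simp_all
  next
    case rowp
    have jn: "j' \<le> n" using rowp by (auto simp: p_def)
    let ?D = "fa_smult qh (fa_sum (\<lambda>l. fa_smult (q ^ (l - j' - 1)) (X2 (r,l) (r, p l))) {j'+1..n})"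
    have "fa_sub (X2 (r,p j') (r,j')) (fa_add (X2 (r,j') (r,p j')) ?D) \<in> relations n q"
      unfolding relations_def Let_def pp using rowp bounds jn by blast
    moreover have "?D \<in> fa_over (G m)"
      using bounds rowp jn by (intro fa_over_closed X) (auto simp: inG gin p_def)
    moreover have "fa_smult 1 f = f" for f :: "'k fa" by (simp add: fa_smult_def)
    ultimately show ?thesis using rowp by (intro goalI[of 1 ?D]) simp_all
  next
    case eq
    have "fa_sub (X2 (2,j) (1,j)) (fa_smult (inverse q) (X2 (1,j) (2,j))) \<in> relations n q"
      unfolding relations_def Let_def pp using bounds by blast
    moreover have "fa_add (fa_smult (inverse q) (X2 (1,j) (2,j))) (\<lambda>_. 0) = fa_smult (inverse q) (X2 (1,j) (2,j))"
      by (simp add: fa_add_def)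
    ultimately show ?thesis using zero q0 eq by (intro goalI[of "inverse q" "\<lambda>_. 0"]) simp_all
  next
    case lt
    have "fa_sub (X2 (2,j) (1,j')) (X2 (1,j') (2,j)) \<in> relations n q"
      unfolding relations_def Let_def pp using bounds lt by blast
    moreover have "fa_add (fa_smult 1 (X2 (1,j') (2,j))) (\<lambda>_. 0) = (X2 (1,j') (2,j) :: 'k fa)"
      by (simp add: fa_add_def fa_smult_def)
    ultimately show ?thesis using zero lt by (intro goalI[of 1 "\<lambda>_. 0"]) simp_all
  next
    case gt
    let ?D = "fa_smult (- qh) (X2 (1,j) (2,j'))"
    have "fa_sub (X2 (2,j) (1,j')) (fa_sub (X2 (1,j') (2,j)) (fa_smult qh (X2 (1,j) (2,j')))) \<in> relations n q"
      unfolding relations_def Let_def pp using bounds gt by blast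
    moreover have "fa_add (fa_smult 1 (X2 (1,j') (2,j))) ?D = fa_sub (X2 (1,j') (2,j)) (fa_smult qh (X2 (1,j) (2,j')))"
      by (simp add: fa_add_def fa_smult_def fa_sub_def algebra_simps)
    moreover have "?D \<in> fa_over (G m)" using bounds gt by (intro fa_over_closed X) (auto simp: inG gin)
    ultimately show ?thesis using gt by (intro goalI[of 1 ?D]) simp_all
  next
    case low
    have jn: "j \<le> n" using low by (auto simp: p_def)
    let ?D = "fa_smult qh (fa_sum (\<lambda>l. fa_smult (q ^ (j - l)) (X2 (1, p l) (2,l))) {1..j-1})"
    have "fa_sub (X2 (2,j) (1,p j)) (fa_add (fa_smult q (X2 (1,p j) (2,j))) ?D) \<in> relations n q"
      unfolding relations_def Let_def pp using low bounds jn by blast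
    moreover have "?D \<in> fa_over (G m)"
      using bounds low jn by (intro fa_over_closed X) (auto simp: inG gin p_def)
    ultimately show ?thesis using low q0 by (intro goalI[of q ?D]) simp_all
  next
    case high
    have jn: "j' \<le> n" using high by (auto simp: p_def)
    let ?S = "fa_add
              (fa_smult qh (fa_sum (\<lambda>l. fa_smult (q ^ (l - j')) (X2 (1,l) (2, p l))) {j'+1..n}))
              (fa_smult (qh * inverse q)
                 (fa_sum (\<lambda>l. fa_smult (q ^ (p l - j')) (X2 (1, p l) (2,l))) {1..n}))"
    let ?D = "fa_sub ?S (fa_smult qh (X2 (1, p j') (2,j')))"
    have "fa_sub (X2 (2, p j') (1,j'))
        (fa_sub (fa_add (fa_smult q (X2 (1,j') (2, p j'))) ?S) (fa_smult qh (X2 (1, p j') (2,j')))) \<in> relations n q"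
      unfolding relations_def Let_def pp using high bounds jn by blast
    moreover have "fa_sub (fa_add (fa_smult q (X2 (1,j') (2, p j'))) ?S) (fa_smult qh (X2 (1, p j') (2,j')))
       = fa_add (fa_smult q (X2 (1,j') (2, p j'))) ?D"
      by (simp add: fa_add_def fa_sub_def fun_eq_iff)
    moreover have "?D \<in> fa_over (G m)"
      using bounds high jn by (intro fa_over_closed X) (auto simp: inG gin p_def)
    ultimately show ?thesis using high q0 by (intro goalI[of q ?D]) simp_all
  qed
qed

end

section \<open>The Ore extensions\<close>

context quantum_space begin

abbreviation xg where "xg m \<equiv> cl (fa_word [gen_list n ! m])"

lemma nth_gens: "m < 4 * n \<Longrightarrow> gen_list n ! m \<in> gens n"
  using gen_list_simps[of n] nth_mem[of m "gen_list n"] by simp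

lemma sc_mult: "sc (a * b) = sc a \<otimes>\<^bsub>Q\<^esub> sc b"
proof -
  have "fa_scal (a * b) = fa_mult (fa_scal a) (fa_scal b)"
    unfolding scal_mult by (simp add: fa_scal_def fa_smult_def mult_ac)
  thus ?thesis by (simp add: cl_mult)
qed

lemma sc_one: "sc 1 = \<one>\<^bsub>Q\<^esub>"
proof -
  have "fa_scal 1 = (fa_word [] :: 'k fa)" by (simp add: fa_scal_def fa_smult_def)
  thus ?thesis by (simp add: cl_one)
qed

lemma swap_cl: assumes m: "m < 4 * n" and y: "y \<in> G m"
  shows "\<exists>\<kappa> D. \<kappa> \<noteq> 0 \<and> D \<in> A m \<and>
    xg m \<otimes>\<^bsub>Q\<^esub> cl (fa_word [y]) = (sc \<kappa> \<otimes>\<^bsub>Q\<^esub> (cl (fa_word [y]) \<otimes>\<^bsub>Q\<^esub> xg m)) \<oplus>\<^bsub>Q\<^esub> D"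
proof -
  let ?g = "gen_list n ! m"
  obtain \<kappa> D where kD: "\<kappa> \<noteq> 0" "D \<in> fa_over (G m)"
    "fa_sub (fa_word [?g, y]) (fa_add (fa_smult \<kappa> (fa_word [y, ?g])) D) \<in> relations n q"
    using swap_relation[OF m y] by blast
  have gy: "?g \<in> gens n" "y \<in> gens n" using nth_gens[OF m] y gens_upto_gens by auto
  have F: "(fa_word [?g, y] :: 'k fa) \<in> FA n" "(fa_word [y, ?g] :: 'k fa) \<in> FA n" "D \<in> FA n"
    using gy kD(2) fa_over_G[of m] by (auto intro!: word_FA)
  have "relations n q \<subseteq> RI" unfolding rel_ideal_def
    by (rule ring.genideal_self[OF ring_free_alg]) (use relations_subset_FA in \<open>simp add: free_alg_simps\<close>)
  hence "cl (fa_word [?g, y]) = cl (fa_add (fa_smult \<kappa> (fa_word [y, ?g])) D)"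
    using kD(3) F by (subst cl_eq_iff) (auto simp: FA_closed)
  also have "\<dots> = (sc \<kappa> \<otimes>\<^bsub>Q\<^esub> cl (fa_word [y, ?g])) \<oplus>\<^bsub>Q\<^esub> cl D"
    using F by (simp add: cl_add cl_smult FA_closed)
  finally have "xg m \<otimes>\<^bsub>Q\<^esub> cl (fa_word [y]) = (sc \<kappa> \<otimes>\<^bsub>Q\<^esub> (cl (fa_word [y]) \<otimes>\<^bsub>Q\<^esub> xg m)) \<oplus>\<^bsub>Q\<^esub> cl D"
    using cl_word_Cons[of ?g "[y]"] cl_word_Cons[of y "[?g]"] gy by simp
  thus ?thesis using kD by (auto simp: subalg_image)
qed

text \<open>Fixing one nonzero scalar for each generator \<open>y\<close> allows the scalar of a
  word to be defined as a product.\<close>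

definition kappa :: "nat \<Rightarrow> gen \<Rightarrow> 'k" where
  "kappa m y = (SOME \<kappa>. \<exists>D. \<kappa> \<noteq> 0 \<and> D \<in> A m \<and>
    xg m \<otimes>\<^bsub>Q\<^esub> cl (fa_word [y]) = (sc \<kappa> \<otimes>\<^bsub>Q\<^esub> (cl (fa_word [y]) \<otimes>\<^bsub>Q\<^esub> xg m)) \<oplus>\<^bsub>Q\<^esub> D)"

lemma kappa_swap: assumes m: "m < 4 * n" and y: "y \<in> G m"
  shows "\<exists>D. kappa m y \<noteq> 0 \<and> D \<in> A m \<and>
    xg m \<otimes>\<^bsub>Q\<^esub> cl (fa_word [y]) = (sc (kappa m y) \<otimes>\<^bsub>Q\<^esub> (cl (fa_word [y]) \<otimes>\<^bsub>Q\<^esub> xg m)) \<oplus>\<^bsub>Q\<^esub> D"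
  unfolding kappa_def by (rule someI_ex[OF swap_cl[OF m y]])

definition chi :: "nat \<Rightarrow> gen list \<Rightarrow> 'k" where "chi m w = prod_list (map (kappa m) w)"

lemma chi_nonzero: "m < 4 * n \<Longrightarrow> w \<in> lists (G m) \<Longrightarrow> chi m w \<noteq> 0"
  unfolding chi_def using kappa_swap by (induction w) auto

text \<open>A diagonal rescaling of words in the free algebra, with no claim that it descends to the
  quotient: it only supplies a coefficient \<open>b\<close> in \<open>x a = b x + d\<close>. Being
  invertible on words over \<open>G m\<close> and preserving supports, it yields both surjectivity
  and injectivity of \<open>\<tau>\<close>.\<close>

definition twist :: "nat \<Rightarrow> 'k fa \<Rightarrow> 'k fa" where "twist m f = (\<lambda>w. chi m w * f w)"

lemma twist_supp: "fa_supp (twist m f) \<subseteq> fa_supp f"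
  by (auto simp: twist_def fa_supp_def)

lemma twist_over: "f \<in> fa_over X \<Longrightarrow> twist m f \<in> fa_over X"
  using twist_supp[of m f] unfolding fa_over_def by (auto intro: finite_subset)

lemma xg_carrier: "m < 4 * n \<Longrightarrow> xg m \<in> carrier Q"
  using nth_gens[of m] by (intro cl_carrier word_FA) auto

lemma A_carrier: "a \<in> A m \<Longrightarrow> a \<in> carrier Q"
  using subalg_carrier by blast

lemma move_word: assumes m: "m < 4 * n" and w: "w \<in> lists (G m)"
  shows "\<exists>d\<in>A m. xg m \<otimes>\<^bsub>Q\<^esub> cl (fa_word w) = ((sc (chi m w) \<otimes>\<^bsub>Q\<^esub> cl (fa_word w)) \<otimes>\<^bsub>Q\<^esub> xg m) \<oplus>\<^bsub>Q\<^esub> d"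
  using w
proof (induction w)
  case Nil
  have "\<zero>\<^bsub>Q\<^esub> \<in> A m" using subringE(2)[OF subring_A] .
  moreover have "xg m \<otimes>\<^bsub>Q\<^esub> cl (fa_word []) = ((sc (chi m []) \<otimes>\<^bsub>Q\<^esub> cl (fa_word [])) \<otimes>\<^bsub>Q\<^esub> xg m) \<oplus>\<^bsub>Q\<^esub> \<zero>\<^bsub>Q\<^esub>"
    using xg_carrier[OF m] by (simp add: cl_one chi_def sc_one)
  ultimately show ?case by blast
next
  case (Cons y w)
  obtain d where d: "d \<in> A m" "xg m \<otimes>\<^bsub>Q\<^esub> cl (fa_word w) = ((sc (chi m w) \<otimes>\<^bsub>Q\<^esub> cl (fa_word w)) \<otimes>\<^bsub>Q\<^esub> xg m) \<oplus>\<^bsub>Q\<^esub> d"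
    using Cons by blast
  obtain D where D: "D \<in> A m" "xg m \<otimes>\<^bsub>Q\<^esub> cl (fa_word [y]) = (sc (kappa m y) \<otimes>\<^bsub>Q\<^esub> (cl (fa_word [y]) \<otimes>\<^bsub>Q\<^esub> xg m)) \<oplus>\<^bsub>Q\<^esub> D"
    using kappa_swap[OF m] Cons by blast
  define x Y W k c where "x = xg m" and "Y = cl (fa_word [y])" and "W = cl (fa_word w)" and "k = sc (kappa m y)" and "c = sc (chi m w)"
  have A: "Y \<in> A m" "W \<in> A m" "k \<in> A m" "c \<in> A m"
    using Cons by (auto simp: Y_def W_def k_def c_def sc_A intro: word_A)
  have car: "x \<in> carrier Q" "Y \<in> carrier Q" "W \<in> carrier Q" "k \<in> carrier Q" "c \<in> carrier Q" "d \<in> carrier Q" "D \<in> carrier Q"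
    using xg_carrier[OF m] A d D A_carrier by (auto simp: x_def)
  have yw: "cl (fa_word (y # w)) = Y \<otimes>\<^bsub>Q\<^esub> W"
    unfolding Y_def W_def using Cons gens_upto_gens[of m n] by (intro cl_word_Cons) auto
  have cen: "Y \<otimes>\<^bsub>Q\<^esub> c = c \<otimes>\<^bsub>Q\<^esub> Y" unfolding c_def using sc_central car by blast
  have "x \<otimes>\<^bsub>Q\<^esub> (Y \<otimes>\<^bsub>Q\<^esub> W) = (x \<otimes>\<^bsub>Q\<^esub> Y) \<otimes>\<^bsub>Q\<^esub> W" using car by (simp add: Q.m_assoc)
  also have "\<dots> = ((k \<otimes>\<^bsub>Q\<^esub> (Y \<otimes>\<^bsub>Q\<^esub> x)) \<oplus>\<^bsub>Q\<^esub> D) \<otimes>\<^bsub>Q\<^esub> W" using D(2) by (simp add: x_def Y_def k_def)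
  also have "\<dots> = (k \<otimes>\<^bsub>Q\<^esub> (Y \<otimes>\<^bsub>Q\<^esub> (x \<otimes>\<^bsub>Q\<^esub> W))) \<oplus>\<^bsub>Q\<^esub> (D \<otimes>\<^bsub>Q\<^esub> W)" using car by (simp add: Q.l_distr Q.m_assoc)
  also have "x \<otimes>\<^bsub>Q\<^esub> W = ((c \<otimes>\<^bsub>Q\<^esub> W) \<otimes>\<^bsub>Q\<^esub> x) \<oplus>\<^bsub>Q\<^esub> d" using d(2) by (simp add: x_def W_def c_def)
  also have "(k \<otimes>\<^bsub>Q\<^esub> (Y \<otimes>\<^bsub>Q\<^esub> (((c \<otimes>\<^bsub>Q\<^esub> W) \<otimes>\<^bsub>Q\<^esub> x) \<oplus>\<^bsub>Q\<^esub> d))) \<oplus>\<^bsub>Q\<^esub> (D \<otimes>\<^bsub>Q\<^esub> W)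
     = (k \<otimes>\<^bsub>Q\<^esub> ((Y \<otimes>\<^bsub>Q\<^esub> c) \<otimes>\<^bsub>Q\<^esub> (W \<otimes>\<^bsub>Q\<^esub> x))) \<oplus>\<^bsub>Q\<^esub> ((k \<otimes>\<^bsub>Q\<^esub> (Y \<otimes>\<^bsub>Q\<^esub> d)) \<oplus>\<^bsub>Q\<^esub> (D \<otimes>\<^bsub>Q\<^esub> W))"
    using car by (simp add: Q.r_distr Q.m_assoc Q.a_assoc)
  also have "\<dots> = (((k \<otimes>\<^bsub>Q\<^esub> c) \<otimes>\<^bsub>Q\<^esub> (Y \<otimes>\<^bsub>Q\<^esub> W)) \<otimes>\<^bsub>Q\<^esub> x) \<oplus>\<^bsub>Q\<^esub> ((k \<otimes>\<^bsub>Q\<^esub> (Y \<otimes>\<^bsub>Q\<^esub> d)) \<oplus>\<^bsub>Q\<^esub> (D \<otimes>\<^bsub>Q\<^esub> W))"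
    unfolding cen using car by (simp add: Q.m_assoc)
  finally have "xg m \<otimes>\<^bsub>Q\<^esub> cl (fa_word (y # w)) = ((sc (chi m (y # w)) \<otimes>\<^bsub>Q\<^esub> cl (fa_word (y # w))) \<otimes>\<^bsub>Q\<^esub> xg m)
      \<oplus>\<^bsub>Q\<^esub> ((k \<otimes>\<^bsub>Q\<^esub> (Y \<otimes>\<^bsub>Q\<^esub> d)) \<oplus>\<^bsub>Q\<^esub> (D \<otimes>\<^bsub>Q\<^esub> W))"
    unfolding yw by (simp add: x_def k_def c_def chi_def sc_mult)
  moreover have "(k \<otimes>\<^bsub>Q\<^esub> (Y \<otimes>\<^bsub>Q\<^esub> d)) \<oplus>\<^bsub>Q\<^esub> (D \<otimes>\<^bsub>Q\<^esub> W) \<in> A m"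
    by (intro subringE(6,7)[OF subring_A] A d(1) D(1))
  ultimately show ?case by blast
qed

lemma move: assumes m: "m < 4 * n" and f: "f \<in> fa_over (G m)"
  shows "\<exists>d\<in>A m. xg m \<otimes>\<^bsub>Q\<^esub> cl f = (cl (twist m f) \<otimes>\<^bsub>Q\<^esub> xg m) \<oplus>\<^bsub>Q\<^esub> d"
  using f
proof (induction f rule: fa_over_induct)
  case zero
  have "twist m (\<lambda>_. 0) = (\<lambda>_. 0)" by (simp add: twist_def)
  moreover have "\<zero>\<^bsub>Q\<^esub> \<in> A m" using subringE(2)[OF subring_A] .
  ultimately show ?case using xg_carrier[OF m] by (intro bexI[of _ "\<zero>\<^bsub>Q\<^esub>"]) (simp_all add: cl_zero)
next
  case (add c w f)
  obtain d where d: "d \<in> A m" "xg m \<otimes>\<^bsub>Q\<^esub> cl f = (cl (twist m f) \<otimes>\<^bsub>Q\<^esub> xg m) \<oplus>\<^bsub>Q\<^esub> d" using add by blast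
  obtain e where e: "e \<in> A m" "xg m \<otimes>\<^bsub>Q\<^esub> cl (fa_word w) = ((sc (chi m w) \<otimes>\<^bsub>Q\<^esub> cl (fa_word w)) \<otimes>\<^bsub>Q\<^esub> xg m) \<oplus>\<^bsub>Q\<^esub> e"
    using move_word[OF m add(1)] by blast
  define x F F' W k h where "x = xg m" and "F = cl f" and "F' = cl (twist m f)" and "W = cl (fa_word w)" and "k = sc c" and "h = sc (chi m w)"
  have fFA: "f \<in> FA n" "twist m f \<in> FA n" "(fa_word w :: 'k fa) \<in> FA n"
    using add twist_over fa_over_G fa_over_closed(4)[of w "G m"] by blast+
  have car: "x \<in> carrier Q" "F \<in> carrier Q" "F' \<in> carrier Q" "W \<in> carrier Q" "k \<in> carrier Q" "h \<in> carrier Q" "d \<in> carrier Q" "e \<in> carrier Q"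
    using xg_carrier[OF m] d e A_carrier fFA by (auto simp: x_def F_def F'_def W_def k_def h_def)
  have 1: "cl (fa_add (fa_smult c (fa_word w)) f) = (k \<otimes>\<^bsub>Q\<^esub> W) \<oplus>\<^bsub>Q\<^esub> F"
    using fFA by (simp add: cl_add cl_smult FA_closed k_def W_def F_def)
  have "twist m (fa_add (fa_smult c (fa_word w)) f) = fa_add (fa_smult (c * chi m w) (fa_word w)) (twist m f)"
    by (auto simp: twist_def fa_add_def fa_smult_def fa_word_def fun_eq_iff algebra_simps)
  hence 2: "cl (twist m (fa_add (fa_smult c (fa_word w)) f)) = ((k \<otimes>\<^bsub>Q\<^esub> h) \<otimes>\<^bsub>Q\<^esub> W) \<oplus>\<^bsub>Q\<^esub> F'"
    using fFA by (simp add: cl_add cl_smult FA_closed k_def W_def F'_def h_def sc_mult)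
  have cen: "x \<otimes>\<^bsub>Q\<^esub> k = k \<otimes>\<^bsub>Q\<^esub> x" unfolding k_def using sc_central car by blast
  have "x \<otimes>\<^bsub>Q\<^esub> ((k \<otimes>\<^bsub>Q\<^esub> W) \<oplus>\<^bsub>Q\<^esub> F) = ((x \<otimes>\<^bsub>Q\<^esub> k) \<otimes>\<^bsub>Q\<^esub> W) \<oplus>\<^bsub>Q\<^esub> (x \<otimes>\<^bsub>Q\<^esub> F)"
    using car by (simp add: Q.r_distr Q.m_assoc)
  also have "\<dots> = (k \<otimes>\<^bsub>Q\<^esub> (x \<otimes>\<^bsub>Q\<^esub> W)) \<oplus>\<^bsub>Q\<^esub> (x \<otimes>\<^bsub>Q\<^esub> F)" unfolding cen using car by (simp add: Q.m_assoc)
  also have "x \<otimes>\<^bsub>Q\<^esub> W = ((h \<otimes>\<^bsub>Q\<^esub> W) \<otimes>\<^bsub>Q\<^esub> x) \<oplus>\<^bsub>Q\<^esub> e" using e(2) by (simp add: x_def W_def h_def)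
  also have "x \<otimes>\<^bsub>Q\<^esub> F = (F' \<otimes>\<^bsub>Q\<^esub> x) \<oplus>\<^bsub>Q\<^esub> d" using d(2) by (simp add: x_def F_def F'_def)
  also have "(k \<otimes>\<^bsub>Q\<^esub> (((h \<otimes>\<^bsub>Q\<^esub> W) \<otimes>\<^bsub>Q\<^esub> x) \<oplus>\<^bsub>Q\<^esub> e)) \<oplus>\<^bsub>Q\<^esub> ((F' \<otimes>\<^bsub>Q\<^esub> x) \<oplus>\<^bsub>Q\<^esub> d)
    = ((((k \<otimes>\<^bsub>Q\<^esub> h) \<otimes>\<^bsub>Q\<^esub> W) \<oplus>\<^bsub>Q\<^esub> F') \<otimes>\<^bsub>Q\<^esub> x) \<oplus>\<^bsub>Q\<^esub> ((k \<otimes>\<^bsub>Q\<^esub> e) \<oplus>\<^bsub>Q\<^esub> d)"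
    using car by (simp add: Q.r_distr Q.l_distr Q.m_assoc Q.a_ac)
  finally have "xg m \<otimes>\<^bsub>Q\<^esub> cl (fa_add (fa_smult c (fa_word w)) f) = (cl (twist m (fa_add (fa_smult c (fa_word w)) f)) \<otimes>\<^bsub>Q\<^esub> xg m) \<oplus>\<^bsub>Q\<^esub> ((k \<otimes>\<^bsub>Q\<^esub> e) \<oplus>\<^bsub>Q\<^esub> d)"
    unfolding 1 2 x_def .
  moreover have "(k \<otimes>\<^bsub>Q\<^esub> e) \<oplus>\<^bsub>Q\<^esub> d \<in> A m"
    unfolding k_def by (intro subringE(6,7)[OF subring_A] sc_A d(1) e(1))
  ultimately show ?case by blast
qed

lemma ore_data_A: assumes m: "m < 4 * n" shows "ore_data Q (A m) (xg m)"
proof (intro ore_data.intro ring_Q ore_data_axioms.intro subring_A xg_carrier[OF m])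
  fix a assume "a \<in> A m"
  then obtain f where f: "a = cl f" "f \<in> fa_over (G m)" by (auto simp: subalg_image)
  have "cl (twist m f) \<in> A m" using twist_over[OF f(2)] by (auto simp: subalg_image)
  thus "\<exists>b\<in>A m. \<exists>d\<in>A m. xg m \<otimes>\<^bsub>Q\<^esub> a = (b \<otimes>\<^bsub>Q\<^esub> xg m) \<oplus>\<^bsub>Q\<^esub> d"
    using move[OF m f(2)] unfolding f(1) by blast
qed

lemma A_mono: "m < 4 * n \<Longrightarrow> A m \<subseteq> A (Suc m)"
  unfolding subalg_image using fa_over_mono[of "G m" "G (Suc m)"] gens_upto_Suc[of m n] by blast

lemma left_polys_eq: assumes m: "m < 4 * n" shows "left_polys Q (A m) (xg m) = A (Suc m)"
proof -
  interpret ore_data Q "A m" "xg m" by (rule ore_data_A[OF m])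
  have S: "subring (A (Suc m)) Q" by (rule subring_A)
  have xS: "xg m \<in> A (Suc m)" using gens_upto_Suc[OF m] by (intro word_A) auto
  have pow: "xg m [^]\<^bsub>Q\<^esub> (j::nat) \<in> A (Suc m)" for j
    by (induction j) (use subringE(3,6)[OF S] xS in auto)
  show ?thesis
  proof (intro equalityI subsetI)
    fix s assume "s \<in> left_polys Q (A m) (xg m)"
    thus "s \<in> A (Suc m)"
    proof (induction s rule: left_polys_induct)
      case zero thus ?case using subringE(2)[OF S] .
    next
      case (add a j s)
      have "a \<in> A (Suc m)" using add A_mono[OF m] by blast
      thus ?case by (intro subringE(6,7)[OF S] pow add)
    qed
  next
    fix s assume "s \<in> A (Suc m)"
    then obtain f where f: "s = cl f" "f \<in> fa_over (G (Suc m))" by (auto simp: subalg_image)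
    have w: "cl (fa_word w) \<in> left_polys Q (A m) (xg m)" if "w \<in> lists (G (Suc m))" for w
      using that
    proof (induction w)
      case Nil
      show ?case unfolding cl_one using left_polys_A[OF subringE(3)[OF subring_A]] .
    next
      case (Cons y w)
      have gw: "y \<in> gens n" "w \<in> lists (gens n)" using Cons gens_upto_gens[of "Suc m" n] by auto
      have "y = gen_list n ! m \<or> y \<in> G m" using Cons gens_upto_Suc[OF m] by auto
      thus ?case unfolding cl_word_Cons[OF gw]
        using left_polys_left_x[OF Cons.IH] left_polys_left_A[OF Cons.IH, of "cl (fa_word [y])"] word_A[of "[y]" m] by auto
    qed
    show "s \<in> left_polys Q (A m) (xg m)" unfolding f(1) using f(2)
    proof (induction f rule: fa_over_induct)
      case zero show ?case unfolding cl_zero by (rule left_polys_zero)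
    next
      case (add c w f)
      have F: "(fa_word w :: 'k fa) \<in> FA n" "f \<in> FA n" using add(1,2) fa_over_G fa_over_closed(4)[of w "G (Suc m)"] by blast+
      hence "cl (fa_add (fa_smult c (fa_word w)) f) = (sc c \<otimes>\<^bsub>Q\<^esub> cl (fa_word w)) \<oplus>\<^bsub>Q\<^esub> cl f"
        by (simp add: cl_add cl_smult FA_closed)
      thus ?case using left_polys_add[OF left_polys_left_A[OF w[OF add(1)] sc_A] add(3)] by simp
    qed
  qed
qed

section \<open>Normal forms and freeness\<close>

definition normal_form :: "nat \<Rightarrow> 'k fa set" where "normal_form m = {f. finite (fa_supp f) \<and> fa_supp f \<subseteq> ord_words n m}"

lemma normal_form_over: "m \<le> 4 * n \<Longrightarrow> normal_form m \<subseteq> fa_over (G m)"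
  unfolding normal_form_def fa_over_def using ord_words_lists[of m n] by blast

lemma normal_form_append: assumes m: "m < 4 * n" and f: "f \<in> normal_form m"
  shows "fa_mult f (fa_word (replicate j (gen_list n ! m))) \<in> normal_form (Suc m)"
proof -
  let ?w = "replicate j (gen_list n ! m)"
  have s: "fa_supp (fa_mult f (fa_word ?w)) \<subseteq> (\<lambda>u. u @ ?w) ` fa_supp f"
    using fa_supp_mult[of f "fa_word ?w"] unfolding fa_supp_simps(4) by auto
  have fin: "finite ((\<lambda>u. u @ ?w) ` fa_supp f)" using f by (simp add: normal_form_def)
  have "(\<lambda>u. u @ ?w) ` fa_supp f \<subseteq> ord_words n (Suc m)" using f unfolding ord_words_Suc[OF m] normal_form_def by blast
  thus ?thesis unfolding normal_form_def mem_Collect_eq using finite_subset[OF s fin] s by blast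
qed

lemma normal_form_add: "f \<in> normal_form m \<Longrightarrow> g \<in> normal_form m \<Longrightarrow> fa_add f g \<in> normal_form m"
  unfolding normal_form_def using fa_supp_simps(1)[of f g] by (auto intro: finite_subset)

text \<open>By \<open>left_polys_eq\<close> an element is a left polynomial in the newest generator,
  and a power of that generator appended to an ordered word in the earlier ones is again
  ordered.\<close>

lemma normal_form_span: "m \<le> 4 * n \<Longrightarrow> a \<in> A m \<Longrightarrow> \<exists>f\<in>normal_form m. a = cl f"
proof (induction m arbitrary: a)
  case 0
  have "fa_over (G 0) = normal_form 0" unfolding fa_over_def normal_form_def ord_words_0 by auto
  thus ?case using 0 unfolding subalg_image by auto
next
  case (Suc m)
  hence m: "m < 4 * n" by simp
  interpret ore_data Q "A m" "xg m" by (rule ore_data_A[OF m])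
  have "a \<in> left_polys Q (A m) (xg m)" using Suc.prems left_polys_eq[OF m] by simp
  thus ?case
  proof (induction a rule: left_polys_induct)
    case zero
    have "(\<lambda>_. 0) \<in> normal_form (Suc m)" by (simp add: normal_form_def fa_supp_def)
    thus ?case using cl_zero by metis
  next
    case (add a j s)
    obtain f where f: "f \<in> normal_form m" "a = cl f" using Suc.IH[of a] add m by auto
    obtain h where h: "h \<in> normal_form (Suc m)" "s = cl h" using add by auto
    let ?w = "replicate j (gen_list n ! m)"
    have FA: "f \<in> FA n" "h \<in> FA n" "(fa_word ?w :: 'k fa) \<in> FA n"
      using f h normal_form_over[of m] normal_form_over[of "Suc m"] fa_over_G m nth_gens[OF m] by (auto intro!: word_FA)
    have "cl (fa_add (fa_mult f (fa_word ?w)) h) = (a \<otimes>\<^bsub>Q\<^esub> xg m [^]\<^bsub>Q\<^esub> j) \<oplus>\<^bsub>Q\<^esub> s"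
      using FA f h by (simp add: cl_add cl_mult FA_closed cl_word_pow[OF nth_gens[OF m]])
    moreover have "fa_add (fa_mult f (fa_word ?w)) h \<in> normal_form (Suc m)"
      by (rule normal_form_add[OF normal_form_append[OF m f(1)] h(1)])
    ultimately show ?case by metis
  qed
qed

lemma normal_form_zero: assumes "m \<le> 4 * n" "f \<in> normal_form m" "cl f = \<zero>\<^bsub>Q\<^esub>" shows "fa_supp f = {}"
proof (rule ordw_independent)
  have "f \<in> FA n" using normal_form_over[OF assms(1)] fa_over_G assms(2) by blast
  thus "f \<in> RI" using assms(3) cl_zero_iff by blast
  show "fa_supp f \<subseteq> ordw" "finite (fa_supp f)" using assms ord_words_ordw[OF assms(1)] unfolding normal_form_def by auto
qed

text \<open>With coefficients lifted to normal forms, the whole sum is a normal form and so vanishes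
  already in the free algebra. The newest generator does not occur in the coefficients, so its
  multiplicity in a word reveals the power \<open>j\<close> and the terms cannot cancel each
  other.\<close>

lemma free_A: assumes m: "m < 4 * n" and f: "f \<in> {..<N} \<rightarrow> A m"
  and z: "finsum Q (\<lambda>j. f j \<otimes>\<^bsub>Q\<^esub> xg m [^]\<^bsub>Q\<^esub> (j::nat)) {..<N} = \<zero>\<^bsub>Q\<^esub>"
  shows "\<forall>j<N. f j = \<zero>\<^bsub>Q\<^esub>"
proof -
  let ?g = "gen_list n ! m"
  have "\<forall>j. \<exists>F. j < N \<longrightarrow> F \<in> normal_form m \<and> f j = cl F"
    using f normal_form_span[of m] m by (metis PiE lessThan_iff less_imp_le_nat)
  then obtain F where F: "\<And>j. j < N \<Longrightarrow> F j \<in> normal_form m" "\<And>j. j < N \<Longrightarrow> f j = cl (F j)" by metis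
  define T where "T j = fa_mult (F j) (fa_word (replicate j ?g))" for j
  have T: "T j \<in> normal_form (Suc m)" if "j < N" for j unfolding T_def by (rule normal_form_append[OF m F(1)[OF that]])
  have nfFA: "h \<in> FA n" if "h \<in> normal_form (Suc m)" for h using normal_form_over[of "Suc m"] m fa_over_G that by auto
  have Fc: "F j \<in> FA n" if "j < N" for j using normal_form_over[of m] m fa_over_G F(1)[OF that] by auto
  have fcar: "f j \<in> carrier Q" if "j < N" for j using f that A_carrier[of "f j" m] by auto
  have H: "fa_sum T {..<M} \<in> normal_form (Suc m) \<and> cl (fa_sum T {..<M}) = finsum Q (\<lambda>j. f j \<otimes>\<^bsub>Q\<^esub> xg m [^]\<^bsub>Q\<^esub> (j::nat)) {..<M}"
    if "M \<le> N" for M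
    using that
  proof (induction M)
    case 0
    have "fa_sum T {..<0} = (\<lambda>_. 0)" by (simp add: fa_sum_def)
    thus ?case by (simp add: cl_zero normal_form_def fa_supp_def)
  next
    case (Suc M)
    have e: "fa_sum T {..<Suc M} = fa_add (T M) (fa_sum T {..<M})"
      by (simp add: fa_sum_def fa_add_def fun_eq_iff add.commute)
    have cT: "cl (T M) = f M \<otimes>\<^bsub>Q\<^esub> xg m [^]\<^bsub>Q\<^esub> M"
      unfolding T_def using Suc Fc[of M] F(2)[of M] nth_gens[OF m] cl_word_pow[OF nth_gens[OF m], of M]
      by (subst cl_mult) (auto intro!: word_FA)
    have "(\<lambda>j. f j \<otimes>\<^bsub>Q\<^esub> xg m [^]\<^bsub>Q\<^esub> j) \<in> {..<M} \<rightarrow> carrier Q" "f M \<otimes>\<^bsub>Q\<^esub> xg m [^]\<^bsub>Q\<^esub> M \<in> carrier Q"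
      using fcar Suc.prems xg_carrier[OF m] by auto
    hence "finsum Q (\<lambda>j. f j \<otimes>\<^bsub>Q\<^esub> xg m [^]\<^bsub>Q\<^esub> (j::nat)) {..<Suc M} =
      f M \<otimes>\<^bsub>Q\<^esub> xg m [^]\<^bsub>Q\<^esub> M \<oplus>\<^bsub>Q\<^esub> finsum Q (\<lambda>j. f j \<otimes>\<^bsub>Q\<^esub> xg m [^]\<^bsub>Q\<^esub> (j::nat)) {..<M}"
      unfolding lessThan_Suc by (subst Q.finsum_insert) auto
    thus ?case unfolding e using Suc cT T[of M] nfFA normal_form_add by (simp add: cl_add)
  qed
  have "fa_supp (fa_sum T {..<N}) = {}"
    using H[of N] z m by (intro normal_form_zero[of "Suc m"]) auto
  hence zero: "fa_sum T {..<N} w = 0" for w by (auto simp: fa_supp_def)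
  have "F j w = 0" if j: "j < N" for j w
  proof (cases "w \<in> fa_supp (F j)")
    case True
    have gn: "?g \<notin> set u" if "u \<in> ord_words n m" for u
      using ord_words_lists[of m n] m nth_notin_gens_upto[OF m] that by auto
    have w: "w \<in> ord_words n m" using True F(1)[OF j] by (auto simp: normal_form_def)
    have "T i (w @ replicate j ?g) = 0" if i: "i < N" "i \<noteq> j" for i
    proof (rule ccontr)
      assume "T i (w @ replicate j ?g) \<noteq> 0"
      hence "w @ replicate j ?g \<in> fa_supp (T i)" by (simp add: fa_supp_def)
      then obtain u where u: "u \<in> fa_supp (F i)" "w @ replicate j ?g = u @ replicate i ?g"
        using fa_supp_mult[of "F i" "fa_word (replicate i ?g)"] unfolding T_def fa_supp_simps(4) by auto
      have "u \<in> ord_words n m" using u F(1)[OF i(1)] by (auto simp: normal_form_def)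
      hence "count_list u ?g = 0" "count_list w ?g = 0" using gn w by (simp_all add: count_notin)
      moreover have "count_list (replicate k ?g) ?g = k" for k by (induction k) auto
      ultimately show False using arg_cong[OF u(2), of "\<lambda>v. count_list v ?g"] i(2) by simp
    qed
    hence "fa_sum T {..<N} (w @ replicate j ?g) = T j (w @ replicate j ?g)"
      unfolding fa_sum_def using j by (subst sum.remove[of _ j]) auto
    thus ?thesis using zero fa_mult_word_right[of "F j" "replicate j ?g" w] by (simp add: T_def)
  qed (simp add: fa_supp_def)
  hence "F j = (\<lambda>_. 0)" if "j < N" for j using that by blast
  thus ?thesis using F(2) cl_zero by metis
qed

section \<open>Each stage as an Ore extension, and the basis\<close>

lemma ore_step: assumes m: "m < 4 * n"
  shows "\<exists>\<tau> \<delta>. ore_extension Q (\<lambda>c. sc c) (A m) (A (Suc m)) (xg m) \<tau> \<delta>"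
proof -
  interpret D: ore_data Q "A m" "xg m" by (rule ore_data_A[OF m])
  note free = free_A[OF m]
  show ?thesis unfolding left_polys_eq[OF m, symmetric]
  proof (rule D.ore_extensionI)
    show "\<forall>j<N. f j = \<zero>\<^bsub>Q\<^esub>" if "f \<in> {..<N} \<rightarrow> A m" "(\<Oplus>\<^bsub>Q\<^esub>j\<in>{..<N}. f j \<otimes>\<^bsub>Q\<^esub> xg m [^]\<^bsub>Q\<^esub> j) = \<zero>\<^bsub>Q\<^esub>" for N :: nat and f
      by (rule free[OF that])
    show "sc c \<in> A m" for c by (rule sc_A)
    show "a \<otimes>\<^bsub>Q\<^esub> sc c = sc c \<otimes>\<^bsub>Q\<^esub> a" if "a \<in> carrier Q" for c a by (rule sc_central[OF that])
  next
    fix b assume "b \<in> A m"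
    then obtain f where f: "b = cl f" "f \<in> fa_over (G m)" by (auto simp: subalg_image)
    \<comment> \<open>This inverts \<open>twist\<close>. Division by zero does no harm:
      \<open>chi m\<close> is nonzero on words over \<open>G m\<close>, and \<open>f\<close>
      vanishes on all others.\<close>
    define h where "h = (\<lambda>w. f w / chi m w)"
    have "fa_supp h \<subseteq> fa_supp f" by (auto simp: h_def fa_supp_def)
    hence h: "h \<in> fa_over (G m)" using f(2) unfolding fa_over_def by (auto intro: finite_subset)
    have "twist m h = f"
    proof
      fix w
      show "twist m h w = f w"
      proof (cases "f w = 0")
        case False
        hence "w \<in> lists (G m)" using f(2) unfolding fa_over_def fa_supp_def by auto
        thus ?thesis using chi_nonzero[OF m] by (simp add: twist_def h_def)
      qed (simp add: twist_def h_def)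
    qed
    thus "\<exists>a\<in>A m. \<exists>d\<in>A m. xg m \<otimes>\<^bsub>Q\<^esub> a = (b \<otimes>\<^bsub>Q\<^esub> xg m) \<oplus>\<^bsub>Q\<^esub> d"
      using move[OF m h] h unfolding f(1) subalg_image by blast
  next
    fix a d assume a: "a \<in> A m" and d: "d \<in> A m" and ad: "xg m \<otimes>\<^bsub>Q\<^esub> a = d"
    \<comment> \<open>A representative in normal form is taken because its twist is again a normal
      form; once that twist is zero in the quotient it is zero in the free algebra, which forces
      \<open>f\<close> to vanish.\<close>
    obtain f where f: "f \<in> normal_form m" "a = cl f" using normal_form_span[OF _ a] m by auto
    have fo: "f \<in> fa_over (G m)" using normal_form_over[of m] m f by auto
    obtain e where e: "e \<in> A m" "xg m \<otimes>\<^bsub>Q\<^esub> a = (cl (twist m f) \<otimes>\<^bsub>Q\<^esub> xg m) \<oplus>\<^bsub>Q\<^esub> e" using move[OF m fo] f by auto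
    have tA: "cl (twist m f) \<in> A m" using twist_over[OF fo] by (auto simp: subalg_image)
    have tnf: "twist m f \<in> normal_form m" using f(1) twist_supp[of m f] unfolding normal_form_def by (auto intro: finite_subset)
    have ed: "e \<ominus>\<^bsub>Q\<^esub> d \<in> A m" unfolding a_minus_def by (intro subringE(5,7)[OF subring_A] e(1) d)
    have car: "cl (twist m f) \<otimes>\<^bsub>Q\<^esub> xg m \<in> carrier Q" "e \<in> carrier Q" "d \<in> carrier Q"
      using tA e d A_carrier xg_carrier[OF m] by auto
    have "(cl (twist m f) \<otimes>\<^bsub>Q\<^esub> xg m) \<oplus>\<^bsub>Q\<^esub> (e \<ominus>\<^bsub>Q\<^esub> d) = ((cl (twist m f) \<otimes>\<^bsub>Q\<^esub> xg m) \<oplus>\<^bsub>Q\<^esub> e) \<ominus>\<^bsub>Q\<^esub> d"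
      using car by (simp add: a_minus_def Q.a_assoc)
    also have "\<dots> = \<zero>\<^bsub>Q\<^esub>" unfolding e(2)[symmetric] ad using car by (simp add: a_minus_def Q.r_neg)
    finally have "cl (twist m f) = \<zero>\<^bsub>Q\<^esub>" using D.two_terms[OF free tA ed] by blast
    hence t: "fa_supp (twist m f) = {}" using normal_form_zero[OF _ tnf] m by simp
    have "f w = 0" for w
    proof (rule ccontr)
      assume fw: "f w \<noteq> 0"
      hence "w \<in> lists (G m)" using fo unfolding fa_over_def fa_supp_def by auto
      hence "chi m w \<noteq> 0" by (rule chi_nonzero[OF m])
      thus False using fw t by (auto simp: fa_supp_def twist_def)
    qed
    hence "f = (\<lambda>_. 0)" by blast
    thus "a = \<zero>\<^bsub>Q\<^esub>" using f(2) cl_zero by simp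
  qed
qed

lemma iterated_ore: "iterated_ore n q"
  unfolding iterated_ore_def
proof (intro conjI allI impI)
  show "\<exists>\<tau> \<delta>. ore_extension Q (\<lambda>c. sc c) (A m) (A (Suc m)) (xg m) \<tau> \<delta>" if "m < 4 * n" for m
    by (rule ore_step[OF that])
  have "G (4 * n) = gens n" by (simp add: gen_list_simps)
  thus "A (4 * n) = carrier Q" unfolding subalg_image carrier_Q FA_eq by simp
  have "fa_over (G 0) = range (fa_scal :: 'k \<Rightarrow> 'k fa)"
  proof (intro equalityI subsetI)
    fix f :: "'k fa" assume "f \<in> fa_over (G 0)"
    hence "fa_supp f \<subseteq> {[]}" unfolding fa_over_def by auto
    hence "f = fa_scal (f [])"
      by (auto simp: fa_supp_def fa_scal_def fa_smult_def fa_word_def fun_eq_iff)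
    thus "f \<in> range fa_scal" by blast
  qed (auto intro: scal_FA)
  thus "A 0 = range (\<lambda>c. sc c)" unfolding subalg_image by auto
qed

lemma basis: "ordered_monomials_basis n q"
  unfolding ordered_monomials_basis_def
proof (intro conjI ballI allI impI)
  fix f :: "'k fa" assume "f \<in> FA n"
  moreover have "G (4 * n) = gens n" by (simp add: gen_list_simps)
  ultimately have "cl f \<in> A (4 * n)" unfolding subalg_image FA_eq by simp
  then obtain h where h: "h \<in> normal_form (4 * n)" "cl f = cl h" using normal_form_span[of "4 * n"] by blast
  define S where "S = {a \<in> exps n. ord_word n a \<in> fa_supp h}"
  have S: "S \<subseteq> exps n" by (auto simp: S_def)
  have im: "ord_word n ` S = fa_supp h" using h(1) unfolding normal_form_def ord_words_ord_word S_def by auto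
  have inj: "inj_on (ord_word n) S" by (rule inj_on_subset[OF inj_ord_word S])
  have fin: "finite S" using h(1) im finite_image_iff[OF inj] by (simp add: normal_form_def)
  have "fa_sum (\<lambda>a. fa_smult (h (ord_word n a)) (fa_word (ord_word n a))) S = h"
  proof
    fix w
    have "fa_sum (\<lambda>a. fa_smult (h (ord_word n a)) (fa_word (ord_word n a))) S w =
      (\<Sum>u\<in>ord_word n ` S. if w = u then h u else 0)"
      unfolding fa_sum_def fa_smult_def fa_word_def by (subst sum.reindex[OF inj]) (auto intro!: sum.cong)
    also have "\<dots> = h w" unfolding im using h(1) by (auto simp: normal_form_def fa_supp_def)
    finally show "fa_sum (\<lambda>a. fa_smult (h (ord_word n a)) (fa_word (ord_word n a))) S w = h w" .
  qed
  thus "\<exists>S c. finite S \<and> S \<subseteq> exps n \<and>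
        cl f = cl (fa_sum (\<lambda>a. fa_smult (c a) (fa_word (ord_word n a))) S)"
    using fin S h(2) by (intro exI[of _ S] exI[of _ "\<lambda>a. h (ord_word n a)"]) simp
next
  fix S c a
  assume *: "finite S \<and> S \<subseteq> exps n \<and> fa_sum (\<lambda>a. fa_smult (c a) (fa_word (ord_word n a))) S \<in> RI"
    and a: "a \<in> S"
  let ?f = "fa_sum (\<lambda>a. fa_smult (c a) (fa_word (ord_word n a))) S"
  have inj: "inj_on (ord_word n) S" using inj_on_subset[OF inj_ord_word] * by blast
  have sub: "fa_supp ?f \<subseteq> ord_word n ` S"
  proof
    fix w assume "w \<in> fa_supp ?f"
    from subsetD[OF fa_supp_simps(5) this]
    obtain b where b: "b \<in> S" "w \<in> fa_supp (fa_smult (c b) (fa_word (ord_word n b)))" by (rule UN_E)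
    have "w \<in> {ord_word n b}" using subsetD[OF fa_supp_simps(3) b(2)] unfolding fa_supp_simps(4) .
    thus "w \<in> ord_word n ` S" using b(1) by simp
  qed
  have "ord_word n ` S \<subseteq> ordw" using ord_words_ordw[of "4 * n"] * unfolding ord_words_ord_word by blast
  hence "fa_supp ?f = {}" using * sub by (intro ordw_independent) (auto intro: finite_subset)
  hence "?f (ord_word n a) = 0" by (auto simp: fa_supp_def)
  moreover have "?f (ord_word n a) = (\<Sum>b\<in>S. if b = a then c a else 0)"
    unfolding fa_sum_def fa_smult_def fa_word_def using inj a by (intro sum.cong) (auto dest: inj_onD)
  ultimately show "c a = 0" using * a by simp
qed

end

theorem theorem5p3:
  fixes n :: nat and q :: "'k::field_char_0"
  assumes "alg_closed TYPE('k)"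
    and "q \<noteq> 0"
    and "transcendental_over_Q q"
    and "n \<ge> 3"
  shows "ordered_monomials_basis n q \<and> iterated_ore n q"
proof -
  interpret quantum_space n q by unfold_locales (use assms in auto)
  show ?thesis using basis iterated_ore by blast
qed

end
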